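(* Let $\alpha\neq 0$ and $\beta$ be real numbers. There is $\epsilon_0>0$ such that the following holds for every $0<\epsilon<\epsilon_0$. Let $s\geq -\frac{7}{4}+4\epsilon$, $b'=-\frac12+2\epsilon$ and $b=\frac12+\epsilon$. Then there is a constant $C>0$ such that for all $u_1,u_2\in X_{s,b}(\mathbb{R}^2)$, $$\|\partial_x(u_1u_2)\|_{X_{s,b'}}\leq C\,\|u_1\|_{X_{s,b}}\|u_2\|_{X_{s,b}}.$$
   Context: Let $\phi(\xi)=\alpha\xi^5-\beta\xi^3$, $\sigma=\tau+\phi(\xi)$ and $\langle\cdot\rangle=(1+|\cdot|^2)^{1/2}$. The space-time Fourier transform is $\mathscr{F}u(\xi,\tau)=\frac{1}{2\pi}\int_{\mathbb{R}^2}e^{-ix\xi-it\tau}u(x,t)\,dx\,dt$. For $s,b\in\mathbb{R}$, $X_{s,b}=X_{s,b}(\mathbb{R}^2)$ is the completion of the Schwartz functions on $\mathbb{R}^2$ with respect to the norm $\|u\|_{X_{s,b}}=\|\langle\xi\rangle^s\langle\sigma\rangle^b\mathscr{F}u(\xi,\tau)\|_{L^2_{\xi\tau}}$. As usual for such bilinear estimates, the inequality is understood for Schwartz functions $u_1,u_2$, the map $(u_1,u_2)\mapsto\partial_x(u_1u_2)$ then being extended to $X_{s,b}\times X_{s,b}$ by density. *)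

theory Defs
  imports "HOL-Analysis.Analysis"
begin

definition dx :: "(real \<times> real \<Rightarrow> complex) \<Rightarrow> real \<times> real \<Rightarrow> complex" where
  "dx f = (\<lambda>(x, t). vector_derivative (\<lambda>y. f (y, t)) (at x))"

definition dt :: "(real \<times> real \<Rightarrow> complex) \<Rightarrow> real \<times> real \<Rightarrow> complex" where
  "dt f = (\<lambda>(x, t). vector_derivative (\<lambda>r. f (x, r)) (at t))"

text \<open>Frechet differentiability of every \<open>(dt ^^ k) ((dx ^^ j) f)\<close> makes the partial derivatives
  of all orders commute (Young's theorem), so this single ordering captures smoothness and
  all mixed derivatives.\<close>

definition schwartz :: "(real \<times> real \<Rightarrow> complex) \<Rightarrow> bool" where
  "schwartz f \<longleftrightarrow>
     (\<forall>j k. (dt ^^ k) ((dx ^^ j) f) differentiable_on UNIV \<and>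
        (\<forall>m n. \<exists>M. \<forall>x t. \<bar>x\<bar> ^ m * \<bar>t\<bar> ^ n * cmod ((dt ^^ k) ((dx ^^ j) f) (x, t)) \<le> M))"

definition fourier :: "(real \<times> real \<Rightarrow> complex) \<Rightarrow> real \<times> real \<Rightarrow> complex" where
  "fourier u = (\<lambda>(\<xi>, \<tau>). complex_of_real (1 / (2 * pi)) *
     (LINT (x, t)|lborel. exp (- \<i> * complex_of_real (x * \<xi>) - \<i> * complex_of_real (t * \<tau>)) * u (x, t)))"

definition jbracket :: "real \<Rightarrow> real" where
  "jbracket y = sqrt (1 + \<bar>y\<bar> ^ 2)"

definition phi :: "real \<Rightarrow> real \<Rightarrow> real \<Rightarrow> real" where
  "phi \<alpha> \<beta> \<xi> = \<alpha> * \<xi> ^ 5 - \<beta> * \<xi> ^ 3"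

text \<open>Only meaningful on Schwartz functions, where the integrand is always integrable; the
  Bochner integral of a non-integrable function would be \<open>0\<close>.\<close>

definition xnorm ::
    "real \<Rightarrow> real \<Rightarrow> real \<Rightarrow> real \<Rightarrow> (real \<times> real \<Rightarrow> complex) \<Rightarrow> real" where
  "xnorm \<alpha> \<beta> s b u = sqrt (LINT (\<xi>, \<tau>)|lborel.
     (jbracket \<xi> powr s * jbracket (\<tau> + phi \<alpha> \<beta> \<xi>) powr b * cmod (fourier u (\<xi>, \<tau>))) ^ 2)"

text \<open>The completion \<open>X_{s,b}\<close> is the set of classes of Cauchy sequences of Schwartz functions
  modulo null sequences; the norm of a class is the limit of the norms along any representative.\<close>

definition xcauchy ::
    "real \<Rightarrow> real \<Rightarrow> real \<Rightarrow> real \<Rightarrow> (nat \<Rightarrow> real \<times> real \<Rightarrow> complex) set" where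
  "xcauchy \<alpha> \<beta> s b = {U. (\<forall>n. schwartz (U n)) \<and>
     (\<forall>e>0. \<exists>N. \<forall>m\<ge>N. \<forall>n\<ge>N. xnorm \<alpha> \<beta> s b (\<lambda>p. U m p - U n p) < e)}"

definition xequiv ::
    "real \<Rightarrow> real \<Rightarrow> real \<Rightarrow> real \<Rightarrow> (nat \<Rightarrow> real \<times> real \<Rightarrow> complex) rel" where
  "xequiv \<alpha> \<beta> s b = {(U, V). U \<in> xcauchy \<alpha> \<beta> s b \<and> V \<in> xcauchy \<alpha> \<beta> s b \<and>
     (\<lambda>n. xnorm \<alpha> \<beta> s b (\<lambda>p. U n p - V n p)) \<longlonglongrightarrow> 0}"

definition xspace ::
    "real \<Rightarrow> real \<Rightarrow> real \<Rightarrow> real \<Rightarrow> (nat \<Rightarrow> real \<times> real \<Rightarrow> complex) set set" where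
  "xspace \<alpha> \<beta> s b = xcauchy \<alpha> \<beta> s b // xequiv \<alpha> \<beta> s b"

definition xspace_norm ::
    "real \<Rightarrow> real \<Rightarrow> real \<Rightarrow> real \<Rightarrow> (nat \<Rightarrow> real \<times> real \<Rightarrow> complex) set \<Rightarrow> real" where
  "xspace_norm \<alpha> \<beta> s b c = (THE l. \<forall>U\<in>c. (\<lambda>n. xnorm \<alpha> \<beta> s b (U n)) \<longlonglongrightarrow> l)"

text \<open>The graph of the extension by density of \<open>(u\<^sub>1, u\<^sub>2) \<mapsto> \<partial>\<^sub>x (u\<^sub>1 u\<^sub>2)\<close>: requiring that
  every choice of representatives lands in the same class \<open>w\<close> makes the extension
  well defined and determines \<open>w\<close>.\<close>

definition dx_prod_extends ::
    "(nat \<Rightarrow> real \<times> real \<Rightarrow> complex) set \<Rightarrow> (nat \<Rightarrow> real \<times> real \<Rightarrow> complex) set \<Rightarrow>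
     (nat \<Rightarrow> real \<times> real \<Rightarrow> complex) set \<Rightarrow> bool" where
  "dx_prod_extends u1 u2 w \<longleftrightarrow>
     (\<forall>U1\<in>u1. \<forall>U2\<in>u2. (\<lambda>n. dx (\<lambda>p. U1 n p * U2 n p)) \<in> w)"

end

theory Submission
  imports Defs "HOL-Probability.Probability"
begin

text \<open>
  On the Fourier side the estimate is a trilinear inequality, proved by Cauchy-Schwarz in the style
  of Kenig, Ponce and Vega. With \<open>\<sigma>\<close>, \<open>\<sigma>\<^sub>1\<close>, \<open>\<sigma>\<^sub>2\<close> the modulations of the output and of the two
  inputs, \<open>\<sigma> - \<sigma>\<^sub>1 - \<sigma>\<^sub>2 = \<phi>(\<xi>\<^sub>1 + \<xi>\<^sub>2) - \<phi>(\<xi>\<^sub>1) - \<phi>(\<xi>\<^sub>2)\<close> factors as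
  \<open>\<xi> \<xi>\<^sub>1 \<xi>\<^sub>2 (5\<alpha>(\<xi>\<^sub>1\<^sup>2 + \<xi>\<^sub>1\<xi>\<^sub>2 + \<xi>\<^sub>2\<^sup>2) - 3\<beta>)\<close>, so the largest modulation dominates
  \<open>\<bar>\<xi> \<xi>\<^sub>1 \<xi>\<^sub>2\<bar> max(\<bar>\<xi>\<^sub>1\<bar>, \<bar>\<xi>\<^sub>2\<bar>)\<^sup>2\<close> at high frequency. One freezes the variable carrying it. The square
  of the multiplier is then at most the derivative of the remaining phase
  \<open>x \<mapsto> \<tau> + \<phi>(x) + \<phi>(\<xi> - x)\<close>, up to a term supported where that derivative degenerates, and a
  change of variables bounds the integral. The loss \<open>N powr (7 - 16\<epsilon>)\<close> of the weights at
  \<open>s = -7/4 + 4\<epsilon>\<close> is exactly balanced in the high-high to low interaction when \<open>\<sigma>\<close> dominates.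
\<close>

subsection \<open>One-dimensional integrals\<close>

text \<open>Freezing one point leaves an integral over a frequency and a modulation. The modulation
  integral is taken against two weights with one common exponent above 1, namely
  \<open>2 * b = 1 + 2 * \<epsilon>\<close>. The output weight supplies only
  \<open>1 - 4 * \<epsilon>\<close>: harmless when the output is frozen, too little when an input
  is. In that case \<open>8 * \<epsilon>\<close> of the dominant input weight is moved to the
  output, so only the power \<open>1 - 6 * \<epsilon>\<close> of the resonance can be spent. Hence
  the high-frequency bound comes in two versions.

  At high frequency, near the critical point of the phase, all three frequencies are comparable; the
  weights then leave a power of the frequency below 1, which a tall indicator on a short interval
  absorbs.

  Duality is avoided by using the weighted transform of the output itself as the third function. Its
  norm is finite for Schwartz data and cancels. The convolution theorem is needed only as an
  inequality between moduli.\<close>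

lemma jbracket_ge_1: "jbracket y \<ge> 1"
  by (simp add: jbracket_def)

lemma jbracket_pos [simp]: "jbracket y > 0"
  using jbracket_ge_1[of y] by linarith

lemma jbracket_nz [simp]: "jbracket y \<noteq> 0"
  using jbracket_pos[of y] by linarith

lemma jbracket_power2: "jbracket y ^ 2 = 1 + y ^ 2"
  by (simp add: jbracket_def)

lemma abs_le_jbracket: "\<bar>y\<bar> \<le> jbracket y"
  unfolding jbracket_def by (rule real_le_rsqrt) simp

lemma jbracket_le: "jbracket y \<le> 1 + \<bar>y\<bar>"
  unfolding jbracket_def by (rule real_le_lsqrt) (auto simp: power2_eq_square algebra_simps)

lemma jbracket_mono: "\<bar>x\<bar> \<le> \<bar>y\<bar> \<Longrightarrow> jbracket x \<le> jbracket y"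
  unfolding jbracket_def by (simp add: abs_le_square_iff)

lemma jbracket_minus [simp]: "jbracket (- y) = jbracket y"
  by (simp add: jbracket_def)

lemma continuous_on_jbracket [continuous_intros]:
  "continuous_on A f \<Longrightarrow> continuous_on A (\<lambda>x. jbracket (f x))"
  unfolding jbracket_def by (intro continuous_intros)

lemma measurable_jbracket [measurable]: "jbracket \<in> borel_measurable borel"
  by (intro borel_measurable_continuous_onI continuous_intros)

lemma jbracket_scale: assumes "c \<ge> 1" "\<bar>x\<bar> \<le> c * \<bar>y\<bar>" shows "jbracket x \<le> c * jbracket y"
proof -
  have "jbracket x ^ 2 \<le> (c * jbracket y) ^ 2"
    using power_mono[OF assms(2), of 2] one_le_power[OF assms(1), of 2]
    by (simp add: jbracket_power2 power_mult_distrib algebra_simps)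
  then show ?thesis
    by (rule power2_le_imp_le) (use assms(1) jbracket_pos[of y] in \<open>simp add: less_imp_le\<close>)
qed

text \<open>A crude Peetre inequality. It carries weights from one frequency to another, both to
  drop the weight of a small frequency and to reduce larger \<open>s\<close> to the
  endpoint.\<close>

lemma jbracket_add_le_mult: "jbracket (x + y) \<le> 2 * jbracket x * jbracket y"
proof -
  have "0 \<le> (x - y) ^ 2" "0 \<le> (x * y) ^ 2" "0 \<le> x ^ 2" "0 \<le> y ^ 2" by simp_all
  then have "1 + (x + y) ^ 2 \<le> 4 * (1 + x ^ 2) * (1 + y ^ 2)"
    unfolding power_mult_distrib power2_sum power2_diff distrib_left distrib_right by linarith
  then have "jbracket (x + y) ^ 2 \<le> (2 * jbracket x * jbracket y) ^ 2"
    unfolding power_mult_distrib jbracket_power2 by simp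
  then show ?thesis
    by (rule power2_le_imp_le) (use jbracket_pos[of x] jbracket_pos[of y] in \<open>simp add: less_imp_le\<close>)
qed

lemma jbracket_powr_le_1: "a \<ge> 0 \<Longrightarrow> jbracket y powr - a \<le> 1"
  using powr_mono[of "-a" 0 "jbracket y"] jbracket_ge_1[of y] by simp

lemma nn_integral_jbracket_powr_finite:
  assumes a: "a > 1"
  shows "(\<integral>\<^sup>+y. ennreal (jbracket y powr - a) \<partial>lborel) < \<infinity>"
proof -
  have nz: "x > -1 \<Longrightarrow> (1 + x) powr - a = inverse ((1 + x) powr a)" for x :: real
    by (simp add: powr_minus)
  let ?F = "\<lambda>y::real. - ((1 + y) powr (1 - a)) / (a - 1)"
  let ?f = "\<lambda>y::real. (1 + y) powr - a"
  have lim: "(?F \<longlongrightarrow> - 0 / (a - 1)) at_top"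
    using a by (intro tendsto_intros tendsto_neg_powr filterlim_tendsto_add_at_top[OF tendsto_const filterlim_ident]) auto
  have der: "(?F has_real_derivative ?f x) (at x)" if "0 \<le> x" for x
  proof -
    have "(?F has_real_derivative - ((1 - a) * (1 + x) powr (1 - a - 1)) / (a - 1)) (at x)"
      using that a by (auto intro!: derivative_eq_intros)
    also have "- ((1 - a) * (1 + x) powr (1 - a - 1)) / (a - 1) = ?f x"
    proof -
      have "- ((1 - a) * (1 + x) powr (1 - a - 1)) = (a - 1) * ?f x" by (simp add: algebra_simps)
      moreover have "a - 1 \<noteq> 0" using a by simp
      ultimately show ?thesis by (metis nonzero_mult_div_cancel_left)
    qed
    finally show ?thesis .
  qed
  have "(\<integral>\<^sup>+x. ennreal (?f x) * indicator {0 ..} x \<partial>lborel) = ennreal (- 0 / (a - 1) - ?F 0)"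
    by (rule nn_integral_FTC_atLeast[OF _ _ _ lim])
       (use der in auto)
  then have fin: "(\<integral>\<^sup>+x. ennreal (?f x) * indicator {0 ..} x \<partial>lborel) < \<infinity>" by simp
  have half: "(\<integral>\<^sup>+x. ennreal (?f (-x)) * indicator {0 ..} (-x) \<partial>lborel)
      = (\<integral>\<^sup>+x. ennreal (?f x) * indicator {0 ..} x \<partial>lborel)"
    by (subst nn_integral_real_affine[where c="-1" and t=0]) auto
  have pw: "ennreal (jbracket y powr - a) \<le> ennreal (2 powr a) *
      (ennreal (?f y) * indicator {0 ..} y + ennreal (?f (-y)) * indicator {0 ..} (-y))" for y
  proof -
    have "1 + \<bar>y\<bar> \<le> jbracket y + jbracket y" by (intro add_mono jbracket_ge_1 abs_le_jbracket)
    then have "(1 + \<bar>y\<bar>) / 2 \<le> jbracket y" by simp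
    then have "jbracket y powr - a \<le> ((1 + \<bar>y\<bar>) / 2) powr - a"
      using a by (intro powr_mono2') auto
    also have "\<dots> = 2 powr a * (1 + \<bar>y\<bar>) powr - a"
      by (simp add: powr_divide powr_minus field_simps)
    finally have "ennreal (jbracket y powr - a) \<le> ennreal (2 powr a) * ennreal ((1 + \<bar>y\<bar>) powr - a)"
      by (simp add: ennreal_mult[symmetric] ennreal_leI)
    also have "\<dots> \<le> ennreal (2 powr a) *
      (ennreal (?f y) * indicator {0 ..} y + ennreal (?f (-y)) * indicator {0 ..} (-y))"
      by (intro mult_left_mono) (cases "y \<ge> 0", auto)
    finally show ?thesis .
  qed
  have "(\<integral>\<^sup>+y. ennreal (jbracket y powr - a) \<partial>lborel) \<le> (\<integral>\<^sup>+y. ennreal (2 powr a) *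
      (ennreal (?f y) * indicator {0 ..} y + ennreal (?f (-y)) * indicator {0 ..} (-y)) \<partial>lborel)"
    by (intro nn_integral_mono pw)
  also have "\<dots> = ennreal (2 powr a) * ((\<integral>\<^sup>+x. ennreal (?f x) * indicator {0 ..} x \<partial>lborel)
     + (\<integral>\<^sup>+x. ennreal (?f x) * indicator {0 ..} x \<partial>lborel))"
    by (subst nn_integral_cmult, measurable, subst nn_integral_add, measurable, subst half) simp
  also have "\<dots> < \<infinity>" using fin by (auto simp: ennreal_mult_less_top ennreal_add_less_top)
  finally show ?thesis .
qed

text \<open>At every \<open>t\<close> the two arguments differ by \<open>u - v\<close>, so the
  larger bracket is at least half of \<open>jbracket (u - v)\<close> and its power leaves the
  integral. The other factor is at most the sum of both weights, which are translates with the same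
  integral.\<close>

lemma jbracket_powr_conv:
  assumes a: "a > 1"
  shows "(\<integral>\<^sup>+t. ennreal (jbracket (t + u) powr - a * jbracket (t + v) powr - a) \<partial>lborel)
    \<le> 2 * ennreal (2 powr a) * (\<integral>\<^sup>+y. ennreal (jbracket y powr - a) \<partial>lborel) * ennreal (jbracket (u - v) powr - a)"
    (is "?L \<le> _ * ?I * _")
proof -
  have tr: "(\<integral>\<^sup>+t. ennreal (jbracket (t + u) powr - a) \<partial>lborel) = ?I" for u
    by (subst nn_integral_real_affine[where c=1 and t="-u"]) auto
  have key: "x powr - a * y powr - a \<le> 2 powr a * z powr - a * (x powr - a + y powr - a)"
    if "x > 0" "y > 0" "z > 0" "z \<le> 2 * max x y" for x y z :: real
  proof -
    have "(max x y) powr - a \<le> (z / 2) powr - a"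
      using that a by (intro powr_mono2') auto
    also have "\<dots> = 2 powr a * z powr - a"
      using that by (simp add: powr_divide powr_minus field_simps)
    finally have 1: "(max x y) powr - a \<le> 2 powr a * z powr - a" .
    have "x powr - a * y powr - a = (max x y) powr - a * (min x y) powr - a"
      by (auto simp: max_def min_def)
    also have "\<dots> \<le> (2 powr a * z powr - a) * (x powr - a + y powr - a)"
      using 1 by (intro mult_mono) (auto simp: min_def)
    finally show ?thesis .
  qed
  have "jbracket (u - v) \<le> 2 * max (jbracket (t + u)) (jbracket (t + v))" for t
  proof -
    have "jbracket (u - v) \<le> 2 * jbracket (max \<bar>t + u\<bar> \<bar>t + v\<bar>)"
    proof (rule jbracket_scale)
      have "\<bar>u - v\<bar> \<le> \<bar>t + u\<bar> + \<bar>t + v\<bar>" by linarith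
      also have "\<dots> \<le> 2 * max \<bar>t + u\<bar> \<bar>t + v\<bar>" by (simp add: max_def)
      also have "\<dots> \<le> 2 * \<bar>max \<bar>t + u\<bar> \<bar>t + v\<bar>\<bar>" by simp
      finally show "\<bar>u - v\<bar> \<le> 2 * \<bar>max \<bar>t + u\<bar> \<bar>t + v\<bar>\<bar>" .
    qed simp
    also have "jbracket (max \<bar>t + u\<bar> \<bar>t + v\<bar>) \<le> max (jbracket (t + u)) (jbracket (t + v))"
      using jbracket_mono[of "max \<bar>t + u\<bar> \<bar>t + v\<bar>" "t+u"] jbracket_mono[of "max \<bar>t + u\<bar> \<bar>t + v\<bar>" "t+v"]
      by (cases "\<bar>t + u\<bar> \<le> \<bar>t + v\<bar>") (auto simp: max_def split: if_splits)
    finally show ?thesis by simp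
  qed
  then have "?L \<le> (\<integral>\<^sup>+t. ennreal (2 powr a * jbracket (u - v) powr - a *
       (jbracket (t + u) powr - a + jbracket (t + v) powr - a)) \<partial>lborel)"
    by (intro nn_integral_mono ennreal_leI key) auto
  also have "\<dots> = ennreal (2 powr a * jbracket (u - v) powr - a) * (?I + ?I)"
    by (subst ennreal_mult, simp, simp, subst nn_integral_cmult, measurable)
       (simp add: ennreal_plus nn_integral_add tr)
  finally show ?thesis by (simp add: ennreal_mult mult_ac distrib_left mult_2_right[symmetric] flip: mult_2)
qed

text \<open>Change of variables for a \<open>g\<close> that need not be monotone: on an interval
  with no zero of \<open>g'\<close> inside, \<open>g\<close> is monotone and the integral is at most
  that of \<open>f\<close>. If \<open>n\<close> points of \<open>Z\<close> lie inside, they cut the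
  interval into \<open>n + 1\<close> such pieces; the induction splits at an arbitrary one of
  them.\<close>

lemma nn_integral_comp_deriv_interval:
  fixes f :: "real \<Rightarrow> ennreal" and g g' :: "real \<Rightarrow> real"
  assumes f [measurable]: "f \<in> borel_measurable borel"
    and g: "\<And>x. (g has_real_derivative g' x) (at x)"
    and g': "continuous_on UNIV g'"
    and "finite Z" "\<And>x. g' x = 0 \<Longrightarrow> x \<in> Z"
    and "card (Z \<inter> {c<..<d}) \<le> n"
  shows "(\<integral>\<^sup>+x. ennreal \<bar>g' x\<bar> * f (g x) * indicator {c..d} x \<partial>lborel)
    \<le> of_nat (Suc n) * (\<integral>\<^sup>+x. f x \<partial>lborel)"
  using assms(6)
proof (induction n arbitrary: c d rule: less_induct)
  case (less n)
  have [measurable]: "g \<in> borel_measurable borel" "g' \<in> borel_measurable borel"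
    using g' g by (auto intro!: borel_measurable_continuous_onI continuous_at_imp_continuous_on
        DERIV_isCont)
  show ?case
  proof (cases "Z \<inter> {c<..<d} = {}")
    case True
    show ?thesis
    proof (cases "c < d")
      case False
      then have "(\<integral>\<^sup>+x. ennreal \<bar>g' x\<bar> * f (g x) * indicator {c..d} x \<partial>lborel) =
         (\<integral>\<^sup>+x. ennreal \<bar>g' c\<bar> * f (g c) * indicator {c..d} x \<partial>lborel)"
        using False by (intro nn_integral_cong) (auto simp: indicator_def dest!: antisym)
      also have "\<dots> = 0" using False by (cases "c = d") (simp_all add: nn_integral_cmult_indicator)
      finally show ?thesis by simp
    next
      case cd: True
      have nz: "g' x \<noteq> 0" if "x \<in> {c<..<d}" for x using True assms(5)[of x] that by blast
      have 1: "(\<forall>x\<in>{c<..<d}. g' x > 0) \<or> (\<forall>x\<in>{c<..<d}. g' x < 0)"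
      proof (rule ccontr)
        assume "\<not> ?thesis"
        then obtain x y where xy: "x \<in> {c<..<d}" "y \<in> {c<..<d}" "g' x < 0" "g' y > 0"
          using nz by (metis linorder_less_linear)
        have "connected (g' ` {c<..<d})"
          by (intro connected_continuous_image continuous_on_subset[OF g']) auto
        then have "0 \<in> g' ` {c<..<d}"
          using connectedD_interval[of "g' ` {c<..<d}" "g' x" "g' y" 0] xy by auto
        then show False using nz by auto
      qed
      have cl: "closure {c<..<d} = {c..d}" using cd by simp
      \<comment> \<open>The substitution rule wants the sign of \<open>g'\<close> on the closed
        interval, including endpoints where \<open>g'\<close> may vanish.\<close>
      have ext: "\<forall>x\<in>{c..d}. s * g' x \<ge> 0" if "\<forall>x\<in>{c<..<d}. s * g' x > 0" for s :: real
      proof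
        fix x assume "x \<in> {c..d}"
        then have "x \<in> closure {c<..<d}" using cl by simp
        have cont: "continuous_on (closure {c<..<d}) (\<lambda>x. s * g' x)"
          by (intro continuous_on_mult continuous_on_const continuous_on_subset[OF g'] subset_UNIV)
        show "s * g' x \<ge> 0"
          by (rule continuous_ge_on_closure[OF cont \<open>x \<in> closure {c<..<d}\<close>]) (simp add: that less_imp_le)
      qed
      \<comment> \<open>The sign \<open>s\<close> makes \<open>s * g\<close> nondecreasing. As
        \<open>s * s = 1\<close>, the integrand can be rewritten with
        \<open>f (s * (s * g x))\<close>, and reflecting by \<open>s\<close> does not change the
        integral of \<open>f\<close>.\<close>
      obtain s :: real where s: "\<bar>s\<bar> = 1" "\<forall>x\<in>{c<..<d}. s * g' x > 0"
        using 1
      proof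
        assume "\<forall>x\<in>{c<..<d}. g' x > 0" then show ?thesis using that[of 1] by auto
      next
        assume "\<forall>x\<in>{c<..<d}. g' x < 0" then show ?thesis using that[of "-1"] by auto
      qed
      have sg: "\<forall>x\<in>{c..d}. s * g' x \<ge> 0" by (rule ext[OF s(2)])
      have ab: "\<bar>g' x\<bar> = s * g' x" if "x \<in> {c..d}" for x
        using abs_mult[of s "g' x"] sg[rule_format, OF that] s(1) by simp
      have "s * s = 1" using abs_mult_self_eq[of s] s(1) by simp
      then have ss: "s * (s * x) = x" for x by (metis mult.assoc mult_1)
      have "(\<integral>\<^sup>+x. ennreal \<bar>g' x\<bar> * f (g x) * indicator {c..d} x \<partial>lborel) =
         (\<integral>\<^sup>+x. f (s * (s * g x)) * ennreal (s * g' x) * indicator {c..d} x \<partial>lborel)"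
        by (intro nn_integral_cong) (auto simp: indicator_def ab ss mult_ac)
      also have "\<dots> = (\<integral>\<^sup>+x. f (s * x) * indicator {s * g c..s * g d} x \<partial>lborel)"
      proof (rule nn_integral_substitution_aux[symmetric])
        show "((\<lambda>x. s * g x) has_real_derivative s * g' x) (at x)" for x
          by (rule DERIV_cmult[OF g])
        show "continuous_on {c..d} (\<lambda>x. s * g' x)"
          by (intro continuous_on_mult continuous_on_const continuous_on_subset[OF g'] subset_UNIV)
      qed (use sg cd in auto)
      also have "\<dots> \<le> (\<integral>\<^sup>+x. f (0 + s * x) \<partial>lborel)"
        by (intro nn_integral_mono) (auto simp: indicator_def)
      also have "\<dots> = (\<integral>\<^sup>+x. f x \<partial>lborel)"
        using s(1) by (subst (2) nn_integral_real_affine[where c=s and t=0]) auto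
      also have "\<dots> \<le> of_nat (Suc n) * (\<integral>\<^sup>+x. f x \<partial>lborel)"
        using mult_right_mono[of 1 "of_nat (Suc n) :: ennreal" "\<integral>\<^sup>+x. f x \<partial>lborel"] by simp
      finally show ?thesis .
    qed
  next
    case False
    then obtain z where z: "z \<in> Z" "c < z" "z < d" by auto
    let ?A = "Z \<inter> {c<..<z}" and ?B = "Z \<inter> {z<..<d}"
    \<comment> \<open>The split point \<open>z\<close> lies inside neither half, which compensates
      for the extra piece: \<open>Suc (card ?A) + Suc (card ?B)\<close> is at most
      \<open>Suc n\<close>.\<close>
    have "card (insert z (?A \<union> ?B)) \<le> card (Z \<inter> {c<..<d})"
      using assms(4) z by (intro card_mono) auto
    also have "card (insert z (?A \<union> ?B)) = Suc (card ?A + card ?B)"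
      using assms(4) z by (subst card_insert_disjoint) (auto intro!: card_Un_disjoint)
    finally have c: "Suc (card ?A + card ?B) \<le> n" using less.prems by linarith
    let ?F = "\<lambda>S. (\<integral>\<^sup>+x. ennreal \<bar>g' x\<bar> * f (g x) * indicator S x \<partial>lborel)"
    have "?F {c..d} \<le> (\<integral>\<^sup>+x. ennreal \<bar>g' x\<bar> * f (g x) * indicator {c..z} x + ennreal \<bar>g' x\<bar> * f (g x) * indicator {z..d} x \<partial>lborel)"
      by (intro nn_integral_mono) (auto simp: indicator_def)
    also have "\<dots> = ?F {c..z} + ?F {z..d}"
      by (intro nn_integral_add) auto
    also have "\<dots> \<le> of_nat (Suc (card ?A)) * (\<integral>\<^sup>+x. f x \<partial>lborel) + of_nat (Suc (card ?B)) * (\<integral>\<^sup>+x. f x \<partial>lborel)"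
      using c by (intro add_mono less.IH) auto
    also have "\<dots> = of_nat (Suc (card ?A) + Suc (card ?B)) * (\<integral>\<^sup>+x. f x \<partial>lborel)"
      by (simp add: distrib_right)
    also have "\<dots> \<le> of_nat (Suc n) * (\<integral>\<^sup>+x. f x \<partial>lborel)"
      using c by (intro mult_right_mono of_nat_mono) auto
    finally show ?thesis .
  qed
qed

text \<open>The bound on intervals does not depend on the interval, so it survives exhausting the
  line by symmetric intervals.\<close>

lemma nn_integral_comp_deriv:
  fixes f :: "real \<Rightarrow> ennreal" and g g' :: "real \<Rightarrow> real"
  assumes f [measurable]: "f \<in> borel_measurable borel"
    and g: "\<And>x. (g has_real_derivative g' x) (at x)"
    and g': "continuous_on UNIV g'"
    and Z: "finite Z" "\<And>x. g' x = 0 \<Longrightarrow> x \<in> Z" "card Z \<le> n"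
  shows "(\<integral>\<^sup>+x. ennreal \<bar>g' x\<bar> * f (g x) \<partial>lborel) \<le> of_nat (Suc n) * (\<integral>\<^sup>+x. f x \<partial>lborel)"
proof -
  have [measurable]: "g \<in> borel_measurable borel" "g' \<in> borel_measurable borel"
    using g' g by (auto intro!: borel_measurable_continuous_onI continuous_at_imp_continuous_on
        DERIV_isCont)
  let ?h = "\<lambda>k::nat. \<lambda>x. ennreal \<bar>g' x\<bar> * f (g x) * indicator {-real k..real k} x"
  have sup: "ennreal \<bar>g' x\<bar> * f (g x) = (SUP k. ?h k x)" for x
  proof (rule antisym)
    obtain k :: nat where "\<bar>x\<bar> \<le> real k" using real_arch_simple by blast
    then have "ennreal \<bar>g' x\<bar> * f (g x) = ?h k x" by (auto simp: indicator_def)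
    then show "ennreal \<bar>g' x\<bar> * f (g x) \<le> (SUP k. ?h k x)" using SUP_upper[of k UNIV "\<lambda>k. ?h k x"] by simp
  qed (auto intro!: SUP_least simp: indicator_def)
  have "(\<integral>\<^sup>+x. ennreal \<bar>g' x\<bar> * f (g x) \<partial>lborel) = (SUP k. integral\<^sup>N lborel (?h k))"
  proof -
    have "integral\<^sup>N lborel (\<lambda>x. SUP k. ?h k x) = (SUP k. integral\<^sup>N lborel (?h k))"
      by (rule nn_integral_monotone_convergence_SUP) (auto simp: incseq_def le_fun_def indicator_def)
    then show ?thesis using sup by simp
  qed
  also have "\<dots> \<le> of_nat (Suc n) * (\<integral>\<^sup>+x. f x \<partial>lborel)"
  proof (intro SUP_least nn_integral_comp_deriv_interval[OF f g g' Z(1,2)])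
    show "card (Z \<inter> {- real k<..<real k}) \<le> n" for k
      using Z card_mono[of Z "Z \<inter> {- real k<..<real k}"] by auto
  qed auto
  finally show ?thesis .
qed

subsection \<open>Pointwise bounds for the frequency multiplier\<close>

text \<open>The threshold \<open>1 / 100\<close> is only convenient. The tightest demand on
  \<open>\<epsilon>\<close> comes from \<open>freq_mult_high'\<close>, where
  \<open>1 / 2 + 22 * \<epsilon>\<close> must not exceed 1.\<close>

locale kawahara =
  fixes \<alpha> \<beta> \<epsilon> :: real
  assumes alpha: "\<alpha> \<noteq> 0" and eps_pos: "0 < \<epsilon>" and eps_le: "\<epsilon> \<le> 1 / 100"
begin

definition resonance :: "real \<Rightarrow> real \<Rightarrow> real" where
  "resonance a b = phi \<alpha> \<beta> (a + b) - phi \<alpha> \<beta> a - phi \<alpha> \<beta> b"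

text \<open>The derivative of \<open>phi\<close> at \<open>a\<close> minus that at \<open>b\<close>,
  factored so that its size and its zeros can be read off.\<close>

definition dphi_diff :: "real \<Rightarrow> real \<Rightarrow> real" where
  "dphi_diff a b = (a - b) * (a + b) * (5 * \<alpha> * (a ^ 2 + b ^ 2) - 3 * \<beta>)"

text \<open>Above this threshold the quintic part of \<open>phi\<close> dominates the cubic one: the
  12 makes \<open>3 * \<bar>\<beta>\<bar>\<close> at most a quarter of
  \<open>\<bar>\<alpha>\<bar> * N ^ 2\<close>.\<close>

definition freq0 :: real where "freq0 = 2 + 12 * \<bar>\<beta>\<bar> / \<bar>\<alpha>\<bar>"

text \<open>\<open>wexp = - 2 * s\<close> at the endpoint \<open>s = - 7 / 4 + 4 * \<epsilon>\<close>; larger \<open>s\<close> is reduced to it.\<close>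

definition wexp :: real where "wexp = 7 / 2 - 8 * \<epsilon>"

text \<open>The squared frequency part of the multiplier at the endpoint, for input frequencies
  \<open>a\<close> and \<open>b\<close>. The factor \<open>(a + b) ^ 2\<close> comes from the
  \<open>x\<close>-derivative.\<close>

definition freq_mult :: "real \<Rightarrow> real \<Rightarrow> real" where
  "freq_mult a b = (a + b) ^ 2 * jbracket (a + b) powr - wexp * jbracket a powr wexp * jbracket b powr wexp"

text \<open>The region in which \<open>freq_mult\<close> is bounded by \<open>kern\<close> without
  spending any power of the resonance.\<close>

definition low :: "real \<Rightarrow> real \<Rightarrow> bool" where
  "low a b \<longleftrightarrow> \<bar>a\<bar> \<le> 1 \<or> \<bar>b\<bar> \<le> 1 \<or> max \<bar>a\<bar> \<bar>b\<bar> \<le> freq0"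

text \<open>\<open>dphi_diff x (c - x)\<close> is the derivative of \<open>x \<mapsto> \<phi> x + \<phi> (c - x)\<close>; the second summand covers
  its critical point \<open>x = c / 2\<close>, on an interval short enough to have unit mass.\<close>

definition kern :: "real \<Rightarrow> real \<Rightarrow> real" where
  "kern c x = \<bar>dphi_diff x (c - x)\<bar> + (1 + \<bar>c\<bar>) * indicator {x. \<bar>2 * x - c\<bar> * (1 + \<bar>c\<bar>) \<le> 1} x
     + indicator {-freq0..freq0} x"

lemma resonance_eq: "resonance a b = a * b * (a + b) * (5 * \<alpha> * (a ^ 2 + a * b + b ^ 2) - 3 * \<beta>)"
  unfolding resonance_def phi_def by algebra

lemma freq0_ge: "freq0 \<ge> 2"
  by (simp add: freq0_def)

lemma kern_nonneg: "kern c x \<ge> 0"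
  by (simp add: kern_def)

lemma beta_le:
  assumes "N \<ge> freq0" shows "12 * \<bar>\<beta>\<bar> \<le> \<bar>\<alpha>\<bar> * N ^ 2"
proof -
  have "N \<ge> 2" using assms freq0_ge by linarith
  then have "N \<le> N ^ 2" by (simp add: power2_eq_square)
  have "12 * \<bar>\<beta>\<bar> = \<bar>\<alpha>\<bar> * (12 * \<bar>\<beta>\<bar> / \<bar>\<alpha>\<bar>)" using alpha by simp
  also have "\<dots> \<le> \<bar>\<alpha>\<bar> * N" using assms by (intro mult_left_mono) (auto simp: freq0_def)
  also have "\<dots> \<le> \<bar>\<alpha>\<bar> * N ^ 2" using \<open>N \<le> N ^ 2\<close> by (intro mult_left_mono) auto
  finally show ?thesis .
qed

text \<open>The first term is at least 5/4 of \<open>\<bar>\<alpha>\<bar> * N ^ 2\<close> and the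
  \<open>\<beta>\<close> term removes at most 1/4 of it. The weak hypothesis on \<open>z\<close> is
  met by the quadratic forms of both the resonance and the phase derivative.\<close>

lemma quad_lower:
  assumes "N \<ge> freq0" "z \<ge> N ^ 2 / 4"
  shows "\<bar>5 * \<alpha> * z - 3 * \<beta>\<bar> \<ge> \<bar>\<alpha>\<bar> * N ^ 2"
proof -
  have "\<bar>5 * \<alpha> * z\<bar> = 5 * (\<bar>\<alpha>\<bar> * z)"
    using assms order_trans[OF _ assms(2), of 0] by (simp add: abs_mult)
  moreover have "\<bar>\<alpha>\<bar> * z \<ge> \<bar>\<alpha>\<bar> * (N ^ 2 / 4)" using assms by (intro mult_left_mono) auto
  moreover have "\<bar>3 * \<beta>\<bar> = 3 * \<bar>\<beta>\<bar>" by (simp add: abs_mult)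
  ultimately show ?thesis
    using beta_le[OF assms(1)] abs_triangle_ineq2[of "5 * \<alpha> * z" "3 * \<beta>"] by simp
qed

text \<open>The form \<open>a ^ 2 + a * b + b ^ 2\<close> is positive definite: completing the
  square in one variable leaves 3/4 of the square of the other, so opposite signs of
  \<open>a\<close> and \<open>b\<close> cannot make it small.\<close>

lemma resonance_lower:
  assumes "max \<bar>a\<bar> \<bar>b\<bar> \<ge> freq0"
  shows "\<bar>resonance a b\<bar> \<ge> \<bar>\<alpha>\<bar> * (\<bar>a + b\<bar> * \<bar>a\<bar> * \<bar>b\<bar>) * (max \<bar>a\<bar> \<bar>b\<bar>) ^ 2"
proof -
  let ?N = "max \<bar>a\<bar> \<bar>b\<bar>"
  have "a ^ 2 + a * b + b ^ 2 = (a / 2 + b) ^ 2 + 3 / 4 * a ^ 2"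
       "a ^ 2 + a * b + b ^ 2 = (b / 2 + a) ^ 2 + 3 / 4 * b ^ 2"
    by (simp_all add: power2_eq_square algebra_simps)
  then have "3 / 4 * a ^ 2 \<le> a ^ 2 + a * b + b ^ 2" "3 / 4 * b ^ 2 \<le> a ^ 2 + a * b + b ^ 2"
    using zero_le_power2[of "a / 2 + b"] zero_le_power2[of "b / 2 + a"] by linarith+
  then have "a ^ 2 + a * b + b ^ 2 \<ge> ?N ^ 2 / 4"
  proof (cases "\<bar>a\<bar> \<le> \<bar>b\<bar>")
    case True
    then have "?N ^ 2 = b ^ 2" by (simp add: max_def)
    then show ?thesis using \<open>3 / 4 * b ^ 2 \<le> _\<close> zero_le_power2[of b] by linarith
  next
    case False
    then have "?N ^ 2 = a ^ 2" by (simp add: max_def)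
    then show ?thesis using \<open>3 / 4 * a ^ 2 \<le> _\<close> zero_le_power2[of a] by linarith
  qed
  from mult_left_mono[OF quad_lower[OF assms this], of "\<bar>a\<bar> * \<bar>b\<bar> * \<bar>a + b\<bar>"]
  show ?thesis unfolding resonance_eq abs_mult by (simp add: mult_ac)
qed

text \<open>\<open>N\<close> is decoupled from the arguments because the bound is also applied to
  the output frequency and a negated input frequency, whose maximum is only known to be at least
  half of the largest input.\<close>

lemma dphi_diff_lower:
  assumes "N \<ge> freq0" "max \<bar>a\<bar> \<bar>b\<bar> \<ge> N / 2"
  shows "\<bar>dphi_diff a b\<bar> \<ge> \<bar>\<alpha>\<bar> * (\<bar>a - b\<bar> * \<bar>a + b\<bar>) * N ^ 2"
proof -
  have "(N / 2) ^ 2 \<le> (max \<bar>a\<bar> \<bar>b\<bar>) ^ 2" using assms freq0_ge by (intro power_mono) auto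
  also have "\<dots> \<le> a ^ 2 + b ^ 2" by (auto simp: max_def)
  finally have "a ^ 2 + b ^ 2 \<ge> N ^ 2 / 4" by (simp add: power_divide)
  from mult_left_mono[OF quad_lower[OF assms(1) this], of "\<bar>a - b\<bar> * \<bar>a + b\<bar>"]
  show ?thesis unfolding dphi_diff_def abs_mult by (simp add: mult_ac)
qed

text \<open>Multiply by \<open>1 \<le> ?R powr - \<theta> * \<bar>resonance a b\<bar> powr
  \<theta>\<close>, where \<open>?R\<close> is the lower bound for the resonance, and collect
  powers. For frequencies at least 1 in modulus the brackets are at most
  \<open>2 * \<bar>a\<bar>\<close> and \<open>2 * \<bar>b\<bar>\<close>, whence
  \<open>4 powr wexp\<close>. When \<open>a + b = 0\<close> the bound \<open>?R\<close> degenerates,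
  but so does \<open>freq_mult\<close>.\<close>

lemma freq_mult_resonance:
  assumes N: "N = max \<bar>a\<bar> \<bar>b\<bar>" "N \<ge> freq0" and ab: "\<bar>a\<bar> \<ge> 1" "\<bar>b\<bar> \<ge> 1" and th: "0 \<le> \<theta>" "\<theta> \<le> 1"
  shows "freq_mult a b \<le> 4 powr wexp * \<bar>\<alpha>\<bar> powr - \<theta> * (\<bar>a + b\<bar> powr (2 - \<theta>) * jbracket (a + b) powr - wexp
     * (\<bar>a\<bar> * \<bar>b\<bar>) powr (wexp - \<theta>) * N powr (- 2 * \<theta>)) * \<bar>resonance a b\<bar> powr \<theta>"
proof (cases "a + b = 0")
  case True
  then show ?thesis by (simp add: freq_mult_def)
next
  case False
  have p0: "wexp \<ge> 0" using eps_le by (simp add: wexp_def)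
  have N0: "N > 0" using N freq0_ge by linarith
  let ?X = "\<bar>a + b\<bar>" and ?R = "\<bar>\<alpha>\<bar> * (\<bar>a + b\<bar> * \<bar>a\<bar> * \<bar>b\<bar>) * N ^ 2"
  have X: "?X > 0" using False by simp
  have R: "?R \<le> \<bar>resonance a b\<bar>" using resonance_lower[of a b] N by simp
  have R0: "?R > 0" using X ab alpha N0 by (intro mult_pos_pos) auto
  have "jbracket a powr wexp \<le> (2 * \<bar>a\<bar>) powr wexp" "jbracket b powr wexp \<le> (2 * \<bar>b\<bar>) powr wexp"
    using jbracket_le[of a] jbracket_le[of b] ab p0 by (auto intro!: powr_mono2 simp: less_imp_le)
  then have "jbracket a powr wexp * jbracket b powr wexp \<le> (2 * \<bar>a\<bar>) powr wexp * (2 * \<bar>b\<bar>) powr wexp"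
    by (intro mult_mono) auto
  also have "\<dots> = 4 powr wexp * (\<bar>a\<bar> * \<bar>b\<bar>) powr wexp"
    using powr_mult[of 2 2 wexp] by (simp add: powr_mult)
  finally have 1: "jbracket a powr wexp * jbracket b powr wexp \<le> 4 powr wexp * (\<bar>a\<bar> * \<bar>b\<bar>) powr wexp" .
  have "?R \<noteq> 0" using R0 by linarith
  then have "1 = ?R powr - \<theta> * ?R powr \<theta>"
    unfolding powr_add[symmetric] by (simp only: powr_zero_eq_one if_False add.left_inverse)
  also have "\<dots> \<le> ?R powr - \<theta> * \<bar>resonance a b\<bar> powr \<theta>"
    using R R0 th by (intro mult_left_mono powr_mono2) auto
  also have "?R powr - \<theta> = \<bar>\<alpha>\<bar> powr - \<theta> * ?X powr - \<theta> * (\<bar>a\<bar> * \<bar>b\<bar>) powr - \<theta> * N powr (- 2 * \<theta>)"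
  proof -
    have "(N ^ 2) powr - \<theta> = N powr (- 2 * \<theta>)"
      using N0 by (simp add: powr_powr flip: powr_numeral)
    then show ?thesis by (simp add: powr_mult mult.commute mult.left_commute del: mult_cancel_left mult_cancel_right mult_left_cancel mult_right_cancel)
  qed
  finally have 2: "1 \<le> \<bar>\<alpha>\<bar> powr - \<theta> * ?X powr - \<theta> * (\<bar>a\<bar> * \<bar>b\<bar>) powr - \<theta> * N powr (- 2 * \<theta>)
      * \<bar>resonance a b\<bar> powr \<theta>" .
  have "freq_mult a b = ?X ^ 2 * jbracket (a + b) powr - wexp * (jbracket a powr wexp * jbracket b powr wexp) * 1"
    by (simp add: freq_mult_def)
  also have "\<dots> \<le> ?X ^ 2 * jbracket (a + b) powr - wexp * (4 powr wexp * (\<bar>a\<bar> * \<bar>b\<bar>) powr wexp) *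
     (\<bar>\<alpha>\<bar> powr - \<theta> * ?X powr - \<theta> * (\<bar>a\<bar> * \<bar>b\<bar>) powr - \<theta> * N powr (- 2 * \<theta>)
      * \<bar>resonance a b\<bar> powr \<theta>)"
    by (intro mult_mono 2 mult_left_mono[OF 1]) auto
  also have "\<dots> = 4 powr wexp * \<bar>\<alpha>\<bar> powr - \<theta> * ((?X ^ 2 * ?X powr - \<theta>) * jbracket (a + b) powr - wexp
     * ((\<bar>a\<bar> * \<bar>b\<bar>) powr wexp * (\<bar>a\<bar> * \<bar>b\<bar>) powr - \<theta>) * N powr (- 2 * \<theta>)) * \<bar>resonance a b\<bar> powr \<theta>"
    by (simp add: mult_ac)
  also have "?X ^ 2 * ?X powr - \<theta> = ?X powr (2 - \<theta>)"
    using X by (simp add: powr_diff powr_minus divide_inverse del: power2_abs)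
  also have "(\<bar>a\<bar> * \<bar>b\<bar>) powr wexp * (\<bar>a\<bar> * \<bar>b\<bar>) powr - \<theta> = (\<bar>a\<bar> * \<bar>b\<bar>) powr (wexp - \<theta>)"
    by (simp flip: powr_add)
  finally show ?thesis .
qed

text \<open>If both frequencies are at most \<open>freq0\<close>, everything is bounded and the last
  indicator in \<open>kern\<close> suffices. Otherwise one is at most 1 and the other is large, so
  \<open>a + b\<close> and \<open>a - b\<close> are both of size \<open>N\<close>: the weight of the
  large input cancels against that of the output, and the phase derivative dominates
  \<open>(a + b) ^ 2\<close>.\<close>

lemma freq_mult_low:
  "\<exists>C>0. \<forall>a b. low a b \<longrightarrow> freq_mult a b \<le> C * kern (a + b) a"
proof (intro exI[of _ "4 * freq0 ^ 2 * (1 + freq0) powr wexp * (1 + freq0) powr wexp + 16 * 8 powr wexp / \<bar>\<alpha>\<bar>"] conjI allI impI)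
  have p0: "wexp \<ge> 0" using eps_le by (simp add: wexp_def)
  let ?C1 = "4 * freq0 ^ 2 * (1 + freq0) powr wexp * (1 + freq0) powr wexp" and ?C2 = "16 * 8 powr wexp / \<bar>\<alpha>\<bar>"
  have C: "?C1 \<ge> 0" "?C2 > 0" using alpha by auto
  show "?C1 + ?C2 > 0" using C by linarith
  fix a b assume low: "low a b"
  show "freq_mult a b \<le> (?C1 + ?C2) * kern (a + b) a"
  proof (cases "max \<bar>a\<bar> \<bar>b\<bar> \<le> freq0")
    case True
    have "freq_mult a b \<le> (2 * freq0) ^ 2 * 1 * (1 + freq0) powr wexp * (1 + freq0) powr wexp"
      unfolding freq_mult_def
    proof (intro mult_mono powr_mono2)
      have "\<bar>a + b\<bar> ^ 2 \<le> (2 * freq0) ^ 2" using True by (intro power_mono) auto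
      then show "(a + b) ^ 2 \<le> (2 * freq0) ^ 2" by simp
      show "jbracket a \<le> 1 + freq0" "jbracket b \<le> 1 + freq0"
        using jbracket_le[of a] jbracket_le[of b] True by auto
    qed (use jbracket_powr_le_1[OF p0] p0 in \<open>auto simp: less_imp_le\<close>)
    also have "\<dots> = ?C1" by (simp add: power_mult_distrib)
    also have "\<dots> \<le> ?C1 * kern (a + b) a"
    proof -
      have "a \<in> {-freq0..freq0}" using True by auto
      then have "kern (a + b) a \<ge> 1" by (simp add: kern_def)
      from mult_left_mono[OF this C(1)] show ?thesis by simp
    qed
    also have "\<dots> \<le> (?C1 + ?C2) * kern (a + b) a"
      using C kern_nonneg by (intro mult_right_mono) auto
    finally show ?thesis .
  next
    case False
    define N where "N = max \<bar>a\<bar> \<bar>b\<bar>"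
    have N: "N > freq0" using False by (simp add: N_def not_le del: max.bounded_iff)
    have N2: "N > 2" using N freq0_ge by linarith
    have small: "\<bar>a\<bar> \<le> 1 \<or> \<bar>b\<bar> \<le> 1" using low False by (auto simp: low_def)
    have X: "\<bar>a + b\<bar> \<le> 2 * N" "\<bar>a + b\<bar> \<ge> N / 2" "\<bar>a - b\<bar> \<ge> N / 2"
    proof -
      have *: "\<bar>a + b\<bar> \<le> \<bar>a\<bar> + \<bar>b\<bar>" "\<bar>a\<bar> \<le> \<bar>a + b\<bar> + \<bar>b\<bar>" "\<bar>b\<bar> \<le> \<bar>a + b\<bar> + \<bar>a\<bar>"
        "\<bar>a\<bar> \<le> \<bar>a - b\<bar> + \<bar>b\<bar>" "\<bar>b\<bar> \<le> \<bar>a - b\<bar> + \<bar>a\<bar>" by linarith+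
      have "N = \<bar>a\<bar> \<and> \<bar>b\<bar> \<le> 1 \<or> N = \<bar>b\<bar> \<and> \<bar>a\<bar> \<le> 1"
        using small N2 by (auto simp: N_def max_def split: if_splits)
      then show "\<bar>a + b\<bar> \<le> 2 * N" "\<bar>a + b\<bar> \<ge> N / 2" "\<bar>a - b\<bar> \<ge> N / 2"
        using * N2 by argo+
    qed
    \<comment> \<open>The 8 is 2 for the bracket of the small frequency times 4 for comparing
      \<open>jbracket y\<close> with \<open>jbracket (x + y)\<close>.\<close>
    have key: "jbracket x powr wexp * jbracket y powr wexp \<le> 8 powr wexp * jbracket (x + y) powr wexp" if "\<bar>x\<bar> \<le> 1" for x y
    proof -
      have x: "jbracket x \<le> 2" using jbracket_le[of x] that by linarith
      have "jbracket y \<le> 2 * jbracket (x + y) * jbracket x"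
        using jbracket_add_le_mult[of "x + y" "- x"] by simp
      also have "\<dots> \<le> 2 * jbracket (x + y) * 2" using x by (intro mult_left_mono) (auto simp: less_imp_le)
      finally have y: "jbracket y \<le> 4 * jbracket (x + y)" by simp
      have "jbracket x * jbracket y \<le> 2 * (4 * jbracket (x + y))"
        using x y by (intro mult_mono) (auto simp: less_imp_le)
      then have "(jbracket x * jbracket y) powr wexp \<le> (8 * jbracket (x + y)) powr wexp"
        using p0 by (intro powr_mono2) (auto simp: less_imp_le)
      then show ?thesis by (simp add: powr_mult less_imp_le)
    qed
    have key2: "jbracket a powr wexp * jbracket b powr wexp \<le> 8 powr wexp * jbracket (a + b) powr wexp"
      using small key[of a b] key[of b a] by (auto simp: mult.commute add.commute)
    have "freq_mult a b = (a + b) ^ 2 * jbracket (a + b) powr - wexp * (jbracket a powr wexp * jbracket b powr wexp)"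
      by (simp add: freq_mult_def)
    also have "\<dots> \<le> (a + b) ^ 2 * jbracket (a + b) powr - wexp * (8 powr wexp * jbracket (a + b) powr wexp)"
      by (intro mult_left_mono key2) auto
    also have "\<dots> = \<bar>a + b\<bar> ^ 2 * 8 powr wexp" by (simp add: powr_minus)
    also have "\<dots> \<le> (2 * N) ^ 2 * 8 powr wexp" using X by (intro mult_right_mono power_mono) auto
    \<comment> \<open>The 16 is 4 from \<open>(2 * N) ^ 2\<close> and 4 from the two halves. Only
      the lower bound 1/2 for \<open>\<bar>a - b\<bar>\<close> and \<open>\<bar>a + b\<bar>\<close>
      is spent, although both are at least \<open>N / 2\<close>.\<close>
    also have "\<dots> = ?C2 * (\<bar>\<alpha>\<bar> * (1 / 2 * (1 / 2)) * N ^ 2)" using alpha by (simp add: power_mult_distrib)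
    also have "\<dots> \<le> ?C2 * (\<bar>\<alpha>\<bar> * (\<bar>a - b\<bar> * \<bar>a + b\<bar>) * N ^ 2)"
      using X N2 C(2) by (intro mult_left_mono mult_right_mono mult_mono) auto
    also have "\<dots> \<le> ?C2 * \<bar>dphi_diff a b\<bar>"
      using N N2 C(2) by (intro mult_left_mono dphi_diff_lower) (auto simp flip: N_def)
    also have "\<dots> \<le> ?C2 * kern (a + b) a"
      using C(2) by (intro mult_left_mono) (auto simp: kern_def)
    also have "\<dots> \<le> (?C1 + ?C2) * kern (a + b) a"
      using C kern_nonneg by (intro mult_right_mono) auto
    finally show ?thesis .
  qed
qed

text \<open>For a dominant output modulation; \<open>1 - 4 * \<epsilon>\<close> is the power that
  the output weight can pay for. Away from \<open>a = b\<close> the phase derivative is at least of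
  order \<open>N ^ 3 * \<bar>a + b\<bar>\<close>, matching the loss exactly. Near
  \<open>a = b\<close> the output frequency is at least \<open>N\<close>, and its negative power
  leaves at most \<open>N\<close>.\<close>

lemma freq_mult_high:
  "\<exists>C>0. \<forall>a b. \<not> low a b \<longrightarrow> freq_mult a b \<le> C * kern (a + b) a * \<bar>resonance a b\<bar> powr (1 - 4 * \<epsilon>)"
proof -
  define \<theta> where "\<theta> = 1 - 4 * \<epsilon>"
  \<comment> \<open>The summand 1 serves the indicator at the critical point, the summand
    \<open>2 / \<bar>\<alpha>\<bar>\<close> the phase derivative.\<close>
  let ?C1 = "1 + 2 / \<bar>\<alpha>\<bar>" and ?C0 = "4 powr wexp * \<bar>\<alpha>\<bar> powr - \<theta>"
  have C1: "?C1 \<ge> 1" "?C1 \<ge> 2 / \<bar>\<alpha>\<bar>" using alpha by simp_all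
  have th: "0 \<le> \<theta>" "\<theta> \<le> 1" using eps_pos eps_le by (auto simp: \<theta>_def)
  have "freq_mult a b \<le> ?C0 * ?C1 * kern (a + b) a * \<bar>resonance a b\<bar> powr \<theta>" if "\<not> low a b" for a b
  proof -
    define N X where "N = max \<bar>a\<bar> \<bar>b\<bar>" and "X = \<bar>a + b\<bar>"
    have ab: "\<bar>a\<bar> \<ge> 1" "\<bar>b\<bar> \<ge> 1" and N: "N \<ge> freq0" using that by (auto simp: low_def N_def)
    have N2: "N \<ge> 2" using N freq0_ge by linarith
    have jX: "jbracket (a + b) = jbracket X" by (simp add: X_def jbracket_def)
    let ?B = "X powr (2 - \<theta>) * jbracket (a + b) powr - wexp * (\<bar>a\<bar> * \<bar>b\<bar>) powr (wexp - \<theta>) * N powr (- 2 * \<theta>)"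
    have "(\<bar>a\<bar> * \<bar>b\<bar>) powr (wexp - \<theta>) * N powr (- 2 * \<theta>) \<le> (N * N) powr (wexp - \<theta>) * N powr (- 2 * \<theta>)"
      using eps_le th by (intro mult_right_mono powr_mono2 mult_mono) (auto simp: N_def wexp_def)
    \<comment> \<open>The exponent is \<open>2 * (wexp - \<theta>) - 2 * \<theta>\<close>, in which
      \<open>\<epsilon>\<close> cancels. This is where the value of the endpoint is decided.\<close>
    also have "\<dots> = N powr 3"
      by (simp add: powr_mult flip: powr_add) (simp add: wexp_def \<theta>_def algebra_simps)
    finally have "?B \<le> X powr (2 - \<theta>) * jbracket X powr - wexp * N powr 3"
      unfolding jX by (subst mult.assoc) (rule mult_left_mono, auto)
    also have "\<dots> \<le> ?C1 * kern (a + b) a"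
    proof (cases "\<bar>a - b\<bar> \<ge> N")
      case True
      have "X powr (2 - \<theta>) = X * X powr (1 - \<theta>)"
        by (cases "X = 0") (auto simp: X_def powr_diff field_simps power2_eq_square)
      also have "\<dots> \<le> X * jbracket X powr wexp"
      proof (intro mult_left_mono)
        have "X powr (1 - \<theta>) \<le> jbracket X powr (1 - \<theta>)"
          using abs_le_jbracket[of X] th by (intro powr_mono2) (auto simp: X_def)
        also have "\<dots> \<le> jbracket X powr wexp"
          using eps_le eps_pos by (intro powr_mono jbracket_ge_1) (auto simp: wexp_def \<theta>_def)
        finally show "X powr (1 - \<theta>) \<le> jbracket X powr wexp" .
      qed (simp add: X_def)
      finally have "X powr (2 - \<theta>) * jbracket X powr - wexp * N powr 3 \<le> X * jbracket X powr wexp * jbracket X powr - wexp * N powr 3"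
        by (intro mult_right_mono) auto
      also have "\<dots> = N * X * N ^ 2" using N2 by (simp add: powr_minus power3_eq_cube power2_eq_square)
      also have "\<dots> \<le> \<bar>a - b\<bar> * X * N ^ 2" using True by (intro mult_right_mono) (auto simp: X_def)
      also have "\<dots> = (1 / \<bar>\<alpha>\<bar>) * (\<bar>\<alpha>\<bar> * (\<bar>a - b\<bar> * \<bar>a + b\<bar>) * N ^ 2)" using alpha by (simp add: X_def)
      also have "\<dots> \<le> (1 / \<bar>\<alpha>\<bar>) * \<bar>dphi_diff a b\<bar>"
        using N N2 by (intro mult_left_mono dphi_diff_lower) (auto simp flip: N_def)
      also have "\<dots> \<le> ?C1 * kern (a + b) a"
        using alpha by (intro mult_mono) (auto simp: kern_def field_simps)
      finally show ?thesis .
    next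
      case False
      \<comment> \<open>\<open>\<bar>a - b\<bar>\<close> and \<open>\<bar>a + b\<bar>\<close> add up
        to twice the maximum \<open>N\<close>, so they cannot both be below
        \<open>N\<close>.\<close>
      have X: "X \<ge> N" using False by (auto simp: X_def N_def)
      have "X powr (2 - \<theta>) * jbracket X powr - wexp \<le> X powr (2 - \<theta>) * X powr - wexp"
        using X N2 abs_le_jbracket[of X] eps_le by (intro mult_left_mono powr_mono2') (auto simp: wexp_def)
      also have "\<dots> = X powr (2 - \<theta> - wexp)" by (simp flip: powr_add)
      also have "\<dots> \<le> N powr (2 - \<theta> - wexp)"
        using X N2 eps_le by (intro powr_mono2') (auto simp: wexp_def \<theta>_def)
      finally have "X powr (2 - \<theta>) * jbracket X powr - wexp * N powr 3 \<le> N powr (2 - \<theta> - wexp) * N powr 3"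
        by (intro mult_right_mono) auto
      also have "\<dots> = N powr (5 - \<theta> - wexp)" unfolding powr_add[symmetric] by (simp add: algebra_simps)
      \<comment> \<open>The exponent equals \<open>1 / 2 + 12 * \<epsilon>\<close>. It remains to
        see that \<open>kern\<close> is at least of order \<open>N\<close>: near the critical point
        by the height of its indicator, elsewhere because the derivative is at least of order
        \<open>N ^ 2\<close>.\<close>
      also have "\<dots> \<le> N powr 1" using N2 eps_le by (intro powr_mono) (auto simp: wexp_def \<theta>_def)
      also have "\<dots> \<le> ?C1 * kern (a + b) a"
      proof (cases "\<bar>a - b\<bar> * (1 + X) \<le> 1")
        case True
        then have "N \<le> kern (a + b) a" using X by (auto simp: kern_def X_def indicator_def)
        also have "\<dots> \<le> ?C1 * kern (a + b) a"
          using mult_right_mono[OF C1(1) kern_nonneg] by simp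
        finally show ?thesis using N2 by simp
      next
        case False
        have "\<bar>a - b\<bar> * (1 + X) \<le> \<bar>a - b\<bar> * (2 * X)" using X N2 by (intro mult_left_mono) auto
        then have 1: "1 / 2 \<le> \<bar>a - b\<bar> * X" using False by simp
        have "N \<le> N ^ 2" using N2 by (simp add: power2_eq_square)
        also have "\<dots> = (2 / \<bar>\<alpha>\<bar>) * (\<bar>\<alpha>\<bar> * (1 / 2) * N ^ 2)" using alpha by simp
        also have "\<dots> \<le> (2 / \<bar>\<alpha>\<bar>) * (\<bar>\<alpha>\<bar> * (\<bar>a - b\<bar> * \<bar>a + b\<bar>) * N ^ 2)"
          using 1 by (intro mult_left_mono mult_right_mono) (auto simp: X_def)
        also have "\<dots> \<le> (2 / \<bar>\<alpha>\<bar>) * \<bar>dphi_diff a b\<bar>"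
          using N N2 by (intro mult_left_mono dphi_diff_lower) (auto simp flip: N_def)
        also have "\<dots> \<le> ?C1 * kern (a + b) a"
          using C1 by (intro mult_mono) (auto simp: kern_def)
        finally show ?thesis using N2 by simp
      qed
      finally show ?thesis .
    qed
    finally have B: "?B \<le> ?C1 * kern (a + b) a" .
    have "freq_mult a b \<le> ?C0 * ?B * \<bar>resonance a b\<bar> powr \<theta>"
      using freq_mult_resonance[OF N_def N ab th] by (simp add: X_def)
    also have "\<dots> \<le> ?C0 * (?C1 * kern (a + b) a) * \<bar>resonance a b\<bar> powr \<theta>"
      by (intro mult_right_mono mult_left_mono B) auto
    finally show ?thesis by (simp add: mult.assoc)
  qed
  moreover have "?C0 * ?C1 > 0" using alpha by (intro mult_pos_pos add_pos_nonneg) auto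
  ultimately show ?thesis unfolding \<theta>_def[symmetric] by blast
qed

text \<open>For a dominant input modulation: the input frequency \<open>a\<close> is frozen and the
  output frequency \<open>a + b\<close> varies, so the phase derivative is of order
  \<open>\<bar>a\<bar> * \<bar>a + 2 * b\<bar> * N ^ 2\<close>. The power
  \<open>1 - 6 * \<epsilon>\<close> leaves \<open>8 * \<epsilon>\<close> of the input weight
  \<open>1 + 2 * \<epsilon>\<close> for later use.\<close>

lemma freq_mult_high':
  "\<exists>C>0. \<forall>a b. \<not> low a b \<longrightarrow> freq_mult a b \<le> C * kern a (a + b) * \<bar>resonance a b\<bar> powr (1 - 6 * \<epsilon>)"
proof -
  define \<theta> where "\<theta> = 1 - 6 * \<epsilon>"
  \<comment> \<open>Near the critical point \<open>512 * N\<close> has to be dominated. The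
    indicator only has height at least \<open>N / 8\<close> there, giving
    \<open>4096 = 512 * 8\<close>; the derivative gives \<open>1024 = 512 * 2\<close>.\<close>
  let ?C1 = "4096 + 1024 / \<bar>\<alpha>\<bar>" and ?C0 = "4 powr wexp * \<bar>\<alpha>\<bar> powr - \<theta>"
  have C1: "?C1 \<ge> 4096" "?C1 \<ge> 1024 / \<bar>\<alpha>\<bar>" using alpha by simp_all
  have th: "0 \<le> \<theta>" "\<theta> \<le> 1" using eps_pos eps_le by (auto simp: \<theta>_def)
  have "freq_mult a b \<le> ?C0 * ?C1 * kern a (a + b) * \<bar>resonance a b\<bar> powr \<theta>" if "\<not> low a b" for a b
  proof -
    define N X w where "N = max \<bar>a\<bar> \<bar>b\<bar>" and "X = \<bar>a + b\<bar>" and "w = \<bar>a + 2 * b\<bar>"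
    have ab: "\<bar>a\<bar> \<ge> 1" "\<bar>b\<bar> \<ge> 1" and N: "N \<ge> freq0" using that by (auto simp: low_def N_def)
    have N2: "N \<ge> 2" using N freq0_ge by linarith
    have jX: "jbracket (a + b) = jbracket X" by (simp add: X_def jbracket_def)
    have "N / 2 \<le> max \<bar>a + b\<bar> \<bar>- b\<bar>" unfolding N_def by linarith
    from dphi_diff_lower[OF N this]
    have "\<bar>\<alpha>\<bar> * (w * \<bar>a\<bar>) * N ^ 2 \<le> \<bar>dphi_diff (a + b) (a - (a + b))\<bar>"
    proof -
      have "a - (a + b) = - b" "\<bar>(a + b) - (- b)\<bar> = w" "\<bar>(a + b) + (- b)\<bar> = \<bar>a\<bar>"
        by (simp_all add: w_def)
      then show ?thesis using \<open>_ \<le> \<bar>dphi_diff (a + b) (- b)\<bar>\<close> by metis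
    qed
    also have "\<dots> \<le> kern a (a + b)" by (simp add: kern_def)
    finally have dk: "\<bar>\<alpha>\<bar> * (w * \<bar>a\<bar>) * N ^ 2 \<le> kern a (a + b)" .
    have Nle: "\<bar>a\<bar> \<le> N" "\<bar>b\<bar> \<le> N" by (auto simp: N_def)
    let ?B = "X powr (2 - \<theta>) * jbracket (a + b) powr - wexp * (\<bar>a\<bar> * \<bar>b\<bar>) powr (wexp - \<theta>) * N powr (- 2 * \<theta>)"
    have B: "?B \<le> ?C1 * kern a (a + b)"
    proof (cases "w \<ge> N / 4")
      case True
      have "X powr (2 - \<theta>) * jbracket X powr - wexp \<le> jbracket X powr (2 - \<theta>) * jbracket X powr - wexp"
        using abs_le_jbracket[of X] th by (intro mult_right_mono powr_mono2) (auto simp: X_def)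
      also have "\<dots> = jbracket X powr - (wexp - 2 + \<theta>)" unfolding powr_add[symmetric] by (simp add: algebra_simps)
      also have "\<dots> \<le> 1" using eps_le by (intro jbracket_powr_le_1) (auto simp: wexp_def \<theta>_def)
      finally have 1: "X powr (2 - \<theta>) * jbracket X powr - wexp \<le> 1" .
      have "\<bar>a\<bar> powr (wexp - \<theta>) = \<bar>a\<bar> * \<bar>a\<bar> powr (wexp - \<theta> - 1)"
        using ab by (simp add: powr_diff)
      also have "\<dots> \<le> \<bar>a\<bar> * N powr (wexp - \<theta> - 1)"
        using Nle eps_le by (intro mult_left_mono powr_mono2) (auto simp: wexp_def \<theta>_def)
      finally have 2: "\<bar>a\<bar> powr (wexp - \<theta>) \<le> \<bar>a\<bar> * N powr (wexp - \<theta> - 1)" .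
      have 3: "\<bar>b\<bar> powr (wexp - \<theta>) \<le> N powr (wexp - \<theta>)"
        using Nle eps_le by (intro powr_mono2) (auto simp: wexp_def \<theta>_def)
      have "?B \<le> 1 * ((\<bar>a\<bar> * N powr (wexp - \<theta> - 1)) * N powr (wexp - \<theta>)) * N powr (- 2 * \<theta>)"
        unfolding jX powr_mult by (intro mult_mono 1 2 3) auto
      also have "\<dots> = \<bar>a\<bar> * N powr (2 + 8 * \<epsilon>)"
      proof -
        \<comment> \<open>One power of \<open>\<bar>a\<bar>\<close> is kept apart because the phase
          derivative contains it. The remaining exponent \<open>2 + 8 * \<epsilon>\<close> is well
          below the 3 that the derivative offers for \<open>w\<close> of order
          \<open>N\<close>.\<close>
        have "N powr (wexp - \<theta> - 1) * N powr (wexp - \<theta>) * N powr (- 2 * \<theta>) = N powr (2 + 8 * \<epsilon>)"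
          by (simp flip: powr_add) (simp add: wexp_def \<theta>_def algebra_simps)
        then show ?thesis by (simp add: mult.assoc)
      qed
      also have "\<dots> \<le> \<bar>a\<bar> * N powr 3" using N2 eps_le by (intro mult_left_mono powr_mono) auto
      also have "\<dots> = 4 * ((N / 4) * \<bar>a\<bar> * N ^ 2)" using N2 by (simp add: power3_eq_cube power2_eq_square)
      also have "\<dots> \<le> 4 * (w * \<bar>a\<bar> * N ^ 2)" using True by (intro mult_left_mono mult_right_mono) auto
      also have "\<dots> = 4 / \<bar>\<alpha>\<bar> * (\<bar>\<alpha>\<bar> * (w * \<bar>a\<bar>) * N ^ 2)" using alpha by simp
      also have "\<dots> \<le> 4 / \<bar>\<alpha>\<bar> * kern a (a + b)" by (intro mult_left_mono dk) auto
      also have "\<dots> \<le> ?C1 * kern a (a + b)"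
        using alpha kern_nonneg by (intro mult_right_mono) (auto simp: field_simps)
      finally show ?thesis .
    next
      case False
      then have w: "w < N / 4" by simp
      \<comment> \<open>Small \<open>w\<close> means that \<open>a\<close> is close to
        \<open>- 2 * b\<close>, hence that \<open>a + b\<close> is close to \<open>- b\<close>. All
        three frequencies are then comparable to \<open>N\<close>.\<close>
      have "\<bar>a\<bar> \<le> w + 2 * \<bar>b\<bar>" "2 * \<bar>b\<bar> \<le> w + \<bar>a\<bar>" "\<bar>b\<bar> \<le> w + X"
        unfolding w_def X_def by linarith+
      moreover have "N = \<bar>a\<bar> \<or> N = \<bar>b\<bar>" by (auto simp: N_def max_def)
      ultimately have X: "X \<ge> N / 8" and a: "\<bar>a\<bar> \<ge> N / 8"
        using w N2 by linarith+
      have "X powr (2 - \<theta>) * jbracket X powr - wexp \<le> X powr (2 - \<theta>) * X powr - wexp"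
        using X N2 abs_le_jbracket[of X] eps_le by (intro mult_left_mono powr_mono2') (auto simp: wexp_def)
      also have "\<dots> = X powr (2 - \<theta> - wexp)" by (simp flip: powr_add)
      also have "\<dots> \<le> (N / 8) powr (2 - \<theta> - wexp)"
        using X N2 eps_le by (intro powr_mono2') (auto simp: wexp_def \<theta>_def)
      also have "\<dots> = 8 powr (\<theta> + wexp - 2) * N powr (2 - \<theta> - wexp)"
        using N2 powr_minus_divide[of 8 "\<theta> + wexp - 2"] by (simp add: powr_divide algebra_simps)
      also have "\<dots> \<le> 8 powr 3 * N powr (2 - \<theta> - wexp)"
        using eps_pos by (intro mult_right_mono powr_mono) (auto simp: wexp_def \<theta>_def)
      finally have 1: "X powr (2 - \<theta>) * jbracket X powr - wexp \<le> 512 * N powr (2 - \<theta> - wexp)" by simp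
      have "(\<bar>a\<bar> * \<bar>b\<bar>) powr (wexp - \<theta>) \<le> (N * N) powr (wexp - \<theta>)"
        using Nle eps_le by (intro powr_mono2 mult_mono) (auto simp: wexp_def \<theta>_def)
      then have "?B \<le> (512 * N powr (2 - \<theta> - wexp)) * (N powr (wexp - \<theta>) * N powr (wexp - \<theta>)) * N powr (- 2 * \<theta>)"
        unfolding jX by (intro mult_mono 1) (auto simp: powr_mult)
      also have "\<dots> = 512 * (N powr (2 - \<theta> - wexp) * N powr (wexp - \<theta>) * N powr (wexp - \<theta>) * N powr (- 2 * \<theta>))"
        by simp
      also have "\<dots> = 512 * N powr (2 + wexp - 5 * \<theta>)"
        unfolding powr_add[symmetric] by (simp add: algebra_simps)
      \<comment> \<open>The exponent \<open>2 + wexp - 5 * \<theta>\<close> equals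
        \<open>1 / 2 + 22 * \<epsilon>\<close>.\<close>
      also have "\<dots> \<le> 512 * N powr 1" using N2 eps_le by (intro mult_left_mono powr_mono) (auto simp: wexp_def \<theta>_def)
      also have "\<dots> \<le> ?C1 * kern a (a + b)"
      proof (cases "w * (1 + \<bar>a\<bar>) \<le> 1")
        case True
        then have "N / 8 \<le> kern a (a + b)" using a by (auto simp: kern_def w_def indicator_def)
        then have "512 * N \<le> 4096 * kern a (a + b)" by simp
        also have "\<dots> \<le> ?C1 * kern a (a + b)"
          using C1(1) by (intro mult_right_mono kern_nonneg)
        finally show ?thesis using N2 by simp
      next
        case False
        have "w * (1 + \<bar>a\<bar>) \<le> w * (2 * \<bar>a\<bar>)" using ab by (intro mult_left_mono) (auto simp: w_def)
        then have 1: "1 / 2 \<le> w * \<bar>a\<bar>" using False by simp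
        have "N \<le> N ^ 2" using N2 by (simp add: power2_eq_square)
        also have "\<dots> = (2 / \<bar>\<alpha>\<bar>) * (\<bar>\<alpha>\<bar> * (1 / 2) * N ^ 2)" using alpha by simp
        also have "\<dots> \<le> (2 / \<bar>\<alpha>\<bar>) * (\<bar>\<alpha>\<bar> * (w * \<bar>a\<bar>) * N ^ 2)"
          using 1 by (intro mult_left_mono mult_right_mono) auto
        also have "\<dots> \<le> (2 / \<bar>\<alpha>\<bar>) * kern a (a + b)"
          by (intro mult_left_mono dk) auto
        finally have "512 * N \<le> 1024 / \<bar>\<alpha>\<bar> * kern a (a + b)" by simp
        also have "\<dots> \<le> ?C1 * kern a (a + b)"
          using C1 by (intro mult_right_mono kern_nonneg) auto
        finally show ?thesis using N2 by simp
      qed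
      finally show ?thesis .
    qed
    have "freq_mult a b \<le> ?C0 * ?B * \<bar>resonance a b\<bar> powr \<theta>"
      using freq_mult_resonance[OF N_def N ab th] by (simp add: X_def)
    also have "\<dots> \<le> ?C0 * (?C1 * kern a (a + b)) * \<bar>resonance a b\<bar> powr \<theta>"
      by (intro mult_right_mono mult_left_mono B) auto
    finally show ?thesis by (simp add: mult.assoc)
  qed
  moreover have "?C0 * ?C1 > 0" using alpha by (intro mult_pos_pos add_pos_nonneg) auto
  ultimately show ?thesis unfolding \<theta>_def[symmetric] by blast
qed

end

subsection \<open>A Schur test\<close>

lemma borel_measurable_fst_real [measurable (raw)]:
  fixes f :: "'a \<Rightarrow> real \<times> real"
  shows "f \<in> borel_measurable M \<Longrightarrow> (\<lambda>x. fst (f x)) \<in> borel_measurable M"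
  by (rule borel_measurable_continuous_on[of fst]) (auto intro: continuous_intros)

lemma borel_measurable_snd_real [measurable (raw)]:
  fixes f :: "'a \<Rightarrow> real \<times> real"
  shows "f \<in> borel_measurable M \<Longrightarrow> (\<lambda>x. snd (f x)) \<in> borel_measurable M"
  by (rule borel_measurable_continuous_on[of snd]) (auto intro: continuous_intros)

lemma borel_measurable_phi [measurable (raw)]:
  assumes [measurable]: "f \<in> borel_measurable M"
  shows "(\<lambda>x. phi \<alpha> \<beta> (f x)) \<in> borel_measurable M"
  unfolding phi_def by measurable

lemma nn_integral_lborel_prod:
  fixes f :: "real \<times> real \<Rightarrow> ennreal"
  assumes [measurable]: "f \<in> borel_measurable borel"
  shows "(\<integral>\<^sup>+z. f z \<partial>lborel) = (\<integral>\<^sup>+x. \<integral>\<^sup>+t. f (x, t) \<partial>lborel \<partial>lborel)"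
  by (subst lborel.nn_integral_fst) (simp_all add: lborel_prod)

lemma nn_integral_reflect:
  fixes f :: "'a::euclidean_space \<Rightarrow> ennreal"
  assumes [measurable]: "f \<in> borel_measurable borel"
  shows "(\<integral>\<^sup>+y. f (z - y) \<partial>lborel) = (\<integral>\<^sup>+y. f y \<partial>lborel)"
  by (subst (2) lborel_affine[of "-1" z]) (simp_all add: nn_integral_density nn_integral_distr)

lemma nn_integral_shift:
  fixes f :: "'a::euclidean_space \<Rightarrow> ennreal"
  assumes [measurable]: "f \<in> borel_measurable borel"
  shows "(\<integral>\<^sup>+y. f (y - z) \<partial>lborel) = (\<integral>\<^sup>+y. f y \<partial>lborel)"
  by (subst (2) lborel_affine[of 1 "-z"]) (simp_all add: nn_integral_density nn_integral_distr)

text \<open>Cauchy-Schwarz in \<open>y\<close> for each \<open>z\<close>, then in \<open>z\<close>.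
  The function \<open>k\<close> is left general so that the lemma applies with either the output or
  an input as the outer variable.\<close>

lemma schur_test:
  fixes m k :: "'a::euclidean_space \<Rightarrow> 'a \<Rightarrow> ennreal" and h :: "'a \<Rightarrow> ennreal"
  assumes [measurable]: "h \<in> borel_measurable borel"
    "(\<lambda>(z, y). m z y) \<in> borel_measurable (borel \<Otimes>\<^sub>M borel)"
    "(\<lambda>(z, y). k z y) \<in> borel_measurable (borel \<Otimes>\<^sub>M borel)"
    and S: "\<And>z. (\<integral>\<^sup>+y. m z y ^ 2 \<partial>lborel) \<le> S"
  shows "(\<integral>\<^sup>+z. h z * (\<integral>\<^sup>+y. m z y * k z y \<partial>lborel) \<partial>lborel) ^ 2
    \<le> S * (\<integral>\<^sup>+z. h z ^ 2 \<partial>lborel) * (\<integral>\<^sup>+z. \<integral>\<^sup>+y. k z y ^ 2 \<partial>lborel \<partial>lborel)"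
proof -
  have inner: "(\<integral>\<^sup>+y. m z y * k z y \<partial>lborel) ^ 2 \<le> S * (\<integral>\<^sup>+y. k z y ^ 2 \<partial>lborel)" for z
  proof -
    have "(\<integral>\<^sup>+y. m z y * k z y \<partial>lborel) ^ 2 \<le> (\<integral>\<^sup>+y. m z y ^ 2 \<partial>lborel) * (\<integral>\<^sup>+y. k z y ^ 2 \<partial>lborel)"
      by (rule Cauchy_Schwarz_nn_integral) measurable
    also have "\<dots> \<le> S * (\<integral>\<^sup>+y. k z y ^ 2 \<partial>lborel)" by (intro mult_right_mono S) auto
    finally show ?thesis .
  qed
  have "(\<integral>\<^sup>+z. h z * (\<integral>\<^sup>+y. m z y * k z y \<partial>lborel) \<partial>lborel) ^ 2
     \<le> (\<integral>\<^sup>+z. h z ^ 2 \<partial>lborel) * (\<integral>\<^sup>+z. (\<integral>\<^sup>+y. m z y * k z y \<partial>lborel) ^ 2 \<partial>lborel)"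
    by (rule Cauchy_Schwarz_nn_integral) measurable
  also have "\<dots> \<le> (\<integral>\<^sup>+z. h z ^ 2 \<partial>lborel) * (\<integral>\<^sup>+z. S * (\<integral>\<^sup>+y. k z y ^ 2 \<partial>lborel) \<partial>lborel)"
    by (intro mult_left_mono nn_integral_mono inner) auto
  also have "\<dots> = S * (\<integral>\<^sup>+z. h z ^ 2 \<partial>lborel) * (\<integral>\<^sup>+z. \<integral>\<^sup>+y. k z y ^ 2 \<partial>lborel \<partial>lborel)"
    by (subst nn_integral_cmult, measurable) (simp add: mult_ac)
  finally show ?thesis .
qed

lemma nn_integral_convolution:
  fixes f g :: "'a::euclidean_space \<Rightarrow> ennreal"
  assumes [measurable]: "f \<in> borel_measurable borel" "g \<in> borel_measurable borel"
  shows "(\<integral>\<^sup>+z. \<integral>\<^sup>+y. (f y * g (z - y)) ^ 2 \<partial>lborel \<partial>lborel)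
    = (\<integral>\<^sup>+y. f y ^ 2 \<partial>lborel) * (\<integral>\<^sup>+y. g y ^ 2 \<partial>lborel)"
proof -
  have "(\<integral>\<^sup>+z. \<integral>\<^sup>+y. (f y * g (z - y)) ^ 2 \<partial>lborel \<partial>lborel) = (\<integral>\<^sup>+y. \<integral>\<^sup>+z. (f y * g (z - y)) ^ 2 \<partial>lborel \<partial>lborel)"
    by (rule lborel_pair.Fubini') measurable
  also have "\<dots> = (\<integral>\<^sup>+y. f y ^ 2 * (\<integral>\<^sup>+z. g z ^ 2 \<partial>lborel) \<partial>lborel)"
  proof (intro nn_integral_cong)
    fix y
    have "(\<integral>\<^sup>+z. (f y * g (z - y)) ^ 2 \<partial>lborel) = f y ^ 2 * (\<integral>\<^sup>+z. g (z - y) ^ 2 \<partial>lborel)"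
      by (subst nn_integral_cmult[symmetric]) (simp_all add: power_mult_distrib)
    also have "(\<integral>\<^sup>+z. g (z - y) ^ 2 \<partial>lborel) = (\<integral>\<^sup>+z. g z ^ 2 \<partial>lborel)"
      by (rule nn_integral_shift[where f="\<lambda>z. g z ^ 2"]) measurable
    finally show "(\<integral>\<^sup>+z. (f y * g (z - y)) ^ 2 \<partial>lborel) = f y ^ 2 * (\<integral>\<^sup>+z. g z ^ 2 \<partial>lborel)" .
  qed
  also have "\<dots> = (\<integral>\<^sup>+y. f y ^ 2 \<partial>lborel) * (\<integral>\<^sup>+y. g y ^ 2 \<partial>lborel)"
    by (rule nn_integral_multc) measurable
  finally show ?thesis .
qed

text \<open>It is enough that one of the two partial integrals of \<open>m ^ 2\<close> is bounded:
  if it is the one in \<open>z\<close>, exchange the order of integration first. In both cases the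
  remaining double integral factors by translation invariance.\<close>

lemma schur_test_convolution:
  fixes m :: "'a::euclidean_space \<Rightarrow> 'a \<Rightarrow> ennreal" and f g h :: "'a \<Rightarrow> ennreal"
  assumes [measurable]: "f \<in> borel_measurable borel" "g \<in> borel_measurable borel" "h \<in> borel_measurable borel"
    "(\<lambda>(z, y). m z y) \<in> borel_measurable (borel \<Otimes>\<^sub>M borel)"
    and S: "(\<forall>z. (\<integral>\<^sup>+y. m z y ^ 2 \<partial>lborel) \<le> S) \<or> (\<forall>y. (\<integral>\<^sup>+z. m z y ^ 2 \<partial>lborel) \<le> S)"
  shows "(\<integral>\<^sup>+z. \<integral>\<^sup>+y. m z y * (h z * f y * g (z - y)) \<partial>lborel \<partial>lborel) ^ 2
    \<le> S * (\<integral>\<^sup>+z. h z ^ 2 \<partial>lborel) * (\<integral>\<^sup>+z. f z ^ 2 \<partial>lborel) * (\<integral>\<^sup>+z. g z ^ 2 \<partial>lborel)"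
  using S
proof
  assume S: "\<forall>z. (\<integral>\<^sup>+y. m z y ^ 2 \<partial>lborel) \<le> S"
  have "(\<integral>\<^sup>+z. \<integral>\<^sup>+y. m z y * (h z * f y * g (z - y)) \<partial>lborel \<partial>lborel)
      = (\<integral>\<^sup>+z. h z * (\<integral>\<^sup>+y. m z y * (f y * g (z - y)) \<partial>lborel) \<partial>lborel)"
    by (subst nn_integral_cmult[symmetric], measurable) (simp add: mult_ac)
  also have "\<dots> ^ 2 \<le> S * (\<integral>\<^sup>+z. h z ^ 2 \<partial>lborel) * (\<integral>\<^sup>+z. \<integral>\<^sup>+y. (f y * g (z - y)) ^ 2 \<partial>lborel \<partial>lborel)"
    by (rule schur_test) (use S in \<open>auto\<close>)
  finally show ?thesis by (simp add: nn_integral_convolution mult.assoc)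
next
  assume S: "\<forall>y. (\<integral>\<^sup>+z. m z y ^ 2 \<partial>lborel) \<le> S"
  have "(\<integral>\<^sup>+z. \<integral>\<^sup>+y. m z y * (h z * f y * g (z - y)) \<partial>lborel \<partial>lborel)
    = (\<integral>\<^sup>+y. \<integral>\<^sup>+z. m z y * (h z * f y * g (z - y)) \<partial>lborel \<partial>lborel)"
    by (rule lborel_pair.Fubini') measurable
  also have "\<dots> = (\<integral>\<^sup>+y. f y * (\<integral>\<^sup>+z. m z y * (h z * g (z - y)) \<partial>lborel) \<partial>lborel)"
    by (subst nn_integral_cmult[symmetric], measurable) (simp add: mult_ac)
  also have "\<dots> ^ 2 \<le> S * (\<integral>\<^sup>+z. f z ^ 2 \<partial>lborel) * (\<integral>\<^sup>+y. \<integral>\<^sup>+z. (h z * g (z - y)) ^ 2 \<partial>lborel \<partial>lborel)"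
    by (rule schur_test) (use S in \<open>auto\<close>)
  also have "(\<integral>\<^sup>+y. \<integral>\<^sup>+z. (h z * g (z - y)) ^ 2 \<partial>lborel \<partial>lborel)
     = (\<integral>\<^sup>+y. h y ^ 2 \<partial>lborel) * (\<integral>\<^sup>+y. g y ^ 2 \<partial>lborel)"
  proof -
    have "(\<integral>\<^sup>+y. \<integral>\<^sup>+z. (h z * g (z - y)) ^ 2 \<partial>lborel \<partial>lborel) =
        (\<integral>\<^sup>+z. \<integral>\<^sup>+y. (h z * g (z - y)) ^ 2 \<partial>lborel \<partial>lborel)"
      by (rule lborel_pair.Fubini') measurable
    also have "\<dots> = (\<integral>\<^sup>+z. h z ^ 2 * (\<integral>\<^sup>+y. g y ^ 2 \<partial>lborel) \<partial>lborel)"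
    proof (intro nn_integral_cong)
      fix z
      have "(\<integral>\<^sup>+y. (h z * g (z - y)) ^ 2 \<partial>lborel) = h z ^ 2 * (\<integral>\<^sup>+y. g (z - y) ^ 2 \<partial>lborel)"
        by (subst nn_integral_cmult[symmetric]) (simp_all add: power_mult_distrib)
      also have "(\<integral>\<^sup>+y. g (z - y) ^ 2 \<partial>lborel) = (\<integral>\<^sup>+y. g y ^ 2 \<partial>lborel)"
        by (rule nn_integral_reflect[where f="\<lambda>z. g z ^ 2"]) measurable
      finally show "(\<integral>\<^sup>+y. (h z * g (z - y)) ^ 2 \<partial>lborel) = h z ^ 2 * (\<integral>\<^sup>+y. g y ^ 2 \<partial>lborel)" .
    qed
    also have "\<dots> = (\<integral>\<^sup>+y. h y ^ 2 \<partial>lborel) * (\<integral>\<^sup>+y. g y ^ 2 \<partial>lborel)"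
      by (rule nn_integral_multc) measurable
    finally show ?thesis .
  qed
  finally show ?thesis by (simp add: mult_ac)
qed

section \<open>Uniform bounds for the integrals of the kernel\<close>

context kawahara
begin

lemma borel_measurable_dphi_diff [measurable (raw)]:
  assumes [measurable]: "f \<in> borel_measurable M" "g \<in> borel_measurable M"
  shows "(\<lambda>x. dphi_diff (f x) (g x)) \<in> borel_measurable M"
  unfolding dphi_diff_def by measurable

lemma borel_measurable_kern [measurable (raw)]:
  assumes [measurable]: "f \<in> borel_measurable M" "g \<in> borel_measurable M"
  shows "(\<lambda>x. kern (f x) (g x)) \<in> borel_measurable M"
  unfolding kern_def indicator_def mem_Collect_eq atLeastAtMost_iff by measurable

text \<open>The derivative of the phase vanishes at \<open>c / 2\<close> and at the roots of a
  quadratic, so at three points at most and the line splits into four pieces, uniformly in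
  \<open>c\<close> and \<open>t\<close>. For \<open>c = 0\<close> it vanishes identically.\<close>

lemma nn_integral_dphi_diff:
  fixes f :: "real \<Rightarrow> ennreal"
  assumes [measurable]: "f \<in> borel_measurable borel"
  shows "(\<integral>\<^sup>+x. ennreal \<bar>dphi_diff x (c - x)\<bar> * f (t + phi \<alpha> \<beta> x + phi \<alpha> \<beta> (c - x)) \<partial>lborel)
    \<le> 4 * (\<integral>\<^sup>+x. f x \<partial>lborel)"
proof (cases "c = 0")
  case True
  then show ?thesis by (simp add: dphi_diff_def)
next
  case False
  let ?q = "[:5 * \<alpha> * c ^ 2 - 3 * \<beta>, - 10 * \<alpha> * c, 10 * \<alpha>:]"
  let ?Z = "insert (c / 2) {x. poly ?q x = 0}"
  have q: "?q \<noteq> 0" using alpha by simp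
  have "card ?Z \<le> Suc (card {x. poly ?q x = 0})" by (rule card_insert_le_m1) auto
  also have "card {x. poly ?q x = 0} \<le> degree ?q" by (rule card_poly_roots_bound[OF q])
  also have "degree ?q \<le> 2" by simp
  finally have card: "card ?Z \<le> 3" by simp
  have "(\<integral>\<^sup>+x. ennreal \<bar>dphi_diff x (c - x)\<bar> * f (t + phi \<alpha> \<beta> x + phi \<alpha> \<beta> (c - x)) \<partial>lborel)
    \<le> of_nat (Suc 3) * (\<integral>\<^sup>+x. f x \<partial>lborel)"
  proof (rule nn_integral_comp_deriv[where g="\<lambda>x. t + phi \<alpha> \<beta> x + phi \<alpha> \<beta> (c - x)"
        and g'="\<lambda>x. dphi_diff x (c - x)" and Z="?Z"])
    show "((\<lambda>x. t + phi \<alpha> \<beta> x + phi \<alpha> \<beta> (c - x)) has_real_derivative dphi_diff x (c - x)) (at x)" for x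
    proof -
      have "((\<lambda>x. t + phi \<alpha> \<beta> x + phi \<alpha> \<beta> (c - x)) has_real_derivative
        (5 * \<alpha> * x ^ 4 - 3 * \<beta> * x ^ 2) - (5 * \<alpha> * (c - x) ^ 4 - 3 * \<beta> * (c - x) ^ 2)) (at x)"
        unfolding phi_def by (auto intro!: derivative_eq_intros)
      also have "(5 * \<alpha> * x ^ 4 - 3 * \<beta> * x ^ 2) - (5 * \<alpha> * (c - x) ^ 4 - 3 * \<beta> * (c - x) ^ 2) = dphi_diff x (c - x)"
        unfolding dphi_diff_def by algebra
      finally show ?thesis .
    qed
    show "continuous_on UNIV (\<lambda>x. dphi_diff x (c - x))"
      unfolding dphi_diff_def by (intro continuous_intros)
    show "finite ?Z" using poly_roots_finite[OF q] by simp
    show "x \<in> ?Z" if "dphi_diff x (c - x) = 0" for x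
    proof -
      have "dphi_diff x (c - x) = (2 * x - c) * c * poly ?q x"
        by (simp add: dphi_diff_def power2_eq_square algebra_simps)
      then show ?thesis using that False by auto
    qed
  qed (use card in auto)
  then show ?thesis by simp
qed

text \<open>The three terms on the right correspond to the three summands of \<open>kern\<close>:
  substitution for the derivative, and the bound 1 on the weight for the two indicators, of mass at
  most 1 and \<open>2 * freq0\<close>.\<close>

lemma nn_integral_kern:
  assumes a: "a > 1"
  shows "(\<integral>\<^sup>+x. ennreal (kern c x * jbracket (t + phi \<alpha> \<beta> x + phi \<alpha> \<beta> (c - x)) powr - a) \<partial>lborel)
    \<le> 4 * (\<integral>\<^sup>+y. ennreal (jbracket y powr - a) \<partial>lborel) + 1 + ennreal (2 * freq0)"
proof -
  let ?w = "\<lambda>x. jbracket (t + phi \<alpha> \<beta> x + phi \<alpha> \<beta> (c - x)) powr - a"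
  let ?B = "{x. \<bar>2 * x - c\<bar> * (1 + \<bar>c\<bar>) \<le> 1}"
  have w1: "?w x \<le> 1" for x using a by (intro jbracket_powr_le_1) auto
  have pw: "ennreal (kern c x * ?w x) \<le> ennreal \<bar>dphi_diff x (c - x)\<bar> * ennreal (?w x)
     + (ennreal (1 + \<bar>c\<bar>) * indicator ?B x + indicator {-freq0..freq0} x)" for x
  proof -
    have "kern c x * ?w x \<le> \<bar>dphi_diff x (c - x)\<bar> * ?w x + ((1 + \<bar>c\<bar>) * indicator ?B x + indicator {-freq0..freq0} x) * 1"
      unfolding kern_def using mult_left_mono[OF w1[of x], of "(1 + \<bar>c\<bar>) * indicator ?B x + indicator {-freq0..freq0} x"]
      by (simp add: distrib_right add.assoc)
    then have "ennreal (kern c x * ?w x) \<le> ennreal (\<bar>dphi_diff x (c - x)\<bar> * ?w x + ((1 + \<bar>c\<bar>) * indicator ?B x + indicator {-freq0..freq0} x))"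
      by (intro ennreal_leI) simp
    then show ?thesis
      by (simp add: ennreal_plus ennreal_mult ennreal_indicator del: ennreal_plus[symmetric])
  qed
  have B: "emeasure lborel ?B \<le> ennreal (1 / (1 + \<bar>c\<bar>))"
  proof -
    have "?B \<subseteq> {(c - 1 / (1 + \<bar>c\<bar>)) / 2 .. (c + 1 / (1 + \<bar>c\<bar>)) / 2}"
    proof
      fix x assume "x \<in> ?B"
      then have "\<bar>2 * x - c\<bar> \<le> 1 / (1 + \<bar>c\<bar>)" by (simp add: field_simps)
      then show "x \<in> {(c - 1 / (1 + \<bar>c\<bar>)) / 2 .. (c + 1 / (1 + \<bar>c\<bar>)) / 2}" by (auto simp: abs_le_iff)
    qed
    then have "emeasure lborel ?B \<le> emeasure lborel {(c - 1 / (1 + \<bar>c\<bar>)) / 2 .. (c + 1 / (1 + \<bar>c\<bar>)) / 2}"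
      by (intro emeasure_mono) auto
    also have "\<dots> = ennreal (1 / (1 + \<bar>c\<bar>))" 
    proof -
      define d where "d = 1 / (1 + \<bar>c\<bar>)"
      have "d \<ge> 0" by (simp add: d_def)
      then have "(c - d) / 2 \<le> (c + d) / 2" "(c + d) / 2 - (c - d) / 2 = d"
        by (simp_all add: field_simps)
      then show ?thesis unfolding d_def[symmetric] by simp
    qed
    finally show ?thesis .
  qed
  have [measurable]: "?B \<in> sets borel" by measurable
  have "(\<integral>\<^sup>+x. ennreal (kern c x * ?w x) \<partial>lborel) \<le> (\<integral>\<^sup>+x. ennreal \<bar>dphi_diff x (c - x)\<bar> * ennreal (?w x)
     + (ennreal (1 + \<bar>c\<bar>) * indicator ?B x + indicator {-freq0..freq0} x) \<partial>lborel)"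
    by (intro nn_integral_mono pw)
  also have "\<dots> = (\<integral>\<^sup>+x. ennreal \<bar>dphi_diff x (c - x)\<bar> * ennreal (?w x) \<partial>lborel)
     + (ennreal (1 + \<bar>c\<bar>) * emeasure lborel ?B + emeasure lborel {-freq0..freq0})"
    by (subst nn_integral_add, measurable, subst nn_integral_add, measurable)
       (simp add: nn_integral_cmult_indicator)
  also have "\<dots> \<le> 4 * (\<integral>\<^sup>+y. ennreal (jbracket y powr - a) \<partial>lborel) + (1 + ennreal (2 * freq0))"
  proof (intro add_mono)
    show "(\<integral>\<^sup>+x. ennreal \<bar>dphi_diff x (c - x)\<bar> * ennreal (?w x) \<partial>lborel)
       \<le> 4 * (\<integral>\<^sup>+y. ennreal (jbracket y powr - a) \<partial>lborel)"
      by (rule nn_integral_dphi_diff[where f="\<lambda>y. ennreal (jbracket y powr - a)"]) measurable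
    have "ennreal (1 + \<bar>c\<bar>) * emeasure lborel ?B \<le> ennreal (1 + \<bar>c\<bar>) * ennreal (1 / (1 + \<bar>c\<bar>))"
      by (intro mult_left_mono B) auto
    also have "\<dots> = ennreal ((1 + \<bar>c\<bar>) * (1 / (1 + \<bar>c\<bar>)))" by (rule ennreal_mult[symmetric]) auto
    also have "(1 + \<bar>c\<bar>) * (1 / (1 + \<bar>c\<bar>)) = 1" by (simp add: add_pos_nonneg)
    also have "ennreal 1 = 1" by simp
    finally show "ennreal (1 + \<bar>c\<bar>) * emeasure lborel ?B \<le> 1" .
    show "emeasure lborel {-freq0..freq0} \<le> ennreal (2 * freq0)" using freq0_ge by simp
  qed
  finally show ?thesis by (simp add: add.assoc)
qed

definition sig :: "real \<times> real \<Rightarrow> real" where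
  "sig z = snd z + phi \<alpha> \<beta> (fst z)"

lemma borel_measurable_sig [measurable (raw)]:
  assumes "f \<in> borel_measurable M"
  shows "(\<lambda>x. sig (f x)) \<in> borel_measurable M"
proof -
  have [measurable]: "(\<lambda>x. fst (f x)) \<in> borel_measurable M" "(\<lambda>x. snd (f x)) \<in> borel_measurable M"
    using assms by (auto intro: borel_measurable_fst_real borel_measurable_snd_real)
  show ?thesis unfolding sig_def by measurable
qed

lemma phi_minus: "phi \<alpha> \<beta> (- x) = - phi \<alpha> \<beta> x"
  by (simp add: phi_def)

lemma sig_minus: "sig (- z) = - sig z"
  by (simp add: sig_def phi_minus)

lemma sig_diff: "sig z - sig y - sig (z - y) = resonance (fst y) (fst z - fst y)"
  by (simp add: sig_def resonance_def)

text \<open>The modulation is integrated first: it occurs only in the two weights, and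
  \<open>jbracket_powr_conv\<close> leaves a single weight evaluated at the phase, to which
  \<open>nn_integral_kern\<close> applies.\<close>

lemma kern_sup:
  assumes a: "a > 1"
  shows "\<exists>S<\<infinity>. \<forall>z. (\<integral>\<^sup>+y. ennreal (kern (fst z) (fst y) * jbracket (sig y) powr - a * jbracket (sig (z - y)) powr - a) \<partial>lborel) \<le> S"
proof -
  let ?I = "\<integral>\<^sup>+y. ennreal (jbracket y powr - a) \<partial>lborel"
  let ?c = "2 * ennreal (2 powr a) * ?I"
  let ?S = "?c * (4 * ?I + 1 + ennreal (2 * freq0))"
  have fin: "?I < \<infinity>" by (rule nn_integral_jbracket_powr_finite[OF a])
  have "?S < \<infinity>" using fin by (auto simp: ennreal_mult_less_top ennreal_add_less_top)
  moreover have "(\<integral>\<^sup>+y. ennreal (kern (fst z) (fst y) * jbracket (sig y) powr - a * jbracket (sig (z - y)) powr - a) \<partial>lborel) \<le> ?S" for z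
  proof -
    obtain c t where z: "z = (c, t)" by fastforce
    have inner: "(\<integral>\<^sup>+r. ennreal (kern c x * jbracket (sig (x, r)) powr - a * jbracket (sig (z - (x, r))) powr - a) \<partial>lborel)
       \<le> ?c * ennreal (kern c x * jbracket (t + phi \<alpha> \<beta> x + phi \<alpha> \<beta> (c - x)) powr - a)" for x
    proof -
      \<comment> \<open>\<open>r\<close> enters with a minus sign. Since \<open>jbracket\<close> is
        even, flipping the argument gives the translated form required by
        \<open>jbracket_powr_conv\<close>.\<close>
      have "jbracket (sig (z - (x, r))) = jbracket (r + (- t - phi \<alpha> \<beta> (c - x)))" for r
        unfolding z by (subst jbracket_minus[symmetric]) (simp add: sig_def algebra_simps)
      then have "(\<integral>\<^sup>+r. ennreal (kern c x * jbracket (sig (x, r)) powr - a * jbracket (sig (z - (x, r))) powr - a) \<partial>lborel)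
        = (\<integral>\<^sup>+r. ennreal (kern c x) * ennreal (jbracket (r + phi \<alpha> \<beta> x) powr - a * jbracket (r + (- t - phi \<alpha> \<beta> (c - x))) powr - a) \<partial>lborel)"
        by (simp add: sig_def mult.assoc kern_nonneg flip: ennreal_mult)
      also have "\<dots> = ennreal (kern c x) * (\<integral>\<^sup>+r. ennreal (jbracket (r + phi \<alpha> \<beta> x) powr - a * jbracket (r + (- t - phi \<alpha> \<beta> (c - x))) powr - a) \<partial>lborel)"
        by (rule nn_integral_cmult) measurable
      also have "\<dots> \<le> ennreal (kern c x) * (?c * ennreal (jbracket (phi \<alpha> \<beta> x - (- t - phi \<alpha> \<beta> (c - x))) powr - a))"
        by (intro mult_left_mono jbracket_powr_conv[OF a]) auto
      also have "\<dots> = ?c * ennreal (kern c x * jbracket (t + phi \<alpha> \<beta> x + phi \<alpha> \<beta> (c - x)) powr - a)"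
      proof -
        have "phi \<alpha> \<beta> x - (- t - phi \<alpha> \<beta> (c - x)) = t + phi \<alpha> \<beta> x + phi \<alpha> \<beta> (c - x)" by simp
        then show ?thesis by (simp only: ennreal_mult kern_nonneg powr_ge_zero mult_ac)
      qed
      finally show ?thesis .
    qed
    have "(\<integral>\<^sup>+y. ennreal (kern (fst z) (fst y) * jbracket (sig y) powr - a * jbracket (sig (z - y)) powr - a) \<partial>lborel)
       = (\<integral>\<^sup>+x. \<integral>\<^sup>+r. ennreal (kern c x * jbracket (sig (x, r)) powr - a * jbracket (sig (z - (x, r))) powr - a) \<partial>lborel \<partial>lborel)"
      by (subst nn_integral_lborel_prod, measurable) (simp add: z)
    also have "\<dots> \<le> (\<integral>\<^sup>+x. ?c * ennreal (kern c x * jbracket (t + phi \<alpha> \<beta> x + phi \<alpha> \<beta> (c - x)) powr - a) \<partial>lborel)"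
      by (intro nn_integral_mono inner)
    also have "\<dots> = ?c * (\<integral>\<^sup>+x. ennreal (kern c x * jbracket (t + phi \<alpha> \<beta> x + phi \<alpha> \<beta> (c - x)) powr - a) \<partial>lborel)"
      by (rule nn_integral_cmult) measurable
    also have "\<dots> \<le> ?S" by (intro mult_left_mono nn_integral_kern[OF a]) auto
    finally show ?thesis .
  qed
  ultimately show ?thesis by blast
qed

end

subsection \<open>The trilinear estimate\<close>

lemma square_add3_le:
  fixes x y z :: ennreal
  assumes "x ^ 2 \<le> Q" "y ^ 2 \<le> Q" "z ^ 2 \<le> Q"
  shows "(x + y + z) ^ 2 \<le> 9 * Q"
proof -
  define m where "m = max x (max y z)"
  have "x \<le> m" "y \<le> m" "z \<le> m" by (auto simp: m_def le_max_iff_disj)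
  then have "x + y + z \<le> m + m + m" by (intro add_mono)
  also have "m + m + m = (1 + 1 + 1) * m" by (simp only: distrib_right mult_1)
  also have "(1 + 1 + 1 :: ennreal) = 3" by simp
  finally have "(x + y + z) ^ 2 \<le> (3 * m) ^ 2" by (intro power_mono) auto
  also have "\<dots> = 9 * m ^ 2" by (simp add: power_mult_distrib)
  also have "m ^ 2 \<le> Q" using assms by (auto simp: m_def max_def)
  finally show ?thesis by (simp add: mult_left_mono)
qed

context kawahara
begin

text \<open>What remains when the weighted transforms are treated as arbitrary square-integrable
  functions: \<open>z\<close> is the output point, with its weight multiplied in; \<open>y\<close>
  and \<open>z - y\<close> are the input points, with their weights divided out.\<close>

definition multiplier :: "real \<Rightarrow> real \<times> real \<Rightarrow> real \<times> real \<Rightarrow> real" where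
  "multiplier s z y = \<bar>fst z\<bar> * (jbracket (fst z) powr s * jbracket (sig z) powr (- 1 / 2 + 2 * \<epsilon>))
    * (jbracket (fst y) powr - s * jbracket (sig y) powr - (1 / 2 + \<epsilon>))
    * (jbracket (fst (z - y)) powr - s * jbracket (sig (z - y)) powr - (1 / 2 + \<epsilon>))"

definition majorant :: "real \<times> real \<Rightarrow> real \<times> real \<Rightarrow> real" where
  "majorant z y = freq_mult (fst y) (fst (z - y)) * jbracket (sig z) powr - (1 - 4 * \<epsilon>)
    * jbracket (sig y) powr - (1 + 2 * \<epsilon>) * jbracket (sig (z - y)) powr - (1 + 2 * \<epsilon>)"

lemma multiplier_nonneg: "multiplier s z y \<ge> 0"
  by (simp add: multiplier_def)

lemma low_commute: "low a b \<longleftrightarrow> low b a"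
  by (auto simp: low_def max.commute)

text \<open>Raising \<open>s\<close> by some amount multiplies the square by a nonnegative power of
  \<open>jbracket (fst z) / (jbracket (fst y) * jbracket (fst (z - y)))\<close>, a quotient bounded
  by 2. Only the endpoint remains to be treated.\<close>

lemma multiplier_square_le:
  assumes "s \<ge> - 7 / 4 + 4 * \<epsilon>"
  shows "multiplier s z y ^ 2 \<le> 2 powr (2 * s + wexp) * majorant z y"
proof -
  have sq: "(x powr r) ^ 2 = x powr (2 * r)" if "x > 0" for x r :: real
    using that by (simp add: powr_power mult.commute)
  have r: "2 * s + wexp \<ge> 0" using assms by (simp add: wexp_def)
  define A B C where "A = jbracket (fst z)" and "B = jbracket (fst y)" and "C = jbracket (fst (z - y))"
  have pos: "A > 0" "B > 0" "C > 0" by (simp_all add: A_def B_def C_def)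
  have "A \<le> 2 * B * C" using jbracket_add_le_mult[of "fst y" "fst (z - y)"] by (simp add: A_def B_def C_def)
  then have "A powr (2 * s + wexp) \<le> (2 * B * C) powr (2 * s + wexp)"
    using pos r by (intro powr_mono2) auto
  also have "\<dots> = 2 powr (2 * s + wexp) * B powr (2 * s + wexp) * C powr (2 * s + wexp)"
    using pos by (simp add: powr_mult)
  finally have "A powr (2 * s + wexp) * (A powr - wexp * B powr (- 2 * s) * C powr (- 2 * s)) \<le>
     2 powr (2 * s + wexp) * B powr (2 * s + wexp) * C powr (2 * s + wexp) * (A powr - wexp * B powr (- 2 * s) * C powr (- 2 * s))"
    by (intro mult_right_mono) auto
  also have "\<dots> = 2 powr (2 * s + wexp) * (A powr - wexp * (B powr (2 * s + wexp) * B powr (- 2 * s)) * (C powr (2 * s + wexp) * C powr (- 2 * s)))"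
    by (simp only: mult_ac)
  also have "\<dots> = 2 powr (2 * s + wexp) * (A powr - wexp * B powr wexp * C powr wexp)"
    unfolding powr_add[symmetric] by simp
  also have "A powr (2 * s + wexp) * (A powr - wexp * B powr (- 2 * s) * C powr (- 2 * s)) = 
      A powr (2 * s) * B powr (- 2 * s) * C powr (- 2 * s)"
    unfolding mult.assoc[symmetric] powr_add[symmetric] by simp
  finally have 1: "A powr (2 * s) * B powr (- 2 * s) * C powr (- 2 * s) \<le> 2 powr (2 * s + wexp) * (A powr - wexp * B powr wexp * C powr wexp)" .
  let ?J = "jbracket (sig z) powr - (1 - 4 * \<epsilon>) * jbracket (sig y) powr - (1 + 2 * \<epsilon>) * jbracket (sig (z - y)) powr - (1 + 2 * \<epsilon>)"
  have e: "2 * (- 1 / 2 + 2 * \<epsilon>) = - (1 - 4 * \<epsilon>)" "2 * - (1 / 2 + \<epsilon>) = - (1 + 2 * \<epsilon>)" "2 * - s = - 2 * s"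
    by (simp_all add: algebra_simps)
  have "multiplier s z y ^ 2 = fst z ^ 2 * (A powr (2 * s) * B powr (- 2 * s) * C powr (- 2 * s)) * ?J"
    unfolding multiplier_def power_mult_distrib sq[OF jbracket_pos] A_def B_def C_def
    unfolding e by (simp add: mult_ac)
  also have "\<dots> \<le> fst z ^ 2 * (2 powr (2 * s + wexp) * (A powr - wexp * B powr wexp * C powr wexp)) * ?J"
    by (intro mult_right_mono mult_left_mono 1) auto
  also have "\<dots> = 2 powr (2 * s + wexp) * majorant z y"
    unfolding majorant_def freq_mult_def by (simp add: A_def B_def C_def mult_ac)
  finally show ?thesis .
qed

text \<open>The 3 counts the modulations: the resonance is a signed sum of three, each at most the
  dominant one in modulus.\<close>

lemma resonance_le_modulation:
  assumes "\<bar>x\<bar> \<le> 3 * \<bar>m\<bar>" "0 \<le> \<theta>" "\<theta> \<le> 1"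
  shows "\<bar>x\<bar> powr \<theta> \<le> 3 * jbracket m powr \<theta>"
proof -
  have "\<bar>x\<bar> powr \<theta> \<le> (3 * jbracket m) powr \<theta>"
    using assms abs_le_jbracket[of m] by (intro powr_mono2) auto
  also have "\<dots> = 3 powr \<theta> * jbracket m powr \<theta>" by (simp add: powr_mult less_imp_le)
  also have "\<dots> \<le> 3 powr 1 * jbracket m powr \<theta>" using assms by (intro mult_right_mono powr_mono) auto
  finally show ?thesis by simp
qed

text \<open>When the output dominates, its weight cancels the power of the resonance exactly. Low
  frequencies belong here whichever modulation dominates, since there the output weight is simply
  bounded by 1.\<close>

lemma majorant_le_output:
  "\<exists>C>0. \<forall>z y. low (fst y) (fst (z - y)) \<or> \<bar>sig y\<bar> \<le> \<bar>sig z\<bar> \<and> \<bar>sig (z - y)\<bar> \<le> \<bar>sig z\<bar> \<longrightarrow>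
     majorant z y \<le> C * (kern (fst z) (fst y) * jbracket (sig y) powr - (1 + 2 * \<epsilon>) * jbracket (sig (z - y)) powr - (1 + 2 * \<epsilon>))"
proof -
  obtain C1 where C1: "C1 > 0" "\<And>a b. low a b \<Longrightarrow> freq_mult a b \<le> C1 * kern (a + b) a"
    using freq_mult_low by blast
  obtain C2 where C2: "C2 > 0" "\<And>a b. \<not> low a b \<Longrightarrow> freq_mult a b \<le> C2 * kern (a + b) a * \<bar>resonance a b\<bar> powr (1 - 4 * \<epsilon>)"
    using freq_mult_high by blast
  let ?\<theta> = "1 - 4 * \<epsilon>"
  have th: "0 \<le> ?\<theta>" "?\<theta> \<le> 1" using eps_pos eps_le by auto
  have key: "freq_mult (fst y) (fst (z - y)) * jbracket (sig z) powr - ?\<theta> \<le> (C1 + 3 * C2) * kern (fst z) (fst y)"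
    if "low (fst y) (fst (z - y)) \<or> \<bar>sig y\<bar> \<le> \<bar>sig z\<bar> \<and> \<bar>sig (z - y)\<bar> \<le> \<bar>sig z\<bar>" for z y
  proof (cases "low (fst y) (fst (z - y))")
    case True
    have "freq_mult (fst y) (fst (z - y)) * jbracket (sig z) powr - ?\<theta> \<le> (C1 * kern (fst z) (fst y)) * 1"
      using C1(2)[OF True] C1(1) kern_nonneg th by (intro mult_mono jbracket_powr_le_1) auto
    also have "\<dots> \<le> (C1 + 3 * C2) * kern (fst z) (fst y)"
      using C1(1) C2(1) kern_nonneg by (simp add: mult_right_mono)
    finally show ?thesis .
  next
    case False
    then have "\<bar>sig y\<bar> \<le> \<bar>sig z\<bar>" "\<bar>sig (z - y)\<bar> \<le> \<bar>sig z\<bar>" using that by auto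
    then have "\<bar>resonance (fst y) (fst (z - y))\<bar> \<le> 3 * \<bar>sig z\<bar>"
      using sig_diff[of z y] unfolding fst_diff by linarith
    from resonance_le_modulation[OF this th]
    have r: "\<bar>resonance (fst y) (fst (z - y))\<bar> powr ?\<theta> \<le> 3 * jbracket (sig z) powr ?\<theta>" .
    have "freq_mult (fst y) (fst (z - y)) \<le> C2 * kern (fst z) (fst y) * \<bar>resonance (fst y) (fst (z - y))\<bar> powr ?\<theta>"
      using C2(2)[OF False] by simp
    also have "\<dots> \<le> C2 * kern (fst z) (fst y) * (3 * jbracket (sig z) powr ?\<theta>)"
      using C2(1) kern_nonneg by (intro mult_left_mono r) auto
    finally have "freq_mult (fst y) (fst (z - y)) * jbracket (sig z) powr - ?\<theta>
       \<le> C2 * kern (fst z) (fst y) * (3 * jbracket (sig z) powr ?\<theta>) * jbracket (sig z) powr - ?\<theta>"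
      by (intro mult_right_mono) auto
    also have "\<dots> = 3 * C2 * kern (fst z) (fst y) * (jbracket (sig z) powr ?\<theta> * jbracket (sig z) powr - ?\<theta>)"
      by (simp only: mult_ac)
    also have "\<dots> = 3 * C2 * kern (fst z) (fst y)" unfolding powr_add[symmetric] by simp
    also have "\<dots> \<le> (C1 + 3 * C2) * kern (fst z) (fst y)"
      using C1(1) kern_nonneg by (simp add: mult_right_mono)
    finally show ?thesis .
  qed
  show ?thesis
  proof (intro exI[of _ "C1 + 3 * C2"] conjI allI impI)
    show "C1 + 3 * C2 > 0" using C1 C2 by simp
    fix z y assume "low (fst y) (fst (z - y)) \<or> \<bar>sig y\<bar> \<le> \<bar>sig z\<bar> \<and> \<bar>sig (z - y)\<bar> \<le> \<bar>sig z\<bar>"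
    from mult_right_mono[OF key[OF this], of "jbracket (sig y) powr - (1 + 2 * \<epsilon>) * jbracket (sig (z - y)) powr - (1 + 2 * \<epsilon>)"]
    show "majorant z y \<le> (C1 + 3 * C2) * (kern (fst z) (fst y) * jbracket (sig y) powr - (1 + 2 * \<epsilon>) * jbracket (sig (z - y)) powr - (1 + 2 * \<epsilon>))"
      by (simp add: majorant_def mult.assoc)
  qed
qed

text \<open>The dominant modulation \<open>sig y\<close> pays for raising the exponent of \<open>sig z\<close> from
  \<open>1 - 4 * \<epsilon>\<close> to \<open>1 + 2 * \<epsilon>\<close>, which makes the remaining weight integrable.\<close>

lemma majorant_le_input:
  "\<exists>C>0. \<forall>z y. \<not> low (fst y) (fst (z - y)) \<and> \<bar>sig z\<bar> \<le> \<bar>sig y\<bar> \<and> \<bar>sig (z - y)\<bar> \<le> \<bar>sig y\<bar> \<longrightarrow>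
     majorant z y \<le> C * (kern (fst y) (fst z) * jbracket (sig z) powr - (1 + 2 * \<epsilon>) * jbracket (sig (y - z)) powr - (1 + 2 * \<epsilon>))"
proof -
  obtain C2 where C2: "C2 > 0" "\<And>a b. \<not> low a b \<Longrightarrow> freq_mult a b \<le> C2 * kern a (a + b) * \<bar>resonance a b\<bar> powr (1 - 6 * \<epsilon>)"
    using freq_mult_high' by blast
  let ?\<theta> = "1 - 6 * \<epsilon>"
  have th: "0 \<le> ?\<theta>" "?\<theta> \<le> 1" using eps_pos eps_le by auto
  show ?thesis
  proof (intro exI[of _ "3 * C2"] conjI allI impI)
    show "3 * C2 > 0" using C2 by simp
    fix z y assume a: "\<not> low (fst y) (fst (z - y)) \<and> \<bar>sig z\<bar> \<le> \<bar>sig y\<bar> \<and> \<bar>sig (z - y)\<bar> \<le> \<bar>sig y\<bar>"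
    let ?k = "kern (fst y) (fst z)" and ?z = "jbracket (sig z)" and ?y = "jbracket (sig y)"
    let ?v = "jbracket (sig (z - y))"
    have "\<bar>resonance (fst y) (fst (z - y))\<bar> \<le> 3 * \<bar>sig y\<bar>"
      using a sig_diff[of z y] unfolding fst_diff by linarith
    from resonance_le_modulation[OF this th]
    have r: "\<bar>resonance (fst y) (fst (z - y))\<bar> powr ?\<theta> \<le> 3 * ?y powr ?\<theta>" .
    have "freq_mult (fst y) (fst (z - y)) \<le> C2 * ?k * \<bar>resonance (fst y) (fst (z - y))\<bar> powr ?\<theta>"
      using C2(2)[of "fst y" "fst (z - y)"] a by simp
    also have "\<dots> \<le> C2 * ?k * (3 * ?y powr ?\<theta>)"
      using C2(1) kern_nonneg by (intro mult_left_mono r) auto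
    finally have 1: "freq_mult (fst y) (fst (z - y)) \<le> 3 * C2 * ?k * ?y powr ?\<theta>" by (simp add: mult_ac)
    have zy: "?z \<le> ?y" using a by (intro jbracket_mono) auto
    have 2: "?y powr ?\<theta> * ?z powr - (1 - 4 * \<epsilon>) * ?y powr - (1 + 2 * \<epsilon>) \<le> ?z powr - (1 + 2 * \<epsilon>)"
    proof -
      have "?y powr ?\<theta> * ?z powr - (1 - 4 * \<epsilon>) * ?y powr - (1 + 2 * \<epsilon>)
         = ?z powr - (1 - 4 * \<epsilon>) * (?y powr ?\<theta> * ?y powr - (1 + 2 * \<epsilon>))" by (simp only: mult_ac)
      also have "\<dots> = ?z powr - (1 - 4 * \<epsilon>) * ?y powr - (8 * \<epsilon>)"
        unfolding powr_add[symmetric] by simp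
      also have "\<dots> \<le> ?z powr - (1 - 4 * \<epsilon>) * ?z powr - (8 * \<epsilon>)"
        using eps_pos zy by (intro mult_left_mono powr_mono2') auto
      also have "\<dots> = ?z powr - (1 + 4 * \<epsilon>)" unfolding powr_add[symmetric] by (simp add: algebra_simps)
      also have "\<dots> \<le> ?z powr - (1 + 2 * \<epsilon>)" using eps_pos by (intro powr_mono jbracket_ge_1) auto
      finally show ?thesis .
    qed
    have "majorant z y \<le> (3 * C2 * ?k * ?y powr ?\<theta>) * ?z powr - (1 - 4 * \<epsilon>) * ?y powr - (1 + 2 * \<epsilon>) * ?v powr - (1 + 2 * \<epsilon>)"
      unfolding majorant_def by (intro mult_right_mono 1) auto
    also have "\<dots> = 3 * C2 * ?k * (?y powr ?\<theta> * ?z powr - (1 - 4 * \<epsilon>) * ?y powr - (1 + 2 * \<epsilon>)) * ?v powr - (1 + 2 * \<epsilon>)"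
      by (simp only: mult_ac)
    also have "\<dots> \<le> 3 * C2 * ?k * ?z powr - (1 + 2 * \<epsilon>) * ?v powr - (1 + 2 * \<epsilon>)"
      using C2(1) kern_nonneg by (intro mult_right_mono mult_left_mono 2) auto
    also have "?v = jbracket (sig (y - z))"
      using sig_minus[of "z - y"] by (metis jbracket_minus minus_diff_eq)
    finally show "majorant z y \<le> 3 * C2 * (?k * ?z powr - (1 + 2 * \<epsilon>) * jbracket (sig (y - z)) powr - (1 + 2 * \<epsilon>))"
      by (simp only: mult_ac)
  qed
qed

lemma schur_bound_aux:
  assumes "\<And>z. (\<integral>\<^sup>+y. ennreal (kern (fst z) (fst y) * jbracket (sig y) powr - (1 + 2 * \<epsilon>) * jbracket (sig (z - y)) powr - (1 + 2 * \<epsilon>)) \<partial>lborel) \<le> S"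
    and m: "\<And>y. m y ^ 2 \<le> C * (kern (fst z) (fst y) * jbracket (sig y) powr - (1 + 2 * \<epsilon>) * jbracket (sig (z - y)) powr - (1 + 2 * \<epsilon>))"
    and "C \<ge> 0" and m0: "\<And>y. m y \<ge> 0"
  shows "(\<integral>\<^sup>+y. ennreal (m y) ^ 2 \<partial>lborel) \<le> ennreal C * S"
proof -
  let ?k = "\<lambda>y. kern (fst z) (fst y) * jbracket (sig y) powr - (1 + 2 * \<epsilon>) * jbracket (sig (z - y)) powr - (1 + 2 * \<epsilon>)"
  have "(\<integral>\<^sup>+y. ennreal (m y) ^ 2 \<partial>lborel) = (\<integral>\<^sup>+y. ennreal (m y ^ 2) \<partial>lborel)"
    using m0 by (simp add: ennreal_power)
  also have "\<dots> \<le> (\<integral>\<^sup>+y. ennreal (C * ?k y) \<partial>lborel)"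
    by (intro nn_integral_mono ennreal_leI m)
  also have "\<dots> = (\<integral>\<^sup>+y. ennreal C * ennreal (?k y) \<partial>lborel)"
    using assms(3) by (simp add: ennreal_mult kern_nonneg)
  also have "\<dots> = ennreal C * (\<integral>\<^sup>+y. ennreal (?k y) \<partial>lborel)"
    by (rule nn_integral_cmult) measurable
  also have "\<dots> \<le> ennreal C * S" by (intro mult_left_mono assms(1)) auto
  finally show ?thesis .
qed

text \<open>\<open>m0\<close> collects the low frequencies and the dominant output,
  \<open>m1\<close> the dominant input \<open>y\<close>. The case of dominant \<open>z - y\<close>
  is \<open>m1\<close> reflected, because \<open>multiplier\<close> is symmetric in the two
  inputs.\<close>

lemma trilinear:
  assumes s: "s \<ge> - 7 / 4 + 4 * \<epsilon>"
  shows "\<exists>C<\<infinity>. \<forall>f g h. f \<in> borel_measurable borel \<longrightarrow> g \<in> borel_measurable borel \<longrightarrow> h \<in> borel_measurable borel \<longrightarrow>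
    (\<integral>\<^sup>+z. \<integral>\<^sup>+y. ennreal (multiplier s z y) * (h z * f y * g (z - y)) \<partial>lborel \<partial>lborel) ^ 2
    \<le> C * (\<integral>\<^sup>+z. h z ^ 2 \<partial>lborel) * (\<integral>\<^sup>+z. f z ^ 2 \<partial>lborel) * (\<integral>\<^sup>+z. g z ^ 2 \<partial>lborel)"
proof -
  let ?a = "1 + 2 * \<epsilon>" and ?c = "2 powr (2 * s + wexp)"
  obtain S where S: "S < \<infinity>" "\<And>z. (\<integral>\<^sup>+y. ennreal (kern (fst z) (fst y) * jbracket (sig y) powr - ?a * jbracket (sig (z - y)) powr - ?a) \<partial>lborel) \<le> S"
    using kern_sup[of ?a] eps_pos by auto
  obtain C0 where C0: "C0 > 0" "\<And>z y. low (fst y) (fst (z - y)) \<or> \<bar>sig y\<bar> \<le> \<bar>sig z\<bar> \<and> \<bar>sig (z - y)\<bar> \<le> \<bar>sig z\<bar> \<Longrightarrow>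
     majorant z y \<le> C0 * (kern (fst z) (fst y) * jbracket (sig y) powr - ?a * jbracket (sig (z - y)) powr - ?a)"
    using majorant_le_output by blast
  obtain C1 where C1: "C1 > 0" "\<And>z y. \<not> low (fst y) (fst (z - y)) \<Longrightarrow> \<bar>sig z\<bar> \<le> \<bar>sig y\<bar> \<Longrightarrow> \<bar>sig (z - y)\<bar> \<le> \<bar>sig y\<bar> \<Longrightarrow>
     majorant z y \<le> C1 * (kern (fst y) (fst z) * jbracket (sig z) powr - ?a * jbracket (sig (y - z)) powr - ?a)"
    using majorant_le_input by blast
  let ?K = "ennreal (?c * (C0 + C1)) * S"
  define m0 where "m0 z y = (if low (fst y) (fst (z - y)) \<or> \<bar>sig y\<bar> \<le> \<bar>sig z\<bar> \<and> \<bar>sig (z - y)\<bar> \<le> \<bar>sig z\<bar>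
    then multiplier s z y else 0)" for z y
  define m1 where "m1 z y = (if \<not> low (fst y) (fst (z - y)) \<and> \<bar>sig z\<bar> \<le> \<bar>sig y\<bar> \<and> \<bar>sig (z - y)\<bar> \<le> \<bar>sig y\<bar>
    then multiplier s z y else 0)" for z y
  have multiplier_refl: "multiplier s z (z - y) = multiplier s z y" for z y by (simp add: multiplier_def mult_ac)
  have [measurable]: "(\<lambda>(z, y). multiplier s z y) \<in> borel_measurable (borel \<Otimes>\<^sub>M borel)"
    unfolding multiplier_def by measurable
  have [measurable]: "(\<lambda>(z, y). m0 z y) \<in> borel_measurable (borel \<Otimes>\<^sub>M borel)"
    unfolding m0_def low_def by measurable
  have [measurable]: "(\<lambda>(z, y). m1 z y) \<in> borel_measurable (borel \<Otimes>\<^sub>M borel)"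
    unfolding m1_def low_def by measurable
  have m0n: "m0 z y \<ge> 0" and m1n: "m1 z y \<ge> 0" for z y by (simp_all add: m0_def m1_def multiplier_nonneg)
  have b0: "(\<integral>\<^sup>+y. ennreal (m0 z y) ^ 2 \<partial>lborel) \<le> ?K" for z
  proof (rule schur_bound_aux[OF S(2) _ _ m0n])
    fix y
    let ?k = "kern (fst z) (fst y) * jbracket (sig y) powr - ?a * jbracket (sig (z - y)) powr - ?a"
    show "m0 z y ^ 2 \<le> ?c * (C0 + C1) * ?k"
    proof (cases "low (fst y) (fst (z - y)) \<or> \<bar>sig y\<bar> \<le> \<bar>sig z\<bar> \<and> \<bar>sig (z - y)\<bar> \<le> \<bar>sig z\<bar>")
      case True
      then have "m0 z y ^ 2 = multiplier s z y ^ 2" by (simp add: m0_def)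
      also have "\<dots> \<le> ?c * majorant z y" by (rule multiplier_square_le[OF s])
      also have "\<dots> \<le> ?c * (C0 * ?k)" by (intro mult_left_mono C0(2) True) auto
      also have "\<dots> \<le> ?c * ((C0 + C1) * ?k)"
        using C1 kern_nonneg by (intro mult_left_mono mult_right_mono) auto
      finally show ?thesis by simp
    qed (use C0 C1 kern_nonneg in \<open>auto simp: m0_def\<close>)
  qed (use C0 C1 in auto)
  have b1: "(\<integral>\<^sup>+z. ennreal (m1 z y) ^ 2 \<partial>lborel) \<le> ?K" for y
  proof (rule schur_bound_aux[OF S(2) _ _ m1n])
    fix z
    let ?k = "kern (fst y) (fst z) * jbracket (sig z) powr - ?a * jbracket (sig (y - z)) powr - ?a"
    show "m1 z y ^ 2 \<le> ?c * (C0 + C1) * ?k"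
    proof (cases "\<not> low (fst y) (fst (z - y)) \<and> \<bar>sig z\<bar> \<le> \<bar>sig y\<bar> \<and> \<bar>sig (z - y)\<bar> \<le> \<bar>sig y\<bar>")
      case True
      then have "m1 z y ^ 2 = multiplier s z y ^ 2" by (simp add: m1_def)
      also have "\<dots> \<le> ?c * majorant z y" by (rule multiplier_square_le[OF s])
      also have "\<dots> \<le> ?c * (C1 * ?k)" using True by (intro mult_left_mono C1(2)) auto
      also have "\<dots> \<le> ?c * ((C0 + C1) * ?k)"
        using C0 kern_nonneg by (intro mult_left_mono mult_right_mono) auto
      finally show ?thesis by simp
    qed (use C0 C1 kern_nonneg in \<open>auto simp: m1_def\<close>)
  qed (use C0 C1 in auto)
  \<comment> \<open>The three regions cover everything but overlap where modulations tie, hence only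
    an inequality.\<close>
  have cover: "multiplier s z y \<le> m0 z y + m1 z y + m1 z (z - y)" for z y
  proof -
    have "low (fst (z - y)) (fst (z - (z - y))) = low (fst y) (fst (z - y))" by (simp add: low_commute)
    then show ?thesis using multiplier_nonneg[of s z y]
      unfolding m0_def m1_def multiplier_refl by auto
  qed
  show ?thesis
  proof (intro exI[of _ "9 * ?K"] conjI allI impI)
    show "9 * ?K < \<infinity>" using S by (auto simp: ennreal_mult_less_top)
    fix f g h :: "real \<times> real \<Rightarrow> ennreal"
    assume [measurable]: "f \<in> borel_measurable borel" "g \<in> borel_measurable borel" "h \<in> borel_measurable borel"
    let ?R = "?K * (\<integral>\<^sup>+z. h z ^ 2 \<partial>lborel) * (\<integral>\<^sup>+z. f z ^ 2 \<partial>lborel) * (\<integral>\<^sup>+z. g z ^ 2 \<partial>lborel)"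
    let ?I = "\<lambda>m. (\<integral>\<^sup>+z. \<integral>\<^sup>+y. ennreal (m z y) * (h z * f y * g (z - y)) \<partial>lborel \<partial>lborel)"
    have "?I (multiplier s) \<le> (\<integral>\<^sup>+z. \<integral>\<^sup>+y. ennreal (m0 z y) * (h z * f y * g (z - y)) + ennreal (m1 z y) * (h z * f y * g (z - y))
       + ennreal (m1 z (z - y)) * (h z * f y * g (z - y)) \<partial>lborel \<partial>lborel)"
    proof (intro nn_integral_mono)
      fix z y
      have "ennreal (multiplier s z y) \<le> ennreal (m0 z y) + ennreal (m1 z y) + ennreal (m1 z (z - y))"
        using cover[of z y] m0n m1n by (simp add: ennreal_leI flip: ennreal_plus)
      from mult_right_mono[OF this, of "h z * f y * g (z - y)"]
      show "ennreal (multiplier s z y) * (h z * f y * g (z - y)) \<le> ennreal (m0 z y) * (h z * f y * g (z - y)) + ennreal (m1 z y) * (h z * f y * g (z - y))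
       + ennreal (m1 z (z - y)) * (h z * f y * g (z - y))" by (simp add: distrib_right)
    qed
    also have "\<dots> = ?I m0 + ?I m1 + ?I (\<lambda>z y. m1 z (z - y))"
      by (simp add: nn_integral_add)
    finally have "?I (multiplier s) ^ 2 \<le> (?I m0 + ?I m1 + ?I (\<lambda>z y. m1 z (z - y))) ^ 2"
      by (intro power_mono) auto
    also have "\<dots> \<le> 9 * ?R"
    proof (rule square_add3_le)
      show "?I m0 ^ 2 \<le> ?R" by (rule schur_test_convolution) (use b0 in auto)
      show "?I m1 ^ 2 \<le> ?R" by (rule schur_test_convolution) (use b1 in auto)
      \<comment> \<open>Substituting \<open>z - y\<close> for \<open>y\<close> exchanges the roles
        of \<open>f\<close> and \<open>g\<close>, and the bound is symmetric in them.\<close>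
      have "?I (\<lambda>z y. m1 z (z - y)) = (\<integral>\<^sup>+z. \<integral>\<^sup>+y. ennreal (m1 z y) * (h z * g y * f (z - y)) \<partial>lborel \<partial>lborel)"
      proof (rule nn_integral_cong)
        fix z
        have "(\<integral>\<^sup>+y. ennreal (m1 z (z - y)) * (h z * g (z - y) * f (z - (z - y))) \<partial>lborel)
          = (\<integral>\<^sup>+y. ennreal (m1 z y) * (h z * g y * f (z - y)) \<partial>lborel)"
          by (rule nn_integral_reflect[where f="\<lambda>y. ennreal (m1 z y) * (h z * g y * f (z - y))"]) measurable
        then show "(\<integral>\<^sup>+y. ennreal (m1 z (z - y)) * (h z * f y * g (z - y)) \<partial>lborel)
          = (\<integral>\<^sup>+y. ennreal (m1 z y) * (h z * g y * f (z - y)) \<partial>lborel)" by (simp add: mult_ac)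
      qed
      also have "\<dots> ^ 2 \<le> ?K * (\<integral>\<^sup>+z. h z ^ 2 \<partial>lborel) * (\<integral>\<^sup>+z. g z ^ 2 \<partial>lborel) * (\<integral>\<^sup>+z. f z ^ 2 \<partial>lborel)"
        by (rule schur_test_convolution) (use b1 in auto)
      finally show "?I (\<lambda>z y. m1 z (z - y)) ^ 2 \<le> ?R" by (simp add: mult_ac)
    qed
    finally show "?I (multiplier s) ^ 2 \<le> 9 * ?K * (\<integral>\<^sup>+z. h z ^ 2 \<partial>lborel) * (\<integral>\<^sup>+z. f z ^ 2 \<partial>lborel) * (\<integral>\<^sup>+z. g z ^ 2 \<partial>lborel)"
      by (simp add: mult.assoc)
  qed
qed

end

subsection \<open>The Fourier transform of a product\<close>

lemma borel_measurable_cis [measurable (raw)]: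
  "f \<in> borel_measurable M \<Longrightarrow> (\<lambda>x. cis (f x)) \<in> borel_measurable M"
  by (rule borel_measurable_continuous_on[of cis]) (auto intro: continuous_intros continuous_on_cis)

lemma integrable_prod_bounded:
  fixes f :: "'a::euclidean_space \<Rightarrow> complex" and g :: "'b::euclidean_space \<Rightarrow> complex"
  assumes f: "integrable lborel f" and g: "integrable lborel g"
    and k [measurable]: "(\<lambda>(x, y). k x y) \<in> borel_measurable (borel \<Otimes>\<^sub>M borel)"
    and k1: "\<And>x y. cmod (k x y) \<le> 1"
  shows "integrable (lborel \<Otimes>\<^sub>M lborel) (\<lambda>(x, y). f x * g y * k x y)"
proof (rule integrableI_bounded)
  have [measurable]: "f \<in> borel_measurable borel" "g \<in> borel_measurable borel"
    using f g by (auto dest: borel_measurable_integrable)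
  show "(\<lambda>(x, y). f x * g y * k x y) \<in> borel_measurable (lborel \<Otimes>\<^sub>M lborel)" by measurable
  have fin: "(\<integral>\<^sup>+x. ennreal (cmod (f x)) \<partial>lborel) < \<infinity>" "(\<integral>\<^sup>+x. ennreal (cmod (g x)) \<partial>lborel) < \<infinity>"
    using f g by (auto simp: integrable_iff_bounded)
  have "(\<integral>\<^sup>+z. ennreal (norm (case z of (x, y) \<Rightarrow> f x * g y * k x y)) \<partial>(lborel \<Otimes>\<^sub>M lborel)) \<le>
      (\<integral>\<^sup>+z. ennreal (cmod (f (fst z))) * ennreal (cmod (g (snd z))) \<partial>(lborel \<Otimes>\<^sub>M lborel))"
    using k1 by (intro nn_integral_mono)
      (auto simp: norm_mult mult_left_le simp flip: ennreal_mult intro!: ennreal_leI)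
  also have "\<dots> = (\<integral>\<^sup>+x. \<integral>\<^sup>+y. ennreal (cmod (f x)) * ennreal (cmod (g y)) \<partial>lborel \<partial>lborel)"
    by (subst lborel.nn_integral_fst[symmetric]) simp_all
  also have "\<dots> = (\<integral>\<^sup>+x. ennreal (cmod (f x)) \<partial>lborel) * (\<integral>\<^sup>+x. ennreal (cmod (g x)) \<partial>lborel)"
    by (simp add: nn_integral_cmult nn_integral_multc)
  also have "\<dots> < \<infinity>" using fin by (simp add: ennreal_mult_less_top)
  finally show "(\<integral>\<^sup>+z. ennreal (norm (case z of (x, y) \<Rightarrow> f x * g y * k x y)) \<partial>(lborel \<Otimes>\<^sub>M lborel)) < \<infinity>" .
qed

lemma Fubini_prod_bounded:
  fixes f :: "'a::euclidean_space \<Rightarrow> complex" and g :: "'b::euclidean_space \<Rightarrow> complex"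
  assumes "integrable lborel f" "integrable lborel g"
    "(\<lambda>(x, y). k x y) \<in> borel_measurable (borel \<Otimes>\<^sub>M borel)"
    "\<And>x y. cmod (k x y) \<le> 1"
  shows "(LINT y|lborel. LINT x|lborel. f x * g y * k x y) = (LINT x|lborel. LINT y|lborel. f x * g y * k x y)"
  by (rule lborel_pair.Fubini_integral) (use integrable_prod_bounded[OF assms] in simp)

lemma integral_affine_lborel:
  fixes f :: "'a::euclidean_space \<Rightarrow> complex"
  assumes "c \<noteq> 0" and [measurable]: "f \<in> borel_measurable borel"
  shows "(LINT x|lborel. f x) = \<bar>c\<bar> ^ DIM('a) *\<^sub>R (LINT x|lborel. f (t + c *\<^sub>R x))"
  by (subst lborel_affine[OF assms(1), of t]) (simp add: integral_density integral_distr)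

definition gauss2 :: "real \<times> real \<Rightarrow> real" where
  "gauss2 z = std_normal_density (fst z) * std_normal_density (snd z)"

lemma borel_measurable_gauss2 [measurable]: "gauss2 \<in> borel_measurable borel"
  unfolding gauss2_def by measurable

lemma gauss2_nonneg: "gauss2 z \<ge> 0"
  by (simp add: gauss2_def)

lemma gauss2_le_1: "gauss2 z \<le> 1"
proof -
  have "std_normal_density x \<le> 1" for x :: real
  proof -
    have "1 / sqrt (2 * pi) \<le> 1" using pi_gt3 by (simp add: real_le_rsqrt)
    then show ?thesis unfolding std_normal_density_def
      by (intro mult_le_one) auto
  qed
  then show ?thesis unfolding gauss2_def by (intro mult_le_one) auto
qed

text \<open>On each axis the integral is the characteristic function of the standard normal law,
  whose closed form is known; the plane follows by Fubini.\<close>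

lemma integrable_gauss2: "integrable lborel (\<lambda>z. complex_of_real (gauss2 z))"
  and integral_gauss2_cis: "(LINT z|lborel. complex_of_real (gauss2 z) * cis (w \<bullet> z)) = complex_of_real (2 * pi * gauss2 w)"
proof -
  have int: "integrable lborel (\<lambda>x. complex_of_real (std_normal_density x))" by simp
  have c1: "(LINT x|lborel. complex_of_real (std_normal_density x) * cis (t * x)) = complex_of_real (exp (- t\<^sup>2 / 2))" for t :: real
  proof -
    have "(LINT x|lborel. complex_of_real (std_normal_density x) * cis (t * x)) = char std_normal_distribution t"
      unfolding char_def by (subst integral_density) (auto simp: scaleR_conv_of_real cis_conv_exp)
    then show ?thesis by (simp add: char_std_normal_distribution)
  qed
  let ?G = "\<lambda>w z. complex_of_real (gauss2 z) * cis (w \<bullet> z)"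
  have eq: "?G w = (\<lambda>(x, y). complex_of_real (std_normal_density x) * complex_of_real (std_normal_density y) * (cis (fst w * x) * cis (snd w * y)))" for w
    by (auto simp: gauss2_def fun_eq_iff inner_prod_def cis_mult)
  have i: "integrable (lborel \<Otimes>\<^sub>M lborel) (?G w)" for w
    unfolding eq by (intro integrable_prod_bounded int) (auto simp: norm_mult)
  show "integrable lborel (\<lambda>z. complex_of_real (gauss2 z))"
    using i[of 0] by (simp add: lborel_prod)
  have "(LINT z|lborel. ?G w z) = (LINT z|(lborel \<Otimes>\<^sub>M lborel). ?G w z)" by (simp add: lborel_prod)
  also have "\<dots> = (LINT x|lborel. LINT y|lborel. ?G w (x, y))"
    using i[of w] by (rule lborel_pair.integral_fst'[symmetric])
  also have "\<dots> = (LINT x|lborel. LINT y|lborel. (complex_of_real (std_normal_density x) * cis (fst w * x)) * (complex_of_real (std_normal_density y) * cis (snd w * y)))"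
  proof -
    have "?G w (x, y) = (complex_of_real (std_normal_density x) * cis (fst w * x)) * (complex_of_real (std_normal_density y) * cis (snd w * y))" for x y
      unfolding fun_cong[OF eq] by (simp only: prod.case mult_ac)
    then show ?thesis by (simp only:)
  qed
  also have "\<dots> = complex_of_real (exp (- (fst w)\<^sup>2 / 2)) * complex_of_real (exp (- (snd w)\<^sup>2 / 2))"
    by (simp add: c1)
  also have "\<dots> = complex_of_real (2 * pi * gauss2 w)"
    by (simp add: gauss2_def std_normal_density_def)
  finally show "(LINT z|lborel. ?G w z) = complex_of_real (2 * pi * gauss2 w)" .
qed

lemma integral_gauss2: "(LINT z|lborel. gauss2 z) = 1"
proof -
  have "gauss2 0 = 1 / (sqrt (2 * pi) * sqrt (2 * pi))"
    by (simp add: gauss2_def std_normal_density_def del: real_sqrt_mult)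
  then have "2 * pi * gauss2 0 = 1" by simp
  then have "(LINT z|lborel. complex_of_real (gauss2 z)) = 1"
    using integral_gauss2_cis[of 0] by (simp del: integral_complex_of_real)
  then show ?thesis by simp
qed

lemma fourier_eq:
  "fourier u z = complex_of_real (1 / (2 * pi)) * (LINT w|lborel. u w * cis (- (w \<bullet> z)))"
proof (cases z)
  case (Pair \<xi> \<tau>)
  have "exp (- \<i> * complex_of_real (x * \<xi>) - \<i> * complex_of_real (t * \<tau>)) * u (x, t) = u (x, t) * cis (- ((x, t) \<bullet> z))" for x t
  proof -
    have "- \<i> * complex_of_real (x * \<xi>) - \<i> * complex_of_real (t * \<tau>) = \<i> * complex_of_real (- ((x, t) \<bullet> z))"
      by (simp add: Pair algebra_simps)
    then show ?thesis by (simp only: cis_conv_exp mult.commute)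
  qed
  then have "(\<lambda>(x, t). exp (- \<i> * complex_of_real (x * \<xi>) - \<i> * complex_of_real (t * \<tau>)) * u (x, t))
      = (\<lambda>w. u w * cis (- (w \<bullet> z)))"
    by (intro ext, split prod.split, intro allI impI, hypsubst) (simp only:)
  then show ?thesis unfolding fourier_def Pair by (simp only: prod.case)
qed

lemma integrable_cis:
  assumes "integrable lborel u" and [measurable]: "g \<in> borel_measurable borel"
  shows "integrable lborel (\<lambda>w. u w * cis (g w))"
proof -
  have [measurable]: "u \<in> borel_measurable borel" using assms(1) by (auto dest: borel_measurable_integrable)
  show ?thesis by (rule Bochner_Integration.integrable_bound[OF assms(1)]) (auto simp: norm_mult)
qed

lemma borel_measurable_fourier [measurable]:
  assumes "integrable lborel u"
  shows "fourier u \<in> borel_measurable borel"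
proof -
  have [measurable]: "u \<in> borel_measurable borel" using assms by (auto dest: borel_measurable_integrable)
  have "(\<lambda>z. LINT w|lborel. u w * cis (- (w \<bullet> z))) \<in> borel_measurable borel"
    by (rule lborel.borel_measurable_lebesgue_integral) measurable
  then show ?thesis unfolding fourier_eq[abs_def] by measurable
qed

lemma fourier_bound:
  assumes "integrable lborel u"
  shows "cmod (fourier u z) \<le> (LINT w|lborel. cmod (u w))"
proof -
  have pi: "1 / (2 * pi) \<le> 1" using pi_gt3 by simp
  have "cmod (LINT w|lborel. u w * cis (- (w \<bullet> z))) \<le> (LINT w|lborel. cmod (u w * cis (- (w \<bullet> z))))"
    by (rule integral_norm_bound)
  then have "cmod (fourier u z) \<le> 1 / (2 * pi) * (LINT w|lborel. cmod (u w))"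
    unfolding fourier_eq norm_mult norm_of_real by (simp add: divide_right_mono)
  also have "\<dots> \<le> 1 * (LINT w|lborel. cmod (u w))" by (intro mult_right_mono pi) auto
  finally show ?thesis by simp
qed

text \<open>Inserting a Gaussian into the convolution of the transforms amounts to mollifying \<open>v\<close>,
  so no integrability of the transforms is required.\<close>

lemma fourier_mollified:
  assumes u: "integrable lborel u" and v: "integrable lborel v" and d: "d > 0"
  shows "(LINT y|lborel. complex_of_real (gauss2 (d *\<^sub>R y)) * fourier v y * fourier u (z - y))
    = complex_of_real (1 / (2 * pi)) * (LINT w|lborel. u w * cis (- (w \<bullet> z)) *
        (LINT x|lborel. complex_of_real (gauss2 x) * v (w - d *\<^sub>R x)))"
proof -
  have [measurable]: "u \<in> borel_measurable borel" "v \<in> borel_measurable borel"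
    using u v by (auto dest: borel_measurable_integrable)
  note [measurable] = borel_measurable_fourier[OF u] borel_measurable_fourier[OF v]
  let ?c = "complex_of_real (1 / (2 * pi))"
  let ?g = "\<lambda>y. complex_of_real (gauss2 (d *\<^sub>R y))"
  have gi: "integrable lborel ?g"
  proof -
    have "integrable lborel (\<lambda>y. (d * d) *\<^sub>R ?g y)"
      using d integrable_gauss2
      by (subst (asm) lborel_affine[of d 0]) (simp_all add: integrable_density integrable_distr_eq)
    then have "integrable lborel (\<lambda>y. inverse (d * d) *\<^sub>R ((d * d) *\<^sub>R ?g y))"
      by (rule integrable_scaleR_right)
    moreover have "inverse (d * d) *\<^sub>R ((d * d) *\<^sub>R x) = x" for x :: complex
      using d unfolding scaleR_scaleR by (subst left_inverse) auto
    ultimately show ?thesis by (simp only:)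
  qed
  have gs: "(LINT y|lborel. ?g y * cis (w \<bullet> y)) = complex_of_real (2 * pi / d ^ 2 * gauss2 (w /\<^sub>R d))" for w
  proof -
    have wd: "(w /\<^sub>R d) \<bullet> (d *\<^sub>R y) = w \<bullet> y" "0 + d *\<^sub>R y = d *\<^sub>R y" for y using d by simp_all
    have "complex_of_real (2 * pi * gauss2 (w /\<^sub>R d)) = (LINT y|lborel. complex_of_real (gauss2 y) * cis ((w /\<^sub>R d) \<bullet> y))"
      by (rule integral_gauss2_cis[symmetric])
    also have "\<dots> = d ^ 2 *\<^sub>R (LINT y|lborel. ?g y * cis (w \<bullet> y))"
    proof -
      have "(\<lambda>y. complex_of_real (gauss2 y) * cis ((w /\<^sub>R d) \<bullet> y)) \<in> borel_measurable borel" by measurable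
      from integral_affine_lborel[OF _ this, of d 0] show ?thesis
        using d unfolding wd by (simp add: power2_eq_square)
    qed
    finally show ?thesis using d by (simp add: scaleR_conv_of_real field_simps)
  qed
  define B where "B = (LINT w|lborel. cmod (v w))"
  have gv: "integrable lborel (\<lambda>y. ?g y * fourier v y)"
  proof (rule Bochner_Integration.integrable_bound)
    show "integrable lborel (\<lambda>y. complex_of_real B * ?g y)" using gi by simp
    show "AE y in lborel. norm (?g y * fourier v y) \<le> norm (complex_of_real B * ?g y)"
    proof (rule AE_I2)
      fix y
      have "cmod (fourier v y) * cmod (?g y) \<le> B * cmod (?g y)"
        unfolding B_def by (intro mult_right_mono fourier_bound[OF v]) auto
      also have "\<dots> \<le> \<bar>B\<bar> * cmod (?g y)" by (intro mult_right_mono) auto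
      finally show "norm (?g y * fourier v y) \<le> norm (complex_of_real B * ?g y)"
        by (simp add: norm_mult mult.commute)
    qed
  qed measurable
  \<comment> \<open>Integrating in \<open>y\<close> first turns the damping factor into a Gaussian
    of width \<open>d\<close> centred at \<open>w\<close>. Substituting
    \<open>w - d *\<^sub>R x\<close> gives the planar Jacobian \<open>d ^ 2\<close>, which cancels
    the normalization of that Gaussian.\<close>
  have inner: "(LINT y|lborel. ?g y * fourier v y * cis (w \<bullet> y)) = (LINT x|lborel. complex_of_real (gauss2 x) * v (w - d *\<^sub>R x))" for w
  proof -
    have "(LINT y|lborel. ?g y * fourier v y * cis (w \<bullet> y)) = ?c * (LINT y|lborel. LINT x|lborel. v x * ?g y * (cis (w \<bullet> y) * cis (- (x \<bullet> y))))"
    proof -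
      have "?g y * fourier v y * cis (w \<bullet> y) = ?c * (LINT x|lborel. v x * ?g y * (cis (w \<bullet> y) * cis (- (x \<bullet> y))))" for y
      proof -
        have "(LINT x|lborel. v x * ?g y * (cis (w \<bullet> y) * cis (- (x \<bullet> y)))) =
           (LINT x|lborel. (?g y * cis (w \<bullet> y)) * (v x * cis (- (x \<bullet> y))))" by (simp only: mult_ac)
        also have "\<dots> = ?g y * cis (w \<bullet> y) * (LINT x|lborel. v x * cis (- (x \<bullet> y)))"
          by (rule integral_mult_right_zero)
        finally show ?thesis unfolding fourier_eq[of v] by (simp only: mult_ac)
      qed
      then show ?thesis by simp
    qed
    also have "(LINT y|lborel. LINT x|lborel. v x * ?g y * (cis (w \<bullet> y) * cis (- (x \<bullet> y)))) =
       (LINT x|lborel. LINT y|lborel. v x * ?g y * (cis (w \<bullet> y) * cis (- (x \<bullet> y))))"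
      by (rule Fubini_prod_bounded[OF v gi]) (auto simp: norm_mult)
    also have "\<dots> = (LINT x|lborel. v x * complex_of_real (2 * pi / d ^ 2 * gauss2 ((w - x) /\<^sub>R d)))"
    proof (intro Bochner_Integration.integral_cong refl)
      fix x
      have "(LINT y|lborel. v x * ?g y * (cis (w \<bullet> y) * cis (- (x \<bullet> y)))) = (LINT y|lborel. v x * (?g y * cis ((w - x) \<bullet> y)))"
        by (simp add: cis_mult inner_diff_left mult_ac)
      also have "\<dots> = v x * (LINT y|lborel. ?g y * cis ((w - x) \<bullet> y))" by (rule integral_mult_right_zero)
      finally show "(LINT y|lborel. v x * ?g y * (cis (w \<bullet> y) * cis (- (x \<bullet> y)))) = v x * complex_of_real (2 * pi / d ^ 2 * gauss2 ((w - x) /\<^sub>R d))"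
        by (simp only: gs)
    qed
    also have "\<dots> = d ^ 2 *\<^sub>R (LINT x|lborel. v (w + (- d) *\<^sub>R x) * complex_of_real (2 * pi / d ^ 2 * gauss2 ((w - (w + (- d) *\<^sub>R x)) /\<^sub>R d)))"
      using d by (subst integral_affine_lborel[of "- d" _ w]) (simp_all add: power2_eq_square)
    also have "\<dots> = (LINT x|lborel. d ^ 2 *\<^sub>R (v (w + (- d) *\<^sub>R x) * complex_of_real (2 * pi / d ^ 2 * gauss2 ((w - (w + (- d) *\<^sub>R x)) /\<^sub>R d))))"
      by (rule integral_scaleR_right[symmetric]) 
    also have "\<dots> = (LINT x|lborel. complex_of_real (2 * pi) * (complex_of_real (gauss2 x) * v (w - d *\<^sub>R x)))"
      using d by (intro Bochner_Integration.integral_cong refl) (simp add: scaleR_conv_of_real field_simps)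
    finally show ?thesis by simp
  qed
  have "(LINT y|lborel. ?g y * fourier v y * fourier u (z - y)) =
      ?c * (LINT y|lborel. LINT w|lborel. u w * (?g y * fourier v y) * cis (- (w \<bullet> (z - y))))"
  proof -
    have "?g y * fourier v y * fourier u (z - y) = ?c * (LINT w|lborel. u w * (?g y * fourier v y) * cis (- (w \<bullet> (z - y))))" for y
    proof -
      have "(LINT w|lborel. u w * (?g y * fourier v y) * cis (- (w \<bullet> (z - y)))) =
         (LINT w|lborel. (?g y * fourier v y) * (u w * cis (- (w \<bullet> (z - y)))))" by (simp only: mult_ac)
      also have "\<dots> = ?g y * fourier v y * (LINT w|lborel. u w * cis (- (w \<bullet> (z - y))))"
        by (rule integral_mult_right_zero)
      finally show ?thesis unfolding fourier_eq[of u] by (simp only: mult_ac)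
    qed
    then show ?thesis by simp
  qed
  also have "(LINT y|lborel. LINT w|lborel. u w * (?g y * fourier v y) * cis (- (w \<bullet> (z - y))))
     = (LINT w|lborel. LINT y|lborel. u w * (?g y * fourier v y) * cis (- (w \<bullet> (z - y))))"
    by (rule Fubini_prod_bounded[OF u gv]) auto
  also have "\<dots> = (LINT w|lborel. u w * cis (- (w \<bullet> z)) * (LINT x|lborel. complex_of_real (gauss2 x) * v (w - d *\<^sub>R x)))"
  proof (intro Bochner_Integration.integral_cong refl)
    fix w
    have "(LINT y|lborel. u w * (?g y * fourier v y) * cis (- (w \<bullet> (z - y)))) =
       (LINT y|lborel. (u w * cis (- (w \<bullet> z))) * (?g y * fourier v y * cis (w \<bullet> y)))"
    proof (intro Bochner_Integration.integral_cong refl)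
      fix y
      have "cis (- (w \<bullet> (z - y))) = cis (- (w \<bullet> z)) * cis (w \<bullet> y)"
        by (simp add: cis_mult inner_diff_right)
      then show "u w * (?g y * fourier v y) * cis (- (w \<bullet> (z - y))) = (u w * cis (- (w \<bullet> z))) * (?g y * fourier v y * cis (w \<bullet> y))"
        by (simp only: mult_ac)
    qed
    also have "\<dots> = u w * cis (- (w \<bullet> z)) * (LINT y|lborel. ?g y * fourier v y * cis (w \<bullet> y))"
      by (rule integral_mult_right_zero)
    finally show "(LINT y|lborel. u w * (?g y * fourier v y) * cis (- (w \<bullet> (z - y)))) =
       u w * cis (- (w \<bullet> z)) * (LINT x|lborel. complex_of_real (gauss2 x) * v (w - d *\<^sub>R x))" by (simp only: inner)
  qed
  finally show ?thesis .
qed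

text \<open>Let the width \<open>d\<close> tend to 0 in \<open>fourier_mollified\<close>. The right
  side bounds every damped integral because \<open>gauss2\<close> is at most 1, and the left side
  converges by dominated convergence. The damping factor itself tends to
  \<open>gauss2 0 = 1 / (2 * pi)\<close>, the constant of the exact identity, which is given away
  here.\<close>

lemma fourier_mult_le:
  assumes u: "integrable lborel u" and v: "integrable lborel v"
    and cont: "continuous_on UNIV v" and bd: "\<And>x. cmod (v x) \<le> B"
  shows "ennreal (cmod (fourier (\<lambda>w. u w * v w) z)) \<le>
    (\<integral>\<^sup>+y. ennreal (cmod (fourier v y) * cmod (fourier u (z - y))) \<partial>lborel)" (is "_ \<le> ?R")
proof -
  have [measurable]: "u \<in> borel_measurable borel" "v \<in> borel_measurable borel"
    using u v by (auto dest: borel_measurable_integrable)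
  note [measurable] = borel_measurable_fourier[OF u] borel_measurable_fourier[OF v]
  let ?c = "complex_of_real (1 / (2 * pi))"
  define d where "d n = 1 / real (Suc n)" for n
  have d: "d n > 0" for n by (simp add: d_def)
  have d0: "d \<longlonglongrightarrow> 0" unfolding d_def by (rule LIMSEQ_Suc[OF lim_1_over_n])
  have B0: "B \<ge> 0" using bd[of 0] norm_ge_zero[of "v 0"] by linarith
  let ?P = "\<lambda>n w. LINT x|lborel. complex_of_real (gauss2 x) * v (w - d n *\<^sub>R x)"
  have gB: "integrable lborel (\<lambda>x. B * gauss2 x)"
    using integrable_norm[OF integrable_gauss2] gauss2_nonneg by simp
  have P: "(\<lambda>n. ?P n w) \<longlonglongrightarrow> v w" for w
  proof -
    have "(\<lambda>n. ?P n w) \<longlonglongrightarrow> (LINT x|lborel. complex_of_real (gauss2 x) * v w)"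
    proof (rule integral_dominated_convergence[OF _ _ gB])
      have "(\<lambda>n. v (w - d n *\<^sub>R x)) \<longlonglongrightarrow> v w" for x
      proof -
        have "(\<lambda>n. w - d n *\<^sub>R x) \<longlonglongrightarrow> w - 0 *\<^sub>R x" by (intro tendsto_intros d0)
        then have "(\<lambda>n. w - d n *\<^sub>R x) \<longlonglongrightarrow> w" by simp
        then show ?thesis using cont by (auto intro: continuous_on_tendsto_compose)
      qed
      then show "AE x in lborel. (\<lambda>n. complex_of_real (gauss2 x) * v (w - d n *\<^sub>R x)) \<longlonglongrightarrow> complex_of_real (gauss2 x) * v w"
        by (intro AE_I2 tendsto_mult tendsto_const)
      show "AE x in lborel. cmod (complex_of_real (gauss2 x) * v (w - d n *\<^sub>R x)) \<le> B * gauss2 x" for n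
      proof (rule AE_I2)
        fix x
        show "cmod (complex_of_real (gauss2 x) * v (w - d n *\<^sub>R x)) \<le> B * gauss2 x"
          using mult_right_mono[OF bd[of "w - d n *\<^sub>R x"] gauss2_nonneg[of x]] gauss2_nonneg[of x]
          by (simp add: norm_mult mult.commute)
      qed
    qed measurable
    then show ?thesis by (simp add: integral_gauss2)
  qed
  have Pb: "cmod (?P n w) \<le> B" for n w
  proof -
    have "cmod (?P n w) \<le> (LINT x|lborel. B * gauss2 x)"
    proof (rule Bochner_Integration.integral_norm_bound_integral[OF _ gB])
      have le: "cmod (complex_of_real (gauss2 x) * v (w - d n *\<^sub>R x)) \<le> B * gauss2 x" for x
        using mult_right_mono[OF bd[of "w - d n *\<^sub>R x"] gauss2_nonneg[of x]] gauss2_nonneg[of x]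
        by (simp add: norm_mult mult.commute)
      then show "cmod (complex_of_real (gauss2 x) * v (w - d n *\<^sub>R x)) \<le> B * gauss2 x" for x .
      show "integrable lborel (\<lambda>x. complex_of_real (gauss2 x) * v (w - d n *\<^sub>R x))"
        by (rule Bochner_Integration.integrable_bound[OF gB])
           (use le B0 gauss2_nonneg in \<open>auto intro!: AE_I2 simp del: norm_mult\<close>)
    qed
    also have "\<dots> = B"
      by (simp add: integral_gauss2)
    finally show ?thesis .
  qed
  let ?A = "\<lambda>n. LINT y|lborel. complex_of_real (gauss2 (d n *\<^sub>R y)) * fourier v y * fourier u (z - y)"
  have lim: "?A \<longlonglongrightarrow> fourier (\<lambda>w. u w * v w) z"
  proof -
    have "(\<lambda>n. LINT w|lborel. u w * cis (- (w \<bullet> z)) * ?P n w) \<longlonglongrightarrow> (LINT w|lborel. u w * cis (- (w \<bullet> z)) * v w)"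
    proof (rule integral_dominated_convergence)
      show "integrable lborel (\<lambda>w. cmod (u w) * B)" using u by simp
      show "AE w in lborel. (\<lambda>n. u w * cis (- (w \<bullet> z)) * ?P n w) \<longlonglongrightarrow> u w * cis (- (w \<bullet> z)) * v w"
        by (intro AE_I2 tendsto_mult tendsto_const P)
      show "AE w in lborel. cmod (u w * cis (- (w \<bullet> z)) * ?P n w) \<le> cmod (u w) * B" for n
        using Pb by (auto simp: norm_mult intro!: mult_left_mono)
      show "(\<lambda>w. u w * cis (- (w \<bullet> z)) * ?P n w) \<in> borel_measurable lborel" for n by measurable
    qed measurable
    then have "(\<lambda>n. ?c * (LINT w|lborel. u w * cis (- (w \<bullet> z)) * ?P n w)) \<longlonglongrightarrow> ?c * (LINT w|lborel. u w * cis (- (w \<bullet> z)) * v w)"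
      by (intro tendsto_mult tendsto_const)
    moreover have "?c * (LINT w|lborel. u w * cis (- (w \<bullet> z)) * v w) = fourier (\<lambda>w. u w * v w) z"
      unfolding fourier_eq by (simp only: mult_ac)
    ultimately show ?thesis by (simp only: fourier_mollified[OF u v d])
  qed
  have le: "ennreal (cmod (?A n)) \<le> ?R" for n
  proof -
    \<comment> \<open>Were the integrand not integrable, the Bochner integral would take the default
      value 0, so the bound holds in either case.\<close>
    have "ennreal (cmod (?A n)) \<le> (\<integral>\<^sup>+y. ennreal (cmod (complex_of_real (gauss2 (d n *\<^sub>R y)) * fourier v y * fourier u (z - y))) \<partial>lborel)"
      by (cases "integrable lborel (\<lambda>y. complex_of_real (gauss2 (d n *\<^sub>R y)) * fourier v y * fourier u (z - y))")
         (auto simp: not_integrable_integral_eq intro: integral_norm_bound_ennreal)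
    also have "\<dots> \<le> ?R"
      using gauss2_le_1 gauss2_nonneg
      by (intro nn_integral_mono ennreal_leI) (auto simp: norm_mult mult.assoc intro!: mult_left_le_one_le)
    finally show ?thesis .
  qed
  have "(\<lambda>n. ennreal (cmod (?A n))) \<longlonglongrightarrow> ennreal (cmod (fourier (\<lambda>w. u w * v w) z))"
    by (intro tendsto_ennrealI tendsto_norm lim)
  then show ?thesis by (rule LIMSEQ_le_const2) (use le in auto)
qed

subsection \<open>Schwartz functions\<close>

text \<open>The demand that the Schwartz condition makes on a single derivative. It is not inherited
  by \<open>dx f\<close>, which is why lemmas about derivatives assume \<open>rapid\<close> for each
  function separately.\<close>

definition rapid :: "(real \<times> real \<Rightarrow> complex) \<Rightarrow> bool" where
  "rapid f \<longleftrightarrow> f differentiable_on UNIV \<and>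
     (\<forall>m n. \<exists>M. \<forall>x t. \<bar>x\<bar> ^ m * \<bar>t\<bar> ^ n * cmod (f (x, t)) \<le> M)"

lemma schwartz_iff_rapid: "schwartz f \<longleftrightarrow> (\<forall>j k. rapid ((dt ^^ k) ((dx ^^ j) f)))"
  by (simp add: schwartz_def rapid_def)

lemma rapid_continuous: "rapid f \<Longrightarrow> continuous_on UNIV f"
  by (simp add: rapid_def differentiable_imp_continuous_on)

lemma rapid_has_dx:
  assumes "rapid f"
  shows "((\<lambda>y. f (y, t)) has_vector_derivative dx f (x, t)) (at x)"
proof -
  have "f differentiable (at (x, t))" using assms by (auto simp: rapid_def differentiable_on_def)
  moreover have "(\<lambda>y. (y, t)) differentiable (at x)"
    by (intro differentiableI[where f'="\<lambda>y. (y, 0)"] derivative_eq_intros) auto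
  ultimately have "(f \<circ> (\<lambda>y. (y, t))) differentiable (at x)"
    by (intro differentiable_chain_at) auto
  then show ?thesis by (simp add: dx_def o_def vector_derivative_works)
qed

lemma rapid_has_dt:
  assumes "rapid f"
  shows "((\<lambda>r. f (x, r)) has_vector_derivative dt f (x, t)) (at t)"
proof -
  have "f differentiable (at (x, t))" using assms by (auto simp: rapid_def differentiable_on_def)
  moreover have "(\<lambda>r. (x, r)) differentiable (at t)"
    by (intro differentiableI[where f'="\<lambda>y. (0, y)"] derivative_eq_intros) auto
  ultimately have "(f \<circ> (\<lambda>r. (x, r))) differentiable (at t)"
    by (intro differentiable_chain_at) auto
  then show ?thesis by (simp add: dt_def o_def vector_derivative_works)
qed

lemma rapid_bound:
  assumes "rapid f"
  obtains M where "M \<ge> 0" "\<And>x t. cmod (f (x, t)) \<le> M / ((1 + x ^ 2) * (1 + t ^ 2))"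
proof -
  have "\<exists>M. \<forall>x t. \<bar>x\<bar> ^ m * \<bar>t\<bar> ^ n * cmod (f (x, t)) \<le> M" for m n
    using assms by (auto simp: rapid_def)
  then obtain M where M: "\<And>m n x t. \<bar>x\<bar> ^ m * \<bar>t\<bar> ^ n * cmod (f (x, t)) \<le> M m n" by metis
  \<comment> \<open>The four terms come from expanding
    \<open>(1 + x ^ 2) * (1 + t ^ 2)\<close>.\<close>
  let ?M = "M 0 0 + M 2 0 + M 0 2 + M 2 2"
  have b: "(1 + x ^ 2) * (1 + t ^ 2) * cmod (f (x, t)) \<le> ?M" for x t
    using M[where x=x and t=t, of 0 0] M[where x=x and t=t, of 2 0] M[where x=x and t=t, of 0 2] M[where x=x and t=t, of 2 2]
    by (simp add: algebra_simps)
  have "0 \<le> cmod (f (0, 0))" by simp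
  also have "\<dots> \<le> ?M" using b[of 0 0] by simp
  finally have "?M \<ge> 0" .
  moreover have "cmod (f (x, t)) \<le> ?M / ((1 + x ^ 2) * (1 + t ^ 2))" for x t
  proof -
    have "(1 + x ^ 2) * (1 + t ^ 2) > 0" by (intro mult_pos_pos add_pos_nonneg) auto
    then show ?thesis using b[of x t] by (simp add: pos_le_divide_eq mult.commute)
  qed
  ultimately show ?thesis using that by blast
qed

lemma integrable_inverse_1_plus_square: "integrable lborel (\<lambda>x::real. 1 / (1 + x ^ 2))"
proof (rule integrableI_bounded)
  have "norm (1 / (1 + x ^ 2)) = jbracket x powr - 2" for x :: real
    using powr_realpow[of "jbracket x" 2] by (simp add: powr_minus jbracket_power2 divide_inverse)
  then show "(\<integral>\<^sup>+x. ennreal (norm (1 / (1 + x\<^sup>2))) \<partial>(lborel :: real measure)) < \<infinity>"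
    using nn_integral_jbracket_powr_finite[of 2] by (simp only:)
qed simp

lemma integrable_weight: "integrable lborel (\<lambda>z::real \<times> real. 1 / ((1 + fst z ^ 2) * (1 + snd z ^ 2)))"
proof -
  let ?f = "\<lambda>x::real. complex_of_real (1 / (1 + x ^ 2))"
  have f: "integrable lborel ?f" by (rule integrable_of_real[OF integrable_inverse_1_plus_square])
  have "integrable (lborel \<Otimes>\<^sub>M lborel) (\<lambda>(x, y). ?f x * ?f y * 1)"
    by (rule integrable_prod_bounded[OF f f]) auto
  then have "integrable lborel (\<lambda>(x, y). ?f x * ?f y * 1)" by (simp only: lborel_prod)
  from integrable_norm[OF this]
  have "integrable lborel (\<lambda>z. cmod (?f (fst z) * ?f (snd z) * 1))" by (simp only: case_prod_unfold)
  moreover have "cmod (?f x * ?f y * 1) = 1 / ((1 + x ^ 2) * (1 + y ^ 2))" for x y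
    unfolding mult_1_right norm_mult norm_of_real by (simp add: abs_of_nonneg)
  ultimately show ?thesis by (simp only:)
qed

lemma rapid_integrable:
  assumes "rapid f" shows "integrable lborel f"
proof -
  obtain M where M: "M \<ge> 0" "\<And>x t. cmod (f (x, t)) \<le> M / ((1 + x ^ 2) * (1 + t ^ 2))"
    using rapid_bound[OF assms] by blast
  have "integrable lborel (\<lambda>z::real \<times> real. M * (1 / ((1 + fst z ^ 2) * (1 + snd z ^ 2))))"
    by (intro integrable_mult_right integrable_weight)
  then show ?thesis
  proof (rule Bochner_Integration.integrable_bound)
    show "f \<in> borel_measurable lborel"
      using borel_measurable_continuous_onI[OF rapid_continuous[OF assms]] by simp
    show "AE z in lborel. norm (f z) \<le> norm (M * (1 / ((1 + fst z ^ 2) * (1 + snd z ^ 2))))"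
    proof (rule AE_I2)
      fix z :: "real \<times> real"
      have "norm (f z) \<le> M * (1 / ((1 + fst z ^ 2) * (1 + snd z ^ 2)))"
        using M(2)[of "fst z" "snd z"] by simp
      also have "\<dots> \<le> norm (M * (1 / ((1 + fst z ^ 2) * (1 + snd z ^ 2))))" by (simp only: real_norm_def abs_ge_self)
      finally show "norm (f z) \<le> norm (M * (1 / ((1 + fst z ^ 2) * (1 + snd z ^ 2))))" .
    qed
  qed
qed

lemma rapid_bounded: assumes "rapid f" obtains B where "\<And>z. cmod (f z) \<le> B"
proof -
  obtain B where B: "\<forall>x t. \<bar>x\<bar> ^ 0 * \<bar>t\<bar> ^ 0 * cmod (f (x, t)) \<le> B" using assms unfolding rapid_def by blast
  then have "cmod (f z) \<le> B" for z by (cases z) auto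
  then show ?thesis by (rule that)
qed

text \<open>Integration by parts in one variable: the integrand is the derivative of
  \<open>g x * cis (- (x * \<xi> + c))\<close>, which tends to 0 at both ends. The constant
  \<open>c\<close> holds the phase of the variable kept fixed.\<close>

lemma integral_deriv_cis_eq_0:
  fixes g g' :: "real \<Rightarrow> complex"
  assumes g: "\<And>x. (g has_vector_derivative g' x) (at x)"
    and cont: "continuous_on UNIV g'"
    and b: "\<And>x. cmod (g x) \<le> M / (1 + x ^ 2)" "\<And>x. cmod (g' x) \<le> M / (1 + x ^ 2)"
  shows "(LINT x|lborel. (g' x - \<i> * complex_of_real \<xi> * g x) * cis (- (x * \<xi> + c))) = 0"
proof -
  let ?F = "\<lambda>x. g x * cis (- (x * \<xi> + c))"
  let ?f = "\<lambda>x. (g' x - \<i> * complex_of_real \<xi> * g x) * cis (- (x * \<xi> + c))"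
  have cg: "continuous_on UNIV g"
    using g by (intro continuous_at_imp_continuous_on ballI) (blast intro: has_vector_derivative_continuous)
  have cf: "continuous_on UNIV ?f"
    by (intro continuous_intros continuous_on_cis cont cg)
  have F: "(?F has_vector_derivative ?f x) (at x)" for x
  proof -
    have "((\<lambda>x. cis (- (x * \<xi> + c))) has_vector_derivative (- \<xi>) *\<^sub>R (\<i> * cis (- (x * \<xi> + c)))) (at x)"
    proof -
      have "((\<lambda>x. - (x * \<xi> + c)) has_real_derivative - \<xi>) (at x)"
        by (auto intro!: derivative_eq_intros)
      then have "((\<lambda>x. \<i> * complex_of_real (- (x * \<xi> + c))) has_vector_derivative \<i> * complex_of_real (- \<xi>)) (at x)"
        by (intro has_vector_derivative_mult_right has_vector_derivative_of_real)
      from field_vector_diff_chain_at[OF this DERIV_exp] show ?thesis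
        by (simp add: cis_conv_exp o_def scaleR_conv_of_real mult_ac)
    qed
    from has_vector_derivative_mult[OF g this] show ?thesis
      by (simp add: scaleR_conv_of_real algebra_simps)
  qed
  have int: "integrable lborel ?f"
  proof (rule Bochner_Integration.integrable_bound)
    show "integrable lborel (\<lambda>x. (M + \<bar>\<xi>\<bar> * M) * (1 / (1 + x ^ 2)))"
      by (intro integrable_mult_right integrable_inverse_1_plus_square)
    show "?f \<in> borel_measurable lborel" using borel_measurable_continuous_onI[OF cf] by simp
    show "AE x in lborel. norm (?f x) \<le> norm ((M + \<bar>\<xi>\<bar> * M) * (1 / (1 + x ^ 2)))"
    proof (rule AE_I2)
      fix x
      have "norm (?f x) \<le> norm (g' x) + \<bar>\<xi>\<bar> * norm (g x)"
        using norm_triangle_ineq4[of "g' x" "\<i> * complex_of_real \<xi> * g x"] by (simp add: norm_mult)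
      also have "\<dots> \<le> M / (1 + x ^ 2) + \<bar>\<xi>\<bar> * (M / (1 + x ^ 2))"
        by (intro add_mono mult_left_mono b) auto
      also have "\<dots> = (M + \<bar>\<xi>\<bar> * M) * (1 / (1 + x ^ 2))" by (simp add: add_divide_distrib)
      also have "\<dots> \<le> norm ((M + \<bar>\<xi>\<bar> * M) * (1 / (1 + x ^ 2)))" by (simp only: real_norm_def abs_ge_self)
      finally show "norm (?f x) \<le> norm ((M + \<bar>\<xi>\<bar> * M) * (1 / (1 + x ^ 2)))" .
    qed
  qed
  have lim: "(?F \<longlongrightarrow> 0) at_top" "(?F \<longlongrightarrow> 0) at_bot"
  proof -
    have le: "norm (?F x) \<le> M / (1 + x ^ 2)" for x using b(1)[of x] by (simp add: norm_mult)
    have "filterlim (\<lambda>x::real. 1 + x ^ 2) at_top at_top"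
      by (intro filterlim_tendsto_add_at_top[OF tendsto_const] filterlim_pow_at_top filterlim_ident) auto
    then have "((\<lambda>x. M / (1 + x ^ 2)) \<longlongrightarrow> 0) at_top"
      by (intro tendsto_divide_0[OF tendsto_const] filterlim_at_top_imp_at_infinity)
    then show "(?F \<longlongrightarrow> 0) at_top"
      by (rule Lim_null_comparison[OF always_eventually[OF allI[OF le]]])
    have "filterlim (\<lambda>x::real. 1 + x ^ 2) at_top at_bot"
      by (intro filterlim_tendsto_add_at_top[OF tendsto_const] filterlim_pow_at_bot_even filterlim_ident) auto
    then have "((\<lambda>x. M / (1 + x ^ 2)) \<longlongrightarrow> 0) at_bot"
      by (intro tendsto_divide_0[OF tendsto_const] filterlim_at_top_imp_at_infinity)
    then show "(?F \<longlongrightarrow> 0) at_bot"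
      by (rule Lim_null_comparison[OF always_eventually[OF allI[OF le]]])
  qed
  have "(LBINT x=-\<infinity>..\<infinity>. ?f x) = 0 - 0"
  proof (rule interval_integral_FTC_integrable)
    show "(?F has_vector_derivative ?f x) (at x)" for x by (rule F)
    show "isCont ?f x" for x using cf by (simp add: continuous_on_eq_continuous_at)
    show "set_integrable lborel (einterval (- \<infinity>) \<infinity>) ?f"
      using int by (simp add: set_integrable_def)
  qed (use lim in \<open>simp_all add: ereal_tendsto_simps\<close>)
  then show ?thesis by (simp add: interval_lebesgue_integral_def set_lebesgue_integral_def)
qed

lemma fourier_diff_scaled:
  assumes "integrable lborel f" "integrable lborel g"
  shows "fourier f z - c * fourier g z = complex_of_real (1 / (2 * pi)) * (LINT w|lborel. (f w - c * g w) * cis (- (w \<bullet> z)))"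
proof -
  have i: "integrable lborel (\<lambda>w. f w * cis (- (w \<bullet> z)))" "integrable lborel (\<lambda>w. c * (g w * cis (- (w \<bullet> z))))"
    using assms by (auto intro!: integrable_cis integrable_mult_right)
  have "(LINT w|lborel. (f w - c * g w) * cis (- (w \<bullet> z))) =
     (LINT w|lborel. f w * cis (- (w \<bullet> z)) - c * (g w * cis (- (w \<bullet> z))))" by (simp add: algebra_simps)
  also have "\<dots> = (LINT w|lborel. f w * cis (- (w \<bullet> z))) - (LINT w|lborel. c * (g w * cis (- (w \<bullet> z))))"
    by (rule Bochner_Integration.integral_diff[OF i])
  also have "(LINT w|lborel. c * (g w * cis (- (w \<bullet> z)))) = c * (LINT w|lborel. g w * cis (- (w \<bullet> z)))"
    by (rule integral_mult_right_zero)
  finally show ?thesis unfolding fourier_eq by (simp add: right_diff_distrib mult.left_commute)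
qed

text \<open>After subtraction one double integral has to vanish. Integrated in \<open>x\<close>
  first, it is the integral of a total derivative for every fixed \<open>t\<close>.\<close>

lemma fourier_dx:
  assumes f: "rapid f" and f': "rapid (dx f)"
  shows "fourier (dx f) z = \<i> * complex_of_real (fst z) * fourier f z"
proof -
  obtain \<xi> \<tau> where z: "z = (\<xi>, \<tau>)" by fastforce
  let ?h = "\<lambda>x t. (dx f (x, t) - \<i> * complex_of_real \<xi> * f (x, t)) * cis (- (x * \<xi> + t * \<tau>))"
  have hz: "(dx f w - \<i> * complex_of_real \<xi> * f w) * cis (- (w \<bullet> z)) = case_prod ?h w" for w
    by (cases w) (simp add: z)
  have "integrable lborel (\<lambda>w. (dx f w - \<i> * complex_of_real \<xi> * f w) * cis (- (w \<bullet> z)))"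
    by (intro integrable_cis Bochner_Integration.integrable_diff integrable_mult_right rapid_integrable f f') measurable
  then have int: "integrable (lborel \<Otimes>\<^sub>M lborel) (case_prod ?h)"
    unfolding hz lborel_prod by simp
  obtain M where M: "M \<ge> 0" "\<And>x t. cmod (f (x, t)) \<le> M / ((1 + x ^ 2) * (1 + t ^ 2))"
    using rapid_bound[OF f] by blast
  obtain M' where M': "M' \<ge> 0" "\<And>x t. cmod (dx f (x, t)) \<le> M' / ((1 + x ^ 2) * (1 + t ^ 2))"
    using rapid_bound[OF f'] by blast
  have div: "K / ((1 + x ^ 2) * (1 + t ^ 2)) \<le> (M + M') / (1 + x ^ 2)" if "K \<ge> 0" "K \<le> M + M'" for K x t :: real
  proof (rule frac_le)
    have "(1 + x ^ 2) * 1 \<le> (1 + x ^ 2) * (1 + t ^ 2)" by (intro mult_left_mono add_nonneg_nonneg) auto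
    then show "1 + x ^ 2 \<le> (1 + x ^ 2) * (1 + t ^ 2)" by simp
  qed (use that in \<open>auto intro: add_pos_nonneg\<close>)
  have "(LINT x|lborel. ?h x t) = 0" for t
  proof (rule integral_deriv_cis_eq_0[OF rapid_has_dx[OF f]])
    show "continuous_on UNIV (\<lambda>x. dx f (x, t))"
      by (intro continuous_on_compose2[OF rapid_continuous[OF f']] continuous_intros) auto
    show "cmod (f (x, t)) \<le> (M + M') / (1 + x ^ 2)" for x
      using M(2)[of x t] div[of M x t] M(1) M'(1) by linarith
    show "cmod (dx f (x, t)) \<le> (M + M') / (1 + x ^ 2)" for x
      using M'(2)[of x t] div[of M' x t] M(1) M'(1) by linarith
  qed
  then have "0 = (LINT t|lborel. LINT x|lborel. ?h x t)" by simp
  also have "\<dots> = integral\<^sup>L lborel (case_prod ?h)"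
    using lborel_pair.integral_snd[OF int] by (simp add: lborel_prod)
  finally have "fourier (dx f) z - \<i> * complex_of_real \<xi> * fourier f z = 0"
    unfolding fourier_diff_scaled[OF rapid_integrable[OF f'] rapid_integrable[OF f]] hz by simp
  then show ?thesis by (simp add: z)
qed

lemma fourier_dt:
  assumes f: "rapid f" and f': "rapid (dt f)"
  shows "fourier (dt f) z = \<i> * complex_of_real (snd z) * fourier f z"
proof -
  obtain \<xi> \<tau> where z: "z = (\<xi>, \<tau>)" by fastforce
  let ?h = "\<lambda>x t. (dt f (x, t) - \<i> * complex_of_real \<tau> * f (x, t)) * cis (- (t * \<tau> + x * \<xi>))"
  have hz: "(dt f w - \<i> * complex_of_real \<tau> * f w) * cis (- (w \<bullet> z)) = case_prod ?h w" for w
    by (cases w) (simp add: z add.commute)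
  have "integrable lborel (\<lambda>w. (dt f w - \<i> * complex_of_real \<tau> * f w) * cis (- (w \<bullet> z)))"
    by (intro integrable_cis Bochner_Integration.integrable_diff integrable_mult_right rapid_integrable f f') measurable
  then have int: "integrable (lborel \<Otimes>\<^sub>M lborel) (case_prod ?h)"
    unfolding hz lborel_prod by simp
  obtain M where M: "M \<ge> 0" "\<And>x t. cmod (f (x, t)) \<le> M / ((1 + x ^ 2) * (1 + t ^ 2))"
    using rapid_bound[OF f] by blast
  obtain M' where M': "M' \<ge> 0" "\<And>x t. cmod (dt f (x, t)) \<le> M' / ((1 + x ^ 2) * (1 + t ^ 2))"
    using rapid_bound[OF f'] by blast
  have div: "K / ((1 + x ^ 2) * (1 + t ^ 2)) \<le> (M + M') / (1 + t ^ 2)" if "K \<ge> 0" "K \<le> M + M'" for K x t :: real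
  proof (rule frac_le)
    have "1 * (1 + t ^ 2) \<le> (1 + x ^ 2) * (1 + t ^ 2)" by (intro mult_right_mono add_nonneg_nonneg) auto
    then show "1 + t ^ 2 \<le> (1 + x ^ 2) * (1 + t ^ 2)" by simp
  qed (use that in \<open>auto intro: add_pos_nonneg\<close>)
  have "(LINT t|lborel. ?h x t) = 0" for x
  proof (rule integral_deriv_cis_eq_0[OF rapid_has_dt[OF f]])
    show "continuous_on UNIV (\<lambda>t. dt f (x, t))"
      by (intro continuous_on_compose2[OF rapid_continuous[OF f']] continuous_intros) auto
    show "cmod (f (x, t)) \<le> (M + M') / (1 + t ^ 2)" for t
      using M(2)[of x t] div[of M x t] M(1) M'(1) by linarith
    show "cmod (dt f (x, t)) \<le> (M + M') / (1 + t ^ 2)" for t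
      using M'(2)[of x t] div[of M' x t] M(1) M'(1) by linarith
  qed
  then have "0 = (LINT x|lborel. LINT t|lborel. ?h x t)" by simp
  also have "\<dots> = integral\<^sup>L lborel (case_prod ?h)"
    using lborel_pair.integral_fst[OF int] by (simp add: lborel_prod)
  finally have "fourier (dt f) z - \<i> * complex_of_real \<tau> * fourier f z = 0"
    unfolding fourier_diff_scaled[OF rapid_integrable[OF f'] rapid_integrable[OF f]] hz by simp
  then show ?thesis by (simp add: z)
qed

lemma schwartz_rapid: "schwartz f \<Longrightarrow> rapid f"
  unfolding schwartz_iff_rapid by (metis funpow_0)

lemma schwartz_dx: "schwartz f \<Longrightarrow> schwartz (dx f)"
  unfolding schwartz_iff_rapid by (metis funpow_Suc_right o_apply)

lemma schwartz_fourier_derivs: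
  assumes "schwartz u"
  shows "fourier ((dt ^^ k) ((dx ^^ j) u)) z = (\<i> * complex_of_real (snd z)) ^ k * (\<i> * complex_of_real (fst z)) ^ j * fourier u z"
proof -
  have r: "rapid ((dt ^^ k) ((dx ^^ j) u))" for j k using assms by (simp add: schwartz_iff_rapid)
  have r0: "rapid ((dx ^^ j) u)" for j using r[of 0 j] by simp
  have x: "fourier ((dx ^^ j) u) z = (\<i> * complex_of_real (fst z)) ^ j * fourier u z"
  proof (induction j)
    case (Suc j)
    have "fourier (dx ((dx ^^ j) u)) z = \<i> * complex_of_real (fst z) * fourier ((dx ^^ j) u) z"
      using r0[of j] r0[of "Suc j"] by (intro fourier_dx) auto
    then show ?case using Suc by simp
  qed simp
  show ?thesis
  proof (induction k)
    case (Suc k)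
    have "fourier (dt ((dt ^^ k) ((dx ^^ j) u))) z = \<i> * complex_of_real (snd z) * fourier ((dt ^^ k) ((dx ^^ j) u)) z"
      using r[of k j] r[of "Suc k" j] by (intro fourier_dt) auto
    then show ?case using Suc by simp
  qed (simp add: x)
qed

text \<open>Derivatives become monomials under the transform, and even powers of the brackets are
  polynomials, so finitely many integrals of derivatives suffice. \<open>N\<close> is arbitrary
  because it must later absorb the weight of order \<open>s\<close> and the quintic growth of
  \<open>phi\<close>.\<close>

lemma schwartz_fourier_decay:
  assumes "schwartz u"
  shows "\<exists>M\<ge>0. \<forall>z. jbracket (fst z) ^ N * jbracket (snd z) ^ 2 * cmod (fourier u z) \<le> M"
proof -
  define B where "B j k = (LINT w|lborel. cmod ((dt ^^ k) ((dx ^^ j) u) w))" for j k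
  have B: "cmod (fourier ((dt ^^ k) ((dx ^^ j) u)) z) \<le> B j k" for j k z
    unfolding B_def using assms unfolding schwartz_iff_rapid by (intro fourier_bound rapid_integrable) blast
  have b: "\<bar>snd z\<bar> ^ k * \<bar>fst z\<bar> ^ j * cmod (fourier u z) \<le> B j k" for j k z
    using B[of k j z] unfolding schwartz_fourier_derivs[OF assms] by (simp add: norm_mult norm_power)
  let ?M = "2 ^ N * (B 0 0 + B (2 * N) 0 + B 0 2 + B (2 * N) 2)"
  have le: "jbracket (fst z) ^ N * jbracket (snd z) ^ 2 * cmod (fourier u z) \<le> ?M" for z
  proof -
    have "jbracket (fst z) ^ N \<le> jbracket (fst z) ^ (2 * N)"
      by (intro power_increasing jbracket_ge_1) auto
    also have "\<dots> = (1 + fst z ^ 2) ^ N" by (simp add: power_mult jbracket_power2)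
    also have "\<dots> \<le> (2 * max 1 (fst z ^ 2)) ^ N" by (intro power_mono) auto
    also have "\<dots> \<le> 2 ^ N * (1 + \<bar>fst z\<bar> ^ (2 * N))"
      unfolding power_mult_distrib by (intro mult_left_mono) (auto simp: max_def power_mult)
    finally have 1: "jbracket (fst z) ^ N \<le> 2 ^ N * (1 + \<bar>fst z\<bar> ^ (2 * N))" .
    have "jbracket (fst z) ^ N * jbracket (snd z) ^ 2 * cmod (fourier u z) \<le>
        2 ^ N * (1 + \<bar>fst z\<bar> ^ (2 * N)) * jbracket (snd z) ^ 2 * cmod (fourier u z)"
      by (intro mult_right_mono 1) auto
    also have "\<dots> = 2 ^ N * (cmod (fourier u z) + \<bar>fst z\<bar> ^ (2 * N) * cmod (fourier u z) + \<bar>snd z\<bar> ^ 2 * cmod (fourier u z)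
       + \<bar>snd z\<bar> ^ 2 * \<bar>fst z\<bar> ^ (2 * N) * cmod (fourier u z))"
      by (simp add: jbracket_power2 algebra_simps)
    also have "\<dots> \<le> ?M"
      using b[where z=z, of 0 0] b[where z=z, of 0 "2 * N"] b[where z=z, of 2 0] b[where z=z, of 2 "2 * N"]
      by (intro mult_left_mono add_mono) auto
    finally show ?thesis .
  qed
  have "0 \<le> jbracket (fst (0 :: real \<times> real)) ^ N * jbracket (snd (0 :: real \<times> real)) ^ 2 * cmod (fourier u 0)"
    by (intro mult_nonneg_nonneg zero_le_power less_imp_le[OF jbracket_pos]) auto
  then have "?M \<ge> 0" using le[of 0] by linarith
  then show ?thesis using le by blast
qed

subsection \<open>Sums and products of Schwartz functions\<close>

lemma dx_eqI: "(\<And>x t. ((\<lambda>y. f (y, t)) has_vector_derivative g (x, t)) (at x)) \<Longrightarrow> dx f = g"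
  by (auto simp: dx_def fun_eq_iff intro: vector_derivative_at)

lemma dt_eqI: "(\<And>x t. ((\<lambda>r. f (x, r)) has_vector_derivative g (x, t)) (at t)) \<Longrightarrow> dt f = g"
  by (auto simp: dt_def fun_eq_iff intro: vector_derivative_at)

lemma rapid_add:
  assumes "rapid f" "rapid g" shows "rapid (\<lambda>p. f p + g p)"
  unfolding rapid_def
proof (intro conjI allI)
  show "(\<lambda>p. f p + g p) differentiable_on UNIV"
    using assms by (auto simp: rapid_def intro: differentiable_on_add)
  fix m n
  obtain M where M: "\<And>x t. \<bar>x\<bar> ^ m * \<bar>t\<bar> ^ n * cmod (f (x, t)) \<le> M"
    using assms(1) unfolding rapid_def by blast
  obtain M' where M': "\<And>x t. \<bar>x\<bar> ^ m * \<bar>t\<bar> ^ n * cmod (g (x, t)) \<le> M'"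
    using assms(2) unfolding rapid_def by blast
  have "\<bar>x\<bar> ^ m * \<bar>t\<bar> ^ n * cmod (f (x, t) + g (x, t)) \<le> M + M'" for x t
  proof -
    have "\<bar>x\<bar> ^ m * \<bar>t\<bar> ^ n * cmod (f (x, t) + g (x, t)) \<le> \<bar>x\<bar> ^ m * \<bar>t\<bar> ^ n * (cmod (f (x, t)) + cmod (g (x, t)))"
      by (intro mult_left_mono norm_triangle_ineq) auto
    also have "\<dots> \<le> M + M'" using M[of x t] M'[of x t] by (simp add: distrib_left)
    finally show ?thesis .
  qed
  then show "\<exists>M. \<forall>x t. \<bar>x\<bar> ^ m * \<bar>t\<bar> ^ n * cmod (f (x, t) + g (x, t)) \<le> M" by blast
qed

lemma rapid_uminus: "rapid f \<Longrightarrow> rapid (\<lambda>p. - f p)"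
  by (simp add: rapid_def differentiable_on_minus)

lemma rapid_mult:
  assumes "rapid f" "rapid g" shows "rapid (\<lambda>p. f p * g p)"
  unfolding rapid_def
proof (intro conjI allI)
  show "(\<lambda>p. f p * g p) differentiable_on UNIV"
    using assms by (auto simp: rapid_def intro: differentiable_on_mult)
  fix m n
  obtain M where M: "\<And>x t. \<bar>x\<bar> ^ m * \<bar>t\<bar> ^ n * cmod (f (x, t)) \<le> M"
    using assms(1) unfolding rapid_def by blast
  obtain B where B: "\<And>z. cmod (g z) \<le> B" using rapid_bounded[OF assms(2)] by blast
  have M0: "M \<ge> 0" using M[of 0 0] by (rule order_trans[rotated]) auto
  have "\<bar>x\<bar> ^ m * \<bar>t\<bar> ^ n * cmod (f (x, t) * g (x, t)) \<le> M * B" for x t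
    using mult_mono[OF M[of x t] B[of "(x, t)"] M0] by (simp add: norm_mult mult.assoc)
  then show "\<exists>M. \<forall>x t. \<bar>x\<bar> ^ m * \<bar>t\<bar> ^ n * cmod (f (x, t) * g (x, t)) \<le> M" by blast
qed

lemma dx_mult: "rapid f \<Longrightarrow> rapid g \<Longrightarrow> dx (\<lambda>p. f p * g p) = (\<lambda>p. f p * dx g p + dx f p * g p)"
  by (rule dx_eqI) (auto intro: has_vector_derivative_mult rapid_has_dx)

lemma dt_mult: "rapid f \<Longrightarrow> rapid g \<Longrightarrow> dt (\<lambda>p. f p * g p) = (\<lambda>p. f p * dt g p + dt f p * g p)"
  by (rule dt_eqI) (auto intro: has_vector_derivative_mult rapid_has_dt)

lemma dx_add: "rapid f \<Longrightarrow> rapid g \<Longrightarrow> dx (\<lambda>p. f p + g p) = (\<lambda>p. dx f p + dx g p)"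
  by (rule dx_eqI) (auto intro: has_vector_derivative_add rapid_has_dx)

lemma dt_add: "rapid f \<Longrightarrow> rapid g \<Longrightarrow> dt (\<lambda>p. f p + g p) = (\<lambda>p. dt f p + dt g p)"
  by (rule dt_eqI) (auto intro: has_vector_derivative_add rapid_has_dt)

lemma dx_uminus: "rapid f \<Longrightarrow> dx (\<lambda>p. - f p) = (\<lambda>p. - dx f p)"
  by (rule dx_eqI) (auto intro: has_vector_derivative_minus rapid_has_dx)

lemma dt_uminus: "rapid f \<Longrightarrow> dt (\<lambda>p. - f p) = (\<lambda>p. - dt f p)"
  by (rule dt_eqI) (auto intro: has_vector_derivative_minus rapid_has_dt)

lemma schwartz_add:
  assumes "schwartz f" "schwartz g" shows "schwartz (\<lambda>p. f p + g p)"
proof -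
  have r: "rapid ((dt ^^ k) ((dx ^^ j) f))" "rapid ((dt ^^ k) ((dx ^^ j) g))" for j k
    using assms by (auto simp: schwartz_iff_rapid)
  have r0: "rapid ((dx ^^ j) f)" "rapid ((dx ^^ j) g)" for j using r[of 0 j] by auto
  have x: "(dx ^^ j) (\<lambda>p. f p + g p) = (\<lambda>p. (dx ^^ j) f p + (dx ^^ j) g p)" for j
    by (induction j) (simp_all add: dx_add r0)
  have "(dt ^^ k) ((dx ^^ j) (\<lambda>p. f p + g p)) = (\<lambda>p. (dt ^^ k) ((dx ^^ j) f) p + (dt ^^ k) ((dx ^^ j) g) p)" for j k
    by (induction k) (simp_all add: x dt_add r)
  then show ?thesis unfolding schwartz_iff_rapid by (auto intro: rapid_add r)
qed

lemma schwartz_uminus: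
  assumes "schwartz f" shows "schwartz (\<lambda>p. - f p)"
proof -
  have r: "rapid ((dt ^^ k) ((dx ^^ j) f))" for j k
    using assms by (auto simp: schwartz_iff_rapid)
  have r0: "rapid ((dx ^^ j) f)" for j using r[of 0 j] by auto
  have x: "(dx ^^ j) (\<lambda>p. - f p) = (\<lambda>p. - (dx ^^ j) f p)" for j
    by (induction j) (simp_all add: dx_uminus r0)
  have "(dt ^^ k) ((dx ^^ j) (\<lambda>p. - f p)) = (\<lambda>p. - (dt ^^ k) ((dx ^^ j) f) p)" for j k
    by (induction k) (simp_all add: x dt_uminus r)
  then show ?thesis unfolding schwartz_iff_rapid by (auto intro: rapid_uminus r)
qed

lemma schwartz_diff:
  assumes "schwartz f" "schwartz g" shows "schwartz (\<lambda>p. f p - g p)"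
  using schwartz_add[OF assms(1) schwartz_uminus[OF assms(2)]] by simp

text \<open>Two predicates, because \<open>schwartz\<close> takes all \<open>x\<close>-derivatives before the \<open>t\<close>-derivatives: \<open>dx\<close> then
  only meets products of pure \<open>x\<close>-derivatives, and mixed partials never have to be commuted.\<close>

inductive leibniz_x :: "(real \<times> real \<Rightarrow> complex) \<Rightarrow> (real \<times> real \<Rightarrow> complex) \<Rightarrow> (real \<times> real \<Rightarrow> complex) \<Rightarrow> bool"
  for u v where
  "leibniz_x u v (\<lambda>p. (dx ^^ i) u p * (dx ^^ j) v p)"
| "leibniz_x u v f \<Longrightarrow> leibniz_x u v g \<Longrightarrow> leibniz_x u v (\<lambda>p. f p + g p)"

inductive leibniz :: "(real \<times> real \<Rightarrow> complex) \<Rightarrow> (real \<times> real \<Rightarrow> complex) \<Rightarrow> (real \<times> real \<Rightarrow> complex) \<Rightarrow> bool"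
  for u v where
  "leibniz u v (\<lambda>p. (dt ^^ k) ((dx ^^ i) u) p * (dt ^^ l) ((dx ^^ j) v) p)"
| "leibniz u v f \<Longrightarrow> leibniz u v g \<Longrightarrow> leibniz u v (\<lambda>p. f p + g p)"

lemma leibniz_x_imp: "leibniz_x u v f \<Longrightarrow> leibniz u v f"
proof (induction rule: leibniz_x.induct)
  case (1 i j)
  show ?case using leibniz.intros(1)[of u v 0 i 0 j] by simp
qed (rule leibniz.intros(2))

text \<open>The binomial coefficients of the Leibniz rule are irrelevant. It suffices that iterated
  derivatives stay inside the class of finite sums of products of derivatives, all of whose members
  are \<open>rapid\<close>.\<close>

lemma schwartz_mult:
  assumes "schwartz u" "schwartz v" shows "schwartz (\<lambda>p. u p * v p)"
proof -
  have r: "rapid ((dt ^^ k) ((dx ^^ j) u))" "rapid ((dt ^^ k) ((dx ^^ j) v))" for j k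
    using assms by (auto simp: schwartz_iff_rapid)
  have r0: "rapid ((dx ^^ j) u)" "rapid ((dx ^^ j) v)" for j using r[of 0 j] by auto
  have rapid: "rapid f" if "leibniz u v f" for f
    using that by induction (auto intro: rapid_add rapid_mult r)
  have dx: "leibniz_x u v (dx f)" if "leibniz_x u v f" for f
    using that
  proof induction
    case (1 i j)
    show ?case unfolding dx_mult[OF r0]
      using leibniz_x.intros(2)[OF leibniz_x.intros(1)[of u v i "Suc j"] leibniz_x.intros(1)[of u v "Suc i" j]] by simp
  next
    case (2 f g)
    then show ?case by (simp add: dx_add rapid leibniz_x_imp leibniz_x.intros)
  qed
  have dt: "leibniz u v (dt f)" if "leibniz u v f" for f
    using that
  proof induction
    case (1 k i l j)
    show ?case unfolding dt_mult[OF r]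
      using leibniz.intros(2)[OF leibniz.intros(1)[of u v k i "Suc l" j] leibniz.intros(1)[of u v "Suc k" i l j]] by simp
  next
    case (2 f g)
    then show ?case by (simp add: dt_add rapid leibniz.intros)
  qed
  have "leibniz_x u v ((dx ^^ j) (\<lambda>p. u p * v p))" for j
  proof (induction j)
    case 0
    show ?case using leibniz_x.intros(1)[of u v 0 0] by simp
  qed (simp add: dx)
  then have "leibniz u v ((dt ^^ k) ((dx ^^ j) (\<lambda>p. u p * v p)))" for j k
    by (induction k) (simp_all add: dt leibniz_x_imp)
  then show ?thesis unfolding schwartz_iff_rapid by (auto intro: rapid)
qed

subsection \<open>The norms\<close>

lemma fourier_minus_scaled:
  assumes "integrable lborel f" "integrable lborel g"
  shows "fourier (\<lambda>w. f w - c * g w) z = fourier f z - c * fourier g z"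
  unfolding fourier_diff_scaled[OF assms] by (rule fourier_eq)

definition xdensity ::
  "real \<Rightarrow> real \<Rightarrow> real \<Rightarrow> real \<Rightarrow> (real \<times> real \<Rightarrow> complex) \<Rightarrow> real \<times> real \<Rightarrow> real" where
  "xdensity \<alpha> \<beta> s b u z =
     jbracket (fst z) powr s * jbracket (snd z + phi \<alpha> \<beta> (fst z)) powr b * cmod (fourier u z)"

lemma xdensity_nonneg: "xdensity \<alpha> \<beta> s b u z \<ge> 0"
  by (simp add: xdensity_def)

lemma xnorm_eq: "xnorm \<alpha> \<beta> s b u = sqrt (LINT z|lborel. xdensity \<alpha> \<beta> s b u z ^ 2)"
  by (simp add: xnorm_def xdensity_def case_prod_unfold)

lemma xnorm_nonneg: "xnorm \<alpha> \<beta> s b u \<ge> 0"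
  by (simp add: xnorm_eq)

lemma xnorm_power2: "xnorm \<alpha> \<beta> s b u ^ 2 = (LINT z|lborel. xdensity \<alpha> \<beta> s b u z ^ 2)"
  by (simp add: xnorm_eq)

lemma borel_measurable_xdensity:
  assumes "schwartz u" shows "xdensity \<alpha> \<beta> s b u \<in> borel_measurable borel"
proof -
  have [measurable]: "fourier u \<in> borel_measurable borel"
    by (intro borel_measurable_fourier rapid_integrable schwartz_rapid assms)
  have [measurable]: "(fst :: real \<times> real \<Rightarrow> real) \<in> borel_measurable borel" "(snd :: real \<times> real \<Rightarrow> real) \<in> borel_measurable borel"
    by (auto intro!: borel_measurable_continuous_onI continuous_intros)
  show ?thesis unfolding xdensity_def[abs_def] by measurable
qed

lemma jbracket_phi_le: "jbracket (phi \<alpha> \<beta> x) \<le> (1 + \<bar>\<alpha>\<bar> + \<bar>\<beta>\<bar>) * jbracket x ^ 5"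
proof -
  have 5: "\<bar>x\<bar> ^ 5 \<le> jbracket x ^ 5" by (intro power_mono abs_le_jbracket) auto
  have "\<bar>x\<bar> ^ 3 \<le> jbracket x ^ 3" by (intro power_mono abs_le_jbracket) auto
  also have "\<dots> \<le> jbracket x ^ 5" by (intro power_increasing jbracket_ge_1) auto
  finally have 3: "\<bar>x\<bar> ^ 3 \<le> jbracket x ^ 5" .
  have 1: "1 \<le> jbracket x ^ 5" by (intro one_le_power jbracket_ge_1)
  have "jbracket (phi \<alpha> \<beta> x) \<le> 1 + \<bar>phi \<alpha> \<beta> x\<bar>" by (rule jbracket_le)
  also have "\<bar>phi \<alpha> \<beta> x\<bar> \<le> \<bar>\<alpha>\<bar> * \<bar>x\<bar> ^ 5 + \<bar>\<beta>\<bar> * \<bar>x\<bar> ^ 3"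
    unfolding phi_def using abs_triangle_ineq4[of "\<alpha> * x ^ 5" "\<beta> * x ^ 3"] by (simp add: abs_mult power_abs)
  also have "\<dots> \<le> \<bar>\<alpha>\<bar> * jbracket x ^ 5 + \<bar>\<beta>\<bar> * jbracket x ^ 5"
    by (intro add_mono mult_left_mono 5 3) auto
  finally show ?thesis using 1 by (simp add: distrib_right)
qed

lemma xdensity_bound:
  assumes u: "schwartz u" and b: "b \<le> 1"
  shows "\<exists>M\<ge>0. \<forall>z. xdensity \<alpha> \<beta> s b u z \<le> M / (jbracket (fst z) * jbracket (snd z))"
proof -
  define n where "n = nat \<lceil>\<bar>s\<bar>\<rceil>"
  \<comment> \<open>Of the \<open>n + 6\<close> powers, \<open>n\<close> pay for the weight of order
    \<open>s\<close>, 5 for \<open>phi\<close>, and 1 remains as decay. In the second variable one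
    power pays for the modulation weight, which is at most linear since \<open>b \<le> 1\<close>,
    and one remains.\<close>
  obtain M where M: "M \<ge> 0" "\<And>z. jbracket (fst z) ^ (n + 6) * jbracket (snd z) ^ 2 * cmod (fourier u z) \<le> M"
    using schwartz_fourier_decay[OF u] by blast
  let ?K = "2 * (1 + \<bar>\<alpha>\<bar> + \<bar>\<beta>\<bar>)"
  have "xdensity \<alpha> \<beta> s b u z \<le> ?K * M / (jbracket (fst z) * jbracket (snd z))" for z
  proof -
    let ?x = "jbracket (fst z)" and ?t = "jbracket (snd z)"
    have pos: "?x > 0" "?t > 0" by auto
    have "s \<le> real n" unfolding n_def by linarith
    then have "?x powr s \<le> ?x powr real n" by (intro powr_mono jbracket_ge_1)
    also have "\<dots> = ?x ^ n" by (simp add: powr_realpow)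
    finally have 1: "?x powr s \<le> ?x ^ n" .
    have "jbracket (snd z + phi \<alpha> \<beta> (fst z)) powr b \<le> jbracket (snd z + phi \<alpha> \<beta> (fst z)) powr 1"
      using b by (intro powr_mono jbracket_ge_1)
    also have "\<dots> = jbracket (snd z + phi \<alpha> \<beta> (fst z))" by (simp add: less_imp_le)
    also have "\<dots> \<le> 2 * ?t * jbracket (phi \<alpha> \<beta> (fst z))" by (rule jbracket_add_le_mult)
    also have "\<dots> \<le> 2 * ?t * ((1 + \<bar>\<alpha>\<bar> + \<bar>\<beta>\<bar>) * ?x ^ 5)"
      by (intro mult_left_mono jbracket_phi_le) (auto simp: less_imp_le)
    finally have 2: "jbracket (snd z + phi \<alpha> \<beta> (fst z)) powr b \<le> 2 * ?t * ((1 + \<bar>\<alpha>\<bar> + \<bar>\<beta>\<bar>) * ?x ^ 5)" .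
    have "xdensity \<alpha> \<beta> s b u z \<le> ?x ^ n * (2 * ?t * ((1 + \<bar>\<alpha>\<bar> + \<bar>\<beta>\<bar>) * ?x ^ 5)) * cmod (fourier u z)"
      unfolding xdensity_def by (intro mult_right_mono mult_mono 1 2) (use pos in \<open>auto simp: less_imp_le\<close>)
    then have "xdensity \<alpha> \<beta> s b u z * (?x * ?t) \<le> ?x ^ n * (2 * ?t * ((1 + \<bar>\<alpha>\<bar> + \<bar>\<beta>\<bar>) * ?x ^ 5)) * cmod (fourier u z) * (?x * ?t)"
      by (rule mult_right_mono) (simp add: less_imp_le)
    also have "\<dots> = ?K * (?x ^ (n + 6) * ?t ^ 2 * cmod (fourier u z))"
      by (simp add: power_add eval_nat_numeral mult_ac)
    also have "\<dots> \<le> ?K * M" by (intro mult_left_mono M) auto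
    finally show ?thesis using pos by (simp add: pos_le_divide_eq)
  qed
  moreover have "?K * M \<ge> 0" using M by simp
  ultimately show ?thesis by blast
qed

lemma integrable_xdensity:
  assumes u: "schwartz u" and b: "b \<le> 1"
  shows "integrable lborel (\<lambda>z. xdensity \<alpha> \<beta> s b u z ^ 2)"
proof -
  obtain M where M: "M \<ge> 0" "\<And>z. xdensity \<alpha> \<beta> s b u z \<le> M / (jbracket (fst z) * jbracket (snd z))"
    using xdensity_bound[OF assms] by blast
  have "integrable lborel (\<lambda>z::real \<times> real. M ^ 2 * (1 / ((1 + fst z ^ 2) * (1 + snd z ^ 2))))"
    by (intro integrable_mult_right integrable_weight)
  then show ?thesis
  proof (rule Bochner_Integration.integrable_bound)
    show "(\<lambda>z. xdensity \<alpha> \<beta> s b u z ^ 2) \<in> borel_measurable lborel"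
      using borel_measurable_xdensity[OF u] by measurable
    show "AE z in lborel. norm (xdensity \<alpha> \<beta> s b u z ^ 2) \<le> norm (M ^ 2 * (1 / ((1 + fst z ^ 2) * (1 + snd z ^ 2))))"
    proof (rule AE_I2)
      fix z :: "real \<times> real"
      have "norm (xdensity \<alpha> \<beta> s b u z ^ 2) = xdensity \<alpha> \<beta> s b u z ^ 2" by simp
      also have "\<dots> \<le> (M / (jbracket (fst z) * jbracket (snd z))) ^ 2"
        by (intro power_mono M xdensity_nonneg)
      also have "\<dots> = M ^ 2 * (1 / ((1 + fst z ^ 2) * (1 + snd z ^ 2)))"
        by (simp add: power_divide power_mult_distrib jbracket_power2)
      also have "\<dots> \<le> norm (M ^ 2 * (1 / ((1 + fst z ^ 2) * (1 + snd z ^ 2))))"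
        by (simp only: real_norm_def abs_ge_self)
      finally show "norm (xdensity \<alpha> \<beta> s b u z ^ 2) \<le> norm (M ^ 2 * (1 / ((1 + fst z ^ 2) * (1 + snd z ^ 2))))" .
    qed
  qed
qed

text \<open>Passes from the Bochner integral in \<open>xnorm\<close> to the extended one.
  Integrability is essential: without it the former would be 0 and the latter infinite.\<close>

lemma nn_integral_xdensity:
  assumes "schwartz u" "b \<le> 1"
  shows "(\<integral>\<^sup>+z. ennreal (xdensity \<alpha> \<beta> s b u z) ^ 2 \<partial>lborel) = ennreal (xnorm \<alpha> \<beta> s b u ^ 2)"
  unfolding xnorm_power2
  by (subst nn_integral_eq_integral[OF integrable_xdensity[OF assms], symmetric])
     (simp_all add: ennreal_power xdensity_nonneg)

text \<open>Minkowski's inequality: expand the square of \<open>f + g\<close> and bound the mixed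
  term by Cauchy-Schwarz.\<close>

lemma L2_triangle:
  fixes f g h :: "'a \<Rightarrow> real"
  assumes [measurable]: "f \<in> borel_measurable M" "g \<in> borel_measurable M" "h \<in> borel_measurable M"
    and nn: "\<And>x. 0 \<le> f x" "\<And>x. 0 \<le> g x" "\<And>x. 0 \<le> h x"
    and le: "\<And>x. h x \<le> f x + g x"
    and A: "(\<integral>\<^sup>+x. ennreal (f x) ^ 2 \<partial>M) = ennreal (A ^ 2)" "A \<ge> 0"
    and B: "(\<integral>\<^sup>+x. ennreal (g x) ^ 2 \<partial>M) = ennreal (B ^ 2)" "B \<ge> 0"
    and C: "(\<integral>\<^sup>+x. ennreal (h x) ^ 2 \<partial>M) = ennreal (C ^ 2)"
  shows "C \<le> A + B"
proof -
  let ?X = "\<integral>\<^sup>+x. ennreal (f x) * ennreal (g x) \<partial>M"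
  have "?X ^ 2 \<le> ennreal (A ^ 2) * ennreal (B ^ 2)"
    using Cauchy_Schwarz_nn_integral[of "\<lambda>x. ennreal (f x)" M "\<lambda>x. ennreal (g x)"] unfolding A B by simp
  also have "\<dots> = ennreal (A * B) ^ 2"
    using A B by (simp add: ennreal_power power_mult_distrib flip: ennreal_mult)
  finally have X2: "?X ^ 2 \<le> ennreal (A * B) ^ 2" .
  have X: "?X \<le> ennreal (A * B)"
  proof (cases "?X")
    case (real x)
    then have "x ^ 2 \<le> (A * B) ^ 2" using X2 A B by (simp add: ennreal_power)
    then have "x \<le> A * B" using A B by (auto intro: power2_le_imp_le)
    then show ?thesis using real by (simp add: ennreal_leI)
  next
    case top
    then show ?thesis using X2 A B by (simp add: ennreal_power top_power_ennreal top_unique)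
  qed
  have "ennreal (C ^ 2) \<le> (\<integral>\<^sup>+x. ennreal (f x) ^ 2 + 2 * (ennreal (f x) * ennreal (g x)) + ennreal (g x) ^ 2 \<partial>M)"
    unfolding C[symmetric]
  proof (intro nn_integral_mono)
    fix x
    have "ennreal (h x) ^ 2 \<le> (ennreal (f x) + ennreal (g x)) ^ 2"
      using le[of x] nn by (intro power_mono) (auto simp flip: ennreal_plus intro: ennreal_leI)
    also have "\<dots> = ennreal (f x) ^ 2 + 2 * (ennreal (f x) * ennreal (g x)) + ennreal (g x) ^ 2"
      by (simp add: power2_sum mult.assoc add_ac)
    finally show "ennreal (h x) ^ 2 \<le> \<dots>" .
  qed
  also have "\<dots> = ennreal (A ^ 2) + 2 * ?X + ennreal (B ^ 2)"
    by (simp add: nn_integral_add nn_integral_cmult A B)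
  also have "\<dots> \<le> ennreal (A ^ 2) + 2 * ennreal (A * B) + ennreal (B ^ 2)"
    by (intro add_mono mult_left_mono X) auto
  also have "\<dots> = ennreal (A ^ 2 + 2 * (A * B) + B ^ 2)"
  proof -
    have "2 * ennreal (A * B) = ennreal (2 * (A * B))"
      using A B by (subst ennreal_mult) auto
    then show ?thesis using A B by (simp add: ennreal_plus)
  qed
  also have "A ^ 2 + 2 * (A * B) + B ^ 2 = (A + B) ^ 2" by (simp add: power2_sum)
  finally have "C ^ 2 \<le> (A + B) ^ 2" by (simp add: ennreal_le_iff)
  then show ?thesis using A B by (auto intro: power2_le_imp_le)
qed

lemma fourier_uminus: "fourier (\<lambda>p. - u p) z = - fourier u z"
  by (simp add: fourier_eq)

lemma xnorm_uminus: "xnorm \<alpha> \<beta> s b (\<lambda>p. - u p) = xnorm \<alpha> \<beta> s b u"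
  by (simp add: xnorm_eq xdensity_def fourier_uminus)

lemma xnorm_diff_commute: "xnorm \<alpha> \<beta> s b (\<lambda>p. u p - v p) = xnorm \<alpha> \<beta> s b (\<lambda>p. v p - u p)"
  using xnorm_uminus[of \<alpha> \<beta> s b "\<lambda>p. u p - v p"] by simp

lemma xnorm_zero: "xnorm \<alpha> \<beta> s b (\<lambda>p. 0) = 0"
  by (simp add: xnorm_eq xdensity_def fourier_eq)

lemma xnorm_add:
  assumes "schwartz u" "schwartz v" "b \<le> 1"
  shows "xnorm \<alpha> \<beta> s b (\<lambda>p. u p + v p) \<le> xnorm \<alpha> \<beta> s b u + xnorm \<alpha> \<beta> s b v"
proof (rule L2_triangle)
  fix z
  let ?w = "jbracket (fst z) powr s * jbracket (snd z + phi \<alpha> \<beta> (fst z)) powr b"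
  have "fourier (\<lambda>p. u p + v p) z = fourier u z + fourier v z"
    using fourier_minus_scaled[of u v "-1" z] assms by (simp add: rapid_integrable schwartz_rapid)
  then have "cmod (fourier (\<lambda>p. u p + v p) z) \<le> cmod (fourier u z) + cmod (fourier v z)"
    by (simp add: norm_triangle_ineq)
  from mult_left_mono[OF this, of ?w]
  show "xdensity \<alpha> \<beta> s b (\<lambda>p. u p + v p) z \<le> xdensity \<alpha> \<beta> s b u z + xdensity \<alpha> \<beta> s b v z"
    by (simp add: xdensity_def distrib_left)
next
  show "(\<integral>\<^sup>+x. ennreal (xdensity \<alpha> \<beta> s b u x) ^ 2 \<partial>lborel) = ennreal (xnorm \<alpha> \<beta> s b u ^ 2)"
    "(\<integral>\<^sup>+x. ennreal (xdensity \<alpha> \<beta> s b v x) ^ 2 \<partial>lborel) = ennreal (xnorm \<alpha> \<beta> s b v ^ 2)"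
    "(\<integral>\<^sup>+x. ennreal (xdensity \<alpha> \<beta> s b (\<lambda>p. u p + v p) x) ^ 2 \<partial>lborel) = ennreal (xnorm \<alpha> \<beta> s b (\<lambda>p. u p + v p) ^ 2)"
    using assms by (auto intro!: nn_integral_xdensity schwartz_add)
  show "xdensity \<alpha> \<beta> s b u \<in> borel_measurable lborel" "xdensity \<alpha> \<beta> s b v \<in> borel_measurable lborel"
    "xdensity \<alpha> \<beta> s b (\<lambda>p. u p + v p) \<in> borel_measurable lborel"
    using assms borel_measurable_xdensity schwartz_add by auto
qed (simp_all add: xdensity_nonneg xnorm_nonneg)

lemma xnorm_diff_triangle:
  assumes "schwartz u" "schwartz v" "schwartz w" "b \<le> 1"
  shows "xnorm \<alpha> \<beta> s b (\<lambda>p. u p - w p) \<le> xnorm \<alpha> \<beta> s b (\<lambda>p. u p - v p) + xnorm \<alpha> \<beta> s b (\<lambda>p. v p - w p)"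
  using xnorm_add[OF schwartz_diff[OF assms(1,2)] schwartz_diff[OF assms(2,3)] assms(4), of \<alpha> \<beta> s] by simp

lemma xnorm_diff_ge:
  assumes "schwartz u" "schwartz v" "b \<le> 1"
  shows "\<bar>xnorm \<alpha> \<beta> s b u - xnorm \<alpha> \<beta> s b v\<bar> \<le> xnorm \<alpha> \<beta> s b (\<lambda>p. u p - v p)"
  using xnorm_add[OF schwartz_diff[OF assms(1,2)] assms(2,3), of \<alpha> \<beta> s]
    xnorm_add[OF schwartz_diff[OF assms(2,1)] assms(1,3), of \<alpha> \<beta> s]
    xnorm_diff_commute[of \<alpha> \<beta> s b u v]
  by simp

section \<open>The bilinear estimate on Schwartz functions\<close>

context kawahara
begin

text \<open>The trilinear form is tested against the weighted transform of the output. Its square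
  bounds the fourth power of the output norm by that norm squared times the input norms squared; the
  output norm is finite because the output is Schwartz, so it can be divided out.\<close>

lemma schwartz_bilinear:
  assumes s: "s \<ge> - 7 / 4 + 4 * \<epsilon>"
  shows "\<exists>C>0. \<forall>u v. schwartz u \<longrightarrow> schwartz v \<longrightarrow>
    xnorm \<alpha> \<beta> s (- 1 / 2 + 2 * \<epsilon>) (dx (\<lambda>p. u p * v p))
      \<le> C * xnorm \<alpha> \<beta> s (1 / 2 + \<epsilon>) u * xnorm \<alpha> \<beta> s (1 / 2 + \<epsilon>) v"
proof -
  let ?b' = "- 1 / 2 + 2 * \<epsilon>" and ?b = "1 / 2 + \<epsilon>"
  have b: "?b' \<le> 1" "?b \<le> 1" using eps_le by auto
  obtain K where K: "K < \<infinity>" "\<And>f g h. f \<in> borel_measurable borel \<Longrightarrow> g \<in> borel_measurable borel \<Longrightarrow> h \<in> borel_measurable borel \<Longrightarrow>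
    (\<integral>\<^sup>+z. \<integral>\<^sup>+y. ennreal (multiplier s z y) * (h z * f y * g (z - y)) \<partial>lborel \<partial>lborel) ^ 2
    \<le> K * (\<integral>\<^sup>+z. h z ^ 2 \<partial>lborel) * (\<integral>\<^sup>+z. f z ^ 2 \<partial>lborel) * (\<integral>\<^sup>+z. g z ^ 2 \<partial>lborel)"
    using trilinear[OF s] by blast
  obtain c where c: "K = ennreal c" "c \<ge> 0" using K(1) by (cases K) auto
  \<comment> \<open>Adding 1 keeps the constant positive even if \<open>c = 0\<close>.\<close>
  have "xnorm \<alpha> \<beta> s ?b' (dx (\<lambda>p. u p * v p)) \<le> (sqrt c + 1) * xnorm \<alpha> \<beta> s ?b u * xnorm \<alpha> \<beta> s ?b v"
    if u: "schwartz u" and v: "schwartz v" for u v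
  proof -
    let ?w = "\<lambda>p. u p * v p"
    have w: "schwartz ?w" by (rule schwartz_mult[OF u v])
    define h where "h = xdensity \<alpha> \<beta> s ?b' (dx ?w)"
    \<comment> \<open>\<open>f\<close> belongs to \<open>v\<close> and \<open>g\<close> to
      \<open>u\<close> because \<open>fourier_mult_le\<close> places \<open>v\<close> at
      \<open>y\<close> and \<open>u\<close> at \<open>z - y\<close>.\<close>
    define f where "f = xdensity \<alpha> \<beta> s ?b v"
    define g where "g = xdensity \<alpha> \<beta> s ?b u"
    have [measurable]: "h \<in> borel_measurable borel" "f \<in> borel_measurable borel" "g \<in> borel_measurable borel"
      unfolding h_def f_def g_def using u v w by (auto intro: borel_measurable_xdensity schwartz_dx)
    let ?W = "\<lambda>z. \<bar>fst z\<bar> * (jbracket (fst z) powr s * jbracket (sig z) powr ?b')"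
    have [measurable]: "fourier u \<in> borel_measurable borel" "fourier v \<in> borel_measurable borel"
      using u v by (auto intro: borel_measurable_fourier rapid_integrable schwartz_rapid)
    have hz: "ennreal (h z) \<le> (\<integral>\<^sup>+y. ennreal (multiplier s z y) * (ennreal (f y) * ennreal (g (z - y))) \<partial>lborel)" for z
    proof -
      obtain B where B: "\<And>x. cmod (v x) \<le> B" using rapid_bounded schwartz_rapid v by blast
      have "h z = ?W z * cmod (fourier ?w z)"
        unfolding h_def xdensity_def using fourier_dx[OF schwartz_rapid[OF w] schwartz_rapid[OF schwartz_dx[OF w]]]
        by (simp add: norm_mult sig_def mult_ac)
      then have "ennreal (h z) = ennreal (?W z) * ennreal (cmod (fourier ?w z))" by (simp add: ennreal_mult)
      also have "\<dots> \<le> ennreal (?W z) * (\<integral>\<^sup>+y. ennreal (cmod (fourier v y) * cmod (fourier u (z - y))) \<partial>lborel)"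
        by (intro mult_left_mono fourier_mult_le[OF _ _ _ B] rapid_integrable rapid_continuous schwartz_rapid u v) auto
      also have "\<dots> = (\<integral>\<^sup>+y. ennreal (?W z) * ennreal (cmod (fourier v y) * cmod (fourier u (z - y))) \<partial>lborel)"
        by (rule nn_integral_cmult[symmetric]) measurable
      also have "\<dots> = (\<integral>\<^sup>+y. ennreal (multiplier s z y) * (ennreal (f y) * ennreal (g (z - y))) \<partial>lborel)"
      proof (intro nn_integral_cong)
        fix y
        have id: "x powr - r * x powr r = 1" if "x > 0" for x r :: real
          using that by (simp flip: powr_add)
        have "multiplier s z y * (f y * g (z - y)) = ?W z
            * ((jbracket (fst y) powr - s * jbracket (fst y) powr s) * (jbracket (sig y) powr - ?b * jbracket (sig y) powr ?b)
            * ((jbracket (fst (z - y)) powr - s * jbracket (fst (z - y)) powr s) * (jbracket (sig (z - y)) powr - ?b * jbracket (sig (z - y)) powr ?b)))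
            * (cmod (fourier v y) * cmod (fourier u (z - y)))"
          unfolding multiplier_def f_def g_def xdensity_def sig_def by (simp only: mult_ac)
        also have "\<dots> = ?W z * (cmod (fourier v y) * cmod (fourier u (z - y)))"
          by (simp only: id[OF jbracket_pos] mult_1_right mult_1_left)
        finally have eq: "?W z * (cmod (fourier v y) * cmod (fourier u (z - y))) = multiplier s z y * (f y * g (z - y))" ..
        have "ennreal (?W z) * ennreal (cmod (fourier v y) * cmod (fourier u (z - y))) = ennreal (multiplier s z y * (f y * g (z - y)))"
          unfolding eq[symmetric] by (subst ennreal_mult) auto
        also have "\<dots> = ennreal (multiplier s z y) * (ennreal (f y) * ennreal (g (z - y)))"
          by (simp add: ennreal_mult multiplier_nonneg f_def g_def xdensity_nonneg)
        finally show "ennreal (?W z) * ennreal (cmod (fourier v y) * cmod (fourier u (z - y))) = ennreal (multiplier s z y) * (ennreal (f y) * ennreal (g (z - y)))" .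
      qed
      finally show ?thesis .
    qed
    let ?H = "xnorm \<alpha> \<beta> s ?b' (dx ?w)" and ?F = "xnorm \<alpha> \<beta> s ?b v" and ?G = "xnorm \<alpha> \<beta> s ?b u"
    have n: "(\<integral>\<^sup>+z. ennreal (h z) ^ 2 \<partial>lborel) = ennreal (?H ^ 2)" "(\<integral>\<^sup>+z. ennreal (f z) ^ 2 \<partial>lborel) = ennreal (?F ^ 2)"
      "(\<integral>\<^sup>+z. ennreal (g z) ^ 2 \<partial>lborel) = ennreal (?G ^ 2)"
      unfolding h_def f_def g_def using u v w b by (auto intro!: nn_integral_xdensity schwartz_dx)
    have [measurable]: "(\<lambda>(z, y). multiplier s z y) \<in> borel_measurable (borel \<Otimes>\<^sub>M borel)"
      unfolding multiplier_def by measurable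
    have "ennreal (?H ^ 2) = (\<integral>\<^sup>+z. ennreal (h z) * ennreal (h z) \<partial>lborel)"
      using n(1) by (simp add: power2_eq_square)
    also have "\<dots> \<le> (\<integral>\<^sup>+z. ennreal (h z) * (\<integral>\<^sup>+y. ennreal (multiplier s z y) * (ennreal (f y) * ennreal (g (z - y))) \<partial>lborel) \<partial>lborel)"
      by (intro nn_integral_mono mult_left_mono hz) auto
    also have "\<dots> = (\<integral>\<^sup>+z. \<integral>\<^sup>+y. ennreal (multiplier s z y) * (ennreal (h z) * ennreal (f y) * ennreal (g (z - y))) \<partial>lborel \<partial>lborel)"
      by (subst nn_integral_cmult[symmetric], measurable) (simp add: mult_ac)
    finally have "ennreal (?H ^ 2) ^ 2 \<le> (\<integral>\<^sup>+z. \<integral>\<^sup>+y. ennreal (multiplier s z y) * (ennreal (h z) * ennreal (f y) * ennreal (g (z - y))) \<partial>lborel \<partial>lborel) ^ 2"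
      by (intro power_mono) auto
    also have "\<dots> \<le> K * ennreal (?H ^ 2) * ennreal (?F ^ 2) * ennreal (?G ^ 2)"
      unfolding n[symmetric] by (rule K(2)) measurable
    finally have "ennreal ((?H ^ 2) ^ 2) \<le> ennreal (c * ?H ^ 2 * ?F ^ 2 * ?G ^ 2)"
      using c by (simp add: ennreal_mult ennreal_power)
    then have "(?H ^ 2) ^ 2 \<le> c * ?H ^ 2 * ?F ^ 2 * ?G ^ 2"
      using c by (subst (asm) ennreal_le_iff) auto
    then have "?H ^ 2 * ?H ^ 2 \<le> ?H ^ 2 * (c * ?F ^ 2 * ?G ^ 2)" by (simp add: power2_eq_square mult_ac)
    then have "?H ^ 2 \<le> c * ?F ^ 2 * ?G ^ 2" if "?H \<noteq> 0"
      by (rule mult_left_le_imp_le) (use that in simp)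
    then have "?H ^ 2 \<le> c * ?F ^ 2 * ?G ^ 2" using c by (cases "?H = 0") simp_all
    also have "\<dots> = (sqrt c * ?G * ?F) ^ 2" using c by (simp add: power_mult_distrib)
    finally have "?H \<le> sqrt c * ?G * ?F"
      by (rule power2_le_imp_le) (use c xnorm_nonneg in simp)
    also have "\<dots> \<le> (sqrt c + 1) * ?G * ?F"
      by (intro mult_right_mono xnorm_nonneg) auto
    finally show ?thesis .
  qed
  moreover have "sqrt c + 1 > 0" using c by (simp add: add_nonneg_pos)
  ultimately show ?thesis by blast
qed

end

subsection \<open>Extension to the completion\<close>

lemma equiv_xequiv:
  assumes b: "b \<le> 1" shows "equiv (xcauchy \<alpha> \<beta> s b) (xequiv \<alpha> \<beta> s b)"
proof (rule equivI)
  show "xequiv \<alpha> \<beta> s b \<subseteq> xcauchy \<alpha> \<beta> s b \<times> xcauchy \<alpha> \<beta> s b" by (auto simp: xequiv_def)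
  show "refl_on (xcauchy \<alpha> \<beta> s b) (xequiv \<alpha> \<beta> s b)"
    by (auto simp: refl_on_def xequiv_def xnorm_zero)
  show "sym (xequiv \<alpha> \<beta> s b)"
  proof (rule symI)
    fix U V assume "(U, V) \<in> xequiv \<alpha> \<beta> s b"
    moreover have "(\<lambda>n. xnorm \<alpha> \<beta> s b (\<lambda>p. V n p - U n p)) = (\<lambda>n. xnorm \<alpha> \<beta> s b (\<lambda>p. U n p - V n p))"
      by (intro ext xnorm_diff_commute)
    ultimately show "(V, U) \<in> xequiv \<alpha> \<beta> s b" by (simp add: xequiv_def)
  qed
  show "trans (xequiv \<alpha> \<beta> s b)"
  proof (rule transI)
    fix U V X assume UV: "(U, V) \<in> xequiv \<alpha> \<beta> s b" and VX: "(V, X) \<in> xequiv \<alpha> \<beta> s b"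
    have sc: "schwartz (U n)" "schwartz (V n)" "schwartz (X n)" for n
      using UV VX by (auto simp: xequiv_def xcauchy_def)
    have "(\<lambda>n. xnorm \<alpha> \<beta> s b (\<lambda>p. U n p - V n p) + xnorm \<alpha> \<beta> s b (\<lambda>p. V n p - X n p)) \<longlonglongrightarrow> 0 + 0"
      using UV VX by (intro tendsto_add) (auto simp: xequiv_def)
    then have lim: "(\<lambda>n. xnorm \<alpha> \<beta> s b (\<lambda>p. U n p - V n p) + xnorm \<alpha> \<beta> s b (\<lambda>p. V n p - X n p)) \<longlonglongrightarrow> 0" by simp
    have "(\<lambda>n. xnorm \<alpha> \<beta> s b (\<lambda>p. U n p - X n p)) \<longlonglongrightarrow> 0"
      by (rule tendsto_sandwich[OF _ _ tendsto_const lim])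
         (auto intro!: always_eventually xnorm_nonneg xnorm_diff_triangle sc b)
    then show "(U, X) \<in> xequiv \<alpha> \<beta> s b" using UV VX by (auto simp: xequiv_def)
  qed
qed

lemma xcauchy_convergent:
  assumes "U \<in> xcauchy \<alpha> \<beta> s b" "b \<le> 1"
  shows "convergent (\<lambda>n. xnorm \<alpha> \<beta> s b (U n))"
proof (rule Cauchy_convergent, rule metric_CauchyI)
  fix e :: real assume "e > 0"
  then obtain N where N: "\<And>m n. m \<ge> N \<Longrightarrow> n \<ge> N \<Longrightarrow> xnorm \<alpha> \<beta> s b (\<lambda>p. U m p - U n p) < e"
    using assms(1) unfolding xcauchy_def by blast
  have sc: "schwartz (U n)" for n using assms(1) by (auto simp: xcauchy_def)
  show "\<exists>M. \<forall>m\<ge>M. \<forall>n\<ge>M. dist (xnorm \<alpha> \<beta> s b (U m)) (xnorm \<alpha> \<beta> s b (U n)) < e"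
    using N xnorm_diff_ge[OF sc sc assms(2), of \<alpha> \<beta> s] unfolding dist_real_def by (meson le_less_trans)
qed

text \<open>This makes the definite description meaningful: norms along a Cauchy sequence converge,
  and for equivalent sequences their difference is at most the norm of the difference, so the limit
  is shared by the whole class.\<close>

lemma xspace_norm_tendsto:
  assumes c: "c \<in> xspace \<alpha> \<beta> s b" and b: "b \<le> 1" and U: "U \<in> c"
  shows "(\<lambda>n. xnorm \<alpha> \<beta> s b (U n)) \<longlonglongrightarrow> xspace_norm \<alpha> \<beta> s b c"
proof -
  note eq = equiv_xequiv[OF b, of \<alpha> \<beta> s]
  have U': "U \<in> xcauchy \<alpha> \<beta> s b"
    using in_quotient_imp_subset[OF eq] c U by (auto simp: xspace_def)
  obtain l where l: "(\<lambda>n. xnorm \<alpha> \<beta> s b (U n)) \<longlonglongrightarrow> l"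
    using xcauchy_convergent[OF U' b] by (auto simp: convergent_def)
  have all: "(\<lambda>n. xnorm \<alpha> \<beta> s b (V n)) \<longlonglongrightarrow> l" if "V \<in> c" for V
  proof -
    have "(U, V) \<in> xequiv \<alpha> \<beta> s b"
      using in_quotient_imp_in_rel[OF eq, of c U V] c U that by (simp add: xspace_def)
    then have d: "(\<lambda>n. xnorm \<alpha> \<beta> s b (\<lambda>p. U n p - V n p)) \<longlonglongrightarrow> 0" and sc: "schwartz (U n)" "schwartz (V n)" for n
      by (auto simp: xequiv_def xcauchy_def)
    have "(\<lambda>n. xnorm \<alpha> \<beta> s b (U n) - xnorm \<alpha> \<beta> s b (V n)) \<longlonglongrightarrow> 0"
      by (rule Lim_null_comparison[OF _ d]) (use xnorm_diff_ge[OF sc b] in auto)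
    from tendsto_diff[OF l this] show ?thesis by simp
  qed
  have "xspace_norm \<alpha> \<beta> s b c = l"
    unfolding xspace_norm_def by (rule the_equality) (use all U LIMSEQ_unique in blast)+
  then show ?thesis using l by simp
qed

lemma dx_prod_diff:
  assumes "schwartz u" "schwartz v" "schwartz u'" "schwartz v'"
  shows "(\<lambda>p. dx (\<lambda>q. u q * v q) p - dx (\<lambda>q. u' q * v' q) p)
    = (\<lambda>p. dx (\<lambda>q. (u q - u' q) * v q) p + dx (\<lambda>q. u' q * (v q - v' q)) p)"
proof -
  have r: "rapid (\<lambda>q. (u q - u' q) * v q)" "rapid (\<lambda>q. u' q * (v q - v' q))" "rapid (\<lambda>q. u' q * v' q)"
    "rapid (\<lambda>q. u q * v q)" "rapid (\<lambda>q. - (u' q * v' q))"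
    using assms by (auto intro!: schwartz_rapid schwartz_mult schwartz_diff schwartz_uminus)
  have "dx (\<lambda>q. (u q - u' q) * v q + u' q * (v q - v' q)) = dx (\<lambda>q. u q * v q + - (u' q * v' q))"
    by (simp add: algebra_simps)
  then show ?thesis
    unfolding dx_add[OF r(1,2)] dx_add[OF r(4,5)] dx_uminus[OF r(3)] by simp
qed

text \<open>By \<open>dx_prod_diff\<close> the map is Lipschitz on bounded sets. Cauchy sequences
  are bounded, so their images are Cauchy, equivalent inputs have equivalent images, and the
  estimate passes to the limit with the same \<open>C\<close>.\<close>

lemma bilinear_extension:
  assumes b: "b \<le> 1" "b' \<le> 1" and C: "C > 0"
    and bil: "\<And>u v. schwartz u \<Longrightarrow> schwartz v \<Longrightarrow>
      xnorm \<alpha> \<beta> s b' (dx (\<lambda>p. u p * v p)) \<le> C * xnorm \<alpha> \<beta> s b u * xnorm \<alpha> \<beta> s b v"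
    and u1: "u1 \<in> xspace \<alpha> \<beta> s b" and u2: "u2 \<in> xspace \<alpha> \<beta> s b"
  shows "\<exists>w\<in>xspace \<alpha> \<beta> s b'. dx_prod_extends u1 u2 w \<and>
    xspace_norm \<alpha> \<beta> s b' w \<le> C * xspace_norm \<alpha> \<beta> s b u1 * xspace_norm \<alpha> \<beta> s b u2"
proof -
  let ?N = "xnorm \<alpha> \<beta> s b" and ?N' = "xnorm \<alpha> \<beta> s b'"
  note eq = equiv_xequiv[OF b(1), of \<alpha> \<beta> s] and eq' = equiv_xequiv[OF b(2), of \<alpha> \<beta> s]
  let ?F = "\<lambda>U V. (\<lambda>n. dx (\<lambda>p. U n p * V n p)) :: nat \<Rightarrow> real \<times> real \<Rightarrow> complex"
  have cau: "U \<in> xcauchy \<alpha> \<beta> s b" if "c \<in> xspace \<alpha> \<beta> s b" "U \<in> c" for c U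
    using in_quotient_imp_subset[OF eq] that by (auto simp: xspace_def)
  have sch: "schwartz (U n)" if "U \<in> xcauchy \<alpha> \<beta> s b" for U n using that by (simp add: xcauchy_def)
  have diff: "?N' (\<lambda>p. dx (\<lambda>q. u q * v q) p - dx (\<lambda>q. u' q * v' q) p)
     \<le> C * ?N (\<lambda>p. u p - u' p) * ?N v + C * ?N u' * ?N (\<lambda>p. v p - v' p)"
    if "schwartz u" "schwartz v" "schwartz u'" "schwartz v'" for u v u' v'
    unfolding dx_prod_diff[OF that]
    by (rule order_trans[OF xnorm_add[OF _ _ b(2)]])
       (use that in \<open>auto intro!: add_mono bil schwartz_dx schwartz_mult schwartz_diff\<close>)
  have Fc: "?F U V \<in> xcauchy \<alpha> \<beta> s b'" if U: "U \<in> xcauchy \<alpha> \<beta> s b" and V: "V \<in> xcauchy \<alpha> \<beta> s b" for U V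
    unfolding xcauchy_def
  proof (intro CollectI conjI allI impI)
    show "schwartz (?F U V n)" for n by (intro schwartz_dx schwartz_mult sch U V)
    fix e :: real assume e: "e > 0"
    obtain K1 where K1: "K1 > 0" "\<And>n. norm (?N (U n)) \<le> K1"
      using convergent_imp_Bseq[OF xcauchy_convergent[OF U b(1)]] by (elim BseqE) blast
    obtain K2 where K2: "K2 > 0" "\<And>n. norm (?N (V n)) \<le> K2"
      using convergent_imp_Bseq[OF xcauchy_convergent[OF V b(1)]] by (elim BseqE) blast
    have K: "K1 > 0" "?N (U n) \<le> K1" "K2 > 0" "?N (V n) \<le> K2" for n
      using K1 K2 by (auto simp: xnorm_nonneg)
    \<comment> \<open>Each difference appears once, multiplied by \<open>C\<close> and by the bound
      \<open>K2\<close> or \<open>K1\<close> for the other factor.\<close>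
    define d where "d = e / (C * (K1 + K2))"
    have d: "d > 0" using e C K by (simp add: d_def)
    obtain N1 where N1: "\<And>m n. m \<ge> N1 \<Longrightarrow> n \<ge> N1 \<Longrightarrow> ?N (\<lambda>p. U m p - U n p) < d"
      using U d unfolding xcauchy_def by blast
    obtain N2 where N2: "\<And>m n. m \<ge> N2 \<Longrightarrow> n \<ge> N2 \<Longrightarrow> ?N (\<lambda>p. V m p - V n p) < d"
      using V d unfolding xcauchy_def by blast
    show "\<exists>N. \<forall>m\<ge>N. \<forall>n\<ge>N. ?N' (\<lambda>p. ?F U V m p - ?F U V n p) < e"
    proof (intro exI[of _ "max N1 N2"] allI impI)
      fix m n assume mn: "m \<ge> max N1 N2" "n \<ge> max N1 N2"
      have "?N' (\<lambda>p. ?F U V m p - ?F U V n p) \<le> C * ?N (\<lambda>p. U m p - U n p) * ?N (V m) + C * ?N (U n) * ?N (\<lambda>p. V m p - V n p)"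
        by (rule diff) (use sch U V in auto)
      also have "\<dots> \<le> C * ?N (\<lambda>p. U m p - U n p) * K2 + C * K1 * ?N (\<lambda>p. V m p - V n p)"
        using C by (intro add_mono mult_left_mono mult_right_mono K xnorm_nonneg mult_nonneg_nonneg) auto
      also have "\<dots> < C * d * K2 + C * K1 * d"
        using C K N1[of m n] N2[of m n] mn by (intro add_strict_mono mult_strict_left_mono mult_strict_right_mono) auto
      also have "\<dots> = C * (K1 + K2) * d" by (simp add: algebra_simps)
      also have "\<dots> = e" using C K by (simp add: d_def)
      finally show "?N' (\<lambda>p. ?F U V m p - ?F U V n p) < e" .
    qed
  qed
  have Fe: "(?F U V, ?F U' V') \<in> xequiv \<alpha> \<beta> s b'"
    if "U \<in> u1" "V \<in> u2" "U' \<in> u1" "V' \<in> u2" for U V U' V'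
  proof -
    have c: "U \<in> xcauchy \<alpha> \<beta> s b" "U' \<in> xcauchy \<alpha> \<beta> s b" "V \<in> xcauchy \<alpha> \<beta> s b" "V' \<in> xcauchy \<alpha> \<beta> s b"
      using cau[OF u1] cau[OF u2] that by auto
    have e: "(U, U') \<in> xequiv \<alpha> \<beta> s b" "(V, V') \<in> xequiv \<alpha> \<beta> s b"
      using in_quotient_imp_in_rel[OF eq] u1 u2 that by (auto simp: xspace_def)
    have "(\<lambda>n. C * ?N (\<lambda>p. U n p - U' n p) * ?N (V n) + C * ?N (U' n) * ?N (\<lambda>p. V n p - V' n p))
       \<longlonglongrightarrow> C * 0 * xspace_norm \<alpha> \<beta> s b u2 + C * xspace_norm \<alpha> \<beta> s b u1 * 0"
      using e xspace_norm_tendsto[OF u1 b(1)] xspace_norm_tendsto[OF u2 b(1)] that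
      by (intro tendsto_intros) (auto simp: xequiv_def)
    then have lim: "(\<lambda>n. C * ?N (\<lambda>p. U n p - U' n p) * ?N (V n) + C * ?N (U' n) * ?N (\<lambda>p. V n p - V' n p)) \<longlonglongrightarrow> 0"
      by simp
    have "(\<lambda>n. ?N' (\<lambda>p. ?F U V n p - ?F U' V' n p)) \<longlonglongrightarrow> 0"
      by (rule tendsto_sandwich[OF _ _ tendsto_const lim])
         (auto intro!: always_eventually xnorm_nonneg diff sch c)
    then show ?thesis using Fc c by (simp add: xequiv_def)
  qed
  obtain V1 V2 where V: "V1 \<in> u1" "V2 \<in> u2"
    using in_quotient_imp_non_empty[OF eq] u1 u2 unfolding xspace_def by blast
  have FV: "?F V1 V2 \<in> xcauchy \<alpha> \<beta> s b'" using cau[OF u1] cau[OF u2] V Fc by blast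
  \<comment> \<open>One pair of representatives fixes the class; \<open>Fe\<close> puts the image of
    every other pair into it.\<close>
  let ?w = "xequiv \<alpha> \<beta> s b' `` {?F V1 V2}"
  have w: "?w \<in> xspace \<alpha> \<beta> s b'" unfolding xspace_def by (rule quotientI[OF FV])
  have ext: "dx_prod_extends u1 u2 ?w" unfolding dx_prod_extends_def using Fe V by auto
  have "(\<lambda>n. ?N' (?F V1 V2 n)) \<longlonglongrightarrow> xspace_norm \<alpha> \<beta> s b' ?w"
    by (rule xspace_norm_tendsto[OF w b(2)]) (use equiv_class_self[OF eq' FV] in simp)
  moreover have "(\<lambda>n. C * ?N (V1 n) * ?N (V2 n)) \<longlonglongrightarrow> C * xspace_norm \<alpha> \<beta> s b u1 * xspace_norm \<alpha> \<beta> s b u2"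
    by (intro tendsto_intros xspace_norm_tendsto[OF u1 b(1)] xspace_norm_tendsto[OF u2 b(1)] V)
  moreover have "?N' (?F V1 V2 n) \<le> C * ?N (V1 n) * ?N (V2 n)" for n
    by (intro bil sch cau[OF u1] cau[OF u2] V)
  ultimately have "xspace_norm \<alpha> \<beta> s b' ?w \<le> C * xspace_norm \<alpha> \<beta> s b u1 * xspace_norm \<alpha> \<beta> s b u2"
    by (intro LIMSEQ_le) auto
  then show ?thesis using w ext by blast
qed

theorem theorem1p1:
  fixes \<alpha> \<beta> :: real
  assumes "\<alpha> \<noteq> 0"
  shows "\<exists>\<epsilon>0>0. \<forall>\<epsilon>. 0 < \<epsilon> \<and> \<epsilon> < \<epsilon>0 \<longrightarrow>
    (\<forall>s b' b :: real. s \<ge> - 7 / 4 + 4 * \<epsilon> \<and> b' = - 1 / 2 + 2 * \<epsilon> \<and> b = 1 / 2 + \<epsilon> \<longrightarrow>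
      (\<exists>C>0.
        (\<forall>u1 u2. schwartz u1 \<and> schwartz u2 \<longrightarrow>
           xnorm \<alpha> \<beta> s b' (dx (\<lambda>p. u1 p * u2 p)) \<le> C * xnorm \<alpha> \<beta> s b u1 * xnorm \<alpha> \<beta> s b u2) \<and>
        (\<forall>u1\<in>xspace \<alpha> \<beta> s b. \<forall>u2\<in>xspace \<alpha> \<beta> s b.
           \<exists>w\<in>xspace \<alpha> \<beta> s b'. dx_prod_extends u1 u2 w \<and>
             xspace_norm \<alpha> \<beta> s b' w \<le> C * xspace_norm \<alpha> \<beta> s b u1 * xspace_norm \<alpha> \<beta> s b u2)))"
proof (rule exI[of _ "1 / 100"], intro conjI allI impI)
  fix \<epsilon> s b' b :: real
  assume e: "0 < \<epsilon> \<and> \<epsilon> < 1 / 100"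
    and sb: "s \<ge> - 7 / 4 + 4 * \<epsilon> \<and> b' = - 1 / 2 + 2 * \<epsilon> \<and> b = 1 / 2 + \<epsilon>"
  interpret kawahara \<alpha> \<beta> \<epsilon> by unfold_locales (use assms e in auto)
  obtain C where C: "C > 0" "\<And>u v. schwartz u \<Longrightarrow> schwartz v \<Longrightarrow>
      xnorm \<alpha> \<beta> s b' (dx (\<lambda>p. u p * v p)) \<le> C * xnorm \<alpha> \<beta> s b u * xnorm \<alpha> \<beta> s b v"
    using schwartz_bilinear[of s] sb by auto
  have b: "b \<le> 1" "b' \<le> 1" using sb e by auto
  show "\<exists>C>0. (\<forall>u1 u2. schwartz u1 \<and> schwartz u2 \<longrightarrow>
           xnorm \<alpha> \<beta> s b' (dx (\<lambda>p. u1 p * u2 p)) \<le> C * xnorm \<alpha> \<beta> s b u1 * xnorm \<alpha> \<beta> s b u2) \<and>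
        (\<forall>u1\<in>xspace \<alpha> \<beta> s b. \<forall>u2\<in>xspace \<alpha> \<beta> s b.
           \<exists>w\<in>xspace \<alpha> \<beta> s b'. dx_prod_extends u1 u2 w \<and>
             xspace_norm \<alpha> \<beta> s b' w \<le> C * xspace_norm \<alpha> \<beta> s b u1 * xspace_norm \<alpha> \<beta> s b u2)"
    using C bilinear_extension[OF b C] by blast
qed simp

end
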